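(* Let $S_1$ be a closed oriented hyperbolic surface of genus $g\ge 2$ equipped with a geodesic triangulation with vertex set $V$, edge set $E$ and face set $F$, and let $c:E\to\mathbb{R}$ be its canonical edge weights. Assume $c_{ij}>0$ for every edge $ij\in E$. Let $S_2=\mathbb{D}/\Gamma$ be a closed hyperbolic surface and let $h:S_1\to S_2$ be a homeomorphism. Let $\mathcal{R}$ be the space of geodesic realizations of the $1$-skeleton graph $(V,E)$ into $S_2$ in the homotopy class induced by $h$, and let $D_c:\mathcal{R}\to\mathbb{R}$ be the discrete Dirichlet energy $$D_c(f)=\frac12\sum_{ij\in E}c_{ij}\,\ell_{ij}(f)^2,$$ where $\ell_{ij}(f)$ is the hyperbolic length of the geodesic edge $ij$ under $f$. Then: (1) $D_c$ is a proper and differentiable function on $\mathcal{R}$. (2) $D_c$ has a unique minimizer $f^*\in\mathcal{R}$, and for every initial realization $f_0\in\mathcal{R}$ the negative gradient flow $\frac{d}{dt}f_t=-\nabla D_c(f_t)$ starting at $f_0$ exists for all $t\ge 0$ and converges to $f^*$ exponentially fast as $t\to\infty$; that is, there are constants $C,\lambda>0$ (which may depend on $f_0$) such that $d_{\mathcal{R}}(f_t,f^* )\le C e^{-\lambda t}$ for all $t\ge 0$.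
   Context: $\mathbb{D}=\{z\in\mathbb{C}:|z|<1\}$ is the Poincaré disk with the hyperbolic metric $\frac{2|dz|}{1-|z|^2}$ of curvature $-1$ and distance $d_{\mathbb{D}}$. A closed hyperbolic surface is a closed oriented surface with a Riemannian metric of constant curvature $-1$; it is written $\mathbb{D}/\Gamma$, where $\Gamma$ is a discrete group of orientation-preserving isometries of $\mathbb{D}$ acting freely and cocompactly. A geodesic triangulation of $S_1$ is a triangulation whose edges are geodesic segments. It is given by an embedding $f^\dagger:(V,E)\to S_1$ of its $1$-skeleton graph. For a face $ijk$, $\alpha^{k}_{ij}$ denotes the interior angle at vertex $k$ (opposite the edge $ij$), and similarly for the other corners. If the two faces sharing the edge $ij$ are $ijk$ and $jil$, and $\ell^{(1)}_{ij}$ is the hyperbolic length of $ij$ in $S_1$, the canonical edge weight is $$c_{ij}=\left(\tan\frac{\alpha^{i}_{jk}+\alpha^{j}_{ki}-\alpha^{k}_{ij}}{2}+\tan\frac{\alpha^{i}_{lj}+\alpha^{j}_{il}-\alpha^{l}_{ji}}{2}\right)\frac{\tanh(\ell^{(1)}_{ij}/2)}{\ell^{(1)}_{ij}}.$$ A geodesic realization of $(V,E)$ into $S_2$ in the homotopy class induced by $h$ is a map from the graph to $S_2$, homotopic to $h\circ f^\dagger$, sending each edge to a (possibly degenerate) constant-speed geodesic segment. The space $\mathcal{R}$ of such realizations is a manifold of dimension $2|V|$, described as follows. Fix a spanning tree of $(V,E)$ and a lift of it, under $h\circ f^\dagger$, to the universal cover $\mathbb{D}$ of $S_2$. For each oriented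 edge $ij$ this determines an element $\gamma_{ij}\in\Gamma$ (with $\gamma_{ji}=\gamma_{ij}^{-1}$, and $\gamma_{ij}=1$ on tree edges) such that the lift of the edge $ij$ starting at the lifted vertex $i$ ends at $\gamma_{ij}$ applied to the lifted vertex $j$. A realization then corresponds to a point $(x_i)_{i\in V}\in\mathbb{D}^{|V|}$: vertex $i$ is placed at the projection of $x_i$, and the edge $ij$ is the projection of the geodesic segment from $x_i$ to $\gamma_{ij}x_j$, so that $\ell_{ij}(f)=d_{\mathbb{D}}(x_i,\gamma_{ij}x_j)$. The Riemannian metric on $\mathcal{R}$, used for the gradient and for the distance $d_{\mathcal{R}}$, is the one induced from the product hyperbolic metric on $\mathbb{D}^{|V|}$. "Proper" means that preimages of compact sets are compact. *)

theory Defs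
  imports "HOL-Complex_Analysis.Complex_Analysis" "HOL-Algebra.Bij"
begin

no_notation fps_nth (infixl \<open>$\<close> 75)

section \<open>The Poincare disk\<close>

abbreviation disk :: "complex set"
  where "disk \<equiv> ball 0 1"

definition disk_path :: "(real \<Rightarrow> complex) \<Rightarrow> complex \<Rightarrow> complex \<Rightarrow> bool"
  where "disk_path p z w \<longleftrightarrow>
    p C1_differentiable_on {0..1} \<and> p ` {0..1} \<subseteq> disk \<and> p 0 = z \<and> p 1 = w"

definition hlength :: "(real \<Rightarrow> complex) \<Rightarrow> real"
  where "hlength p =
    integral {0..1} (\<lambda>t. 2 * cmod (vector_derivative p (at t)) / (1 - (cmod (p t))\<^sup>2))"

definition hdist :: "complex \<Rightarrow> complex \<Rightarrow> real"
  where "hdist z w = Inf {hlength p | p. disk_path p z w}"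

text \<open>Constant-speed minimizing geodesic from \<open>a\<close> to \<open>b\<close>, parametrized by \<open>[0,1]\<close>
  (the constant path if \<open>a = b\<close>).\<close>

definition hgeodesic :: "complex \<Rightarrow> complex \<Rightarrow> (real \<Rightarrow> complex) \<Rightarrow> bool"
  where "hgeodesic a b p \<longleftrightarrow>
    p ` {0..1} \<subseteq> disk \<and> p 0 = a \<and> p 1 = b \<and>
    (\<forall>s\<in>{0..1}. \<forall>t\<in>{0..1}. hdist (p s) (p t) = \<bar>s - t\<bar> * hdist a b)"

text \<open>The angle at \<open>a\<close> between the geodesics from \<open>a\<close> to \<open>b\<close> and from \<open>a\<close> to \<open>c\<close>.  The hyperbolic metric
  is conformal to the Euclidean one, so the angle between the initial velocities is the Euclidean one.\<close>

definition hangle :: "complex \<Rightarrow> complex \<Rightarrow> complex \<Rightarrow> real"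
  where "hangle a b c = (THE \<theta>. \<exists>p p' u v.
    hgeodesic a b p \<and> hgeodesic a c p' \<and>
    (p has_vector_derivative u) (at 0 within {0..1}) \<and>
    (p' has_vector_derivative v) (at 0 within {0..1}) \<and>
    \<theta> = arccos ((u \<bullet> v) / (norm u * norm v)))"


subsection \<open>Closed form of the distance\<close>

lemma Moebius_deriv:
  assumes a: "cmod a < 1" and z: "cmod z < 1"
  shows "(Moebius_function \<theta> a has_field_derivative
      exp (\<i> * of_real \<theta>) * (1 - cnj a * a) / (1 - cnj a * z)\<^sup>2) (at z)"
proof -
  have "cmod (cnj a * z) < 1"
    using a z by (metis complex_mod_cnj mult_strict_mono' norm_ge_zero norm_mult mult_1)
  then have "1 - cnj a * z \<noteq> 0" by force
  then show ?thesis
    unfolding Moebius_function_def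
    by (auto intro!: derivative_eq_intros simp: field_simps power2_eq_square)
qed

lemma Moebius_norm:
  assumes a: "cmod a < 1" and z: "cmod z < 1"
  shows "1 - (cmod (Moebius_function \<theta> a z))\<^sup>2
       = (1 - (cmod a)\<^sup>2) * (1 - (cmod z)\<^sup>2) / (cmod (1 - cnj a * z))\<^sup>2"
proof -
  have "cmod (cnj a * z) < 1"
    using a z by (metis complex_mod_cnj mult_strict_mono' norm_ge_zero norm_mult mult_1)
  then have n: "cmod (1 - cnj a * z) \<noteq> 0" by force
  have "complex_of_real ((cmod (1 - cnj a * z))\<^sup>2 - (cmod (z - a))\<^sup>2)
      = complex_of_real ((1 - (cmod a)\<^sup>2) * (1 - (cmod z)\<^sup>2))"
    unfolding of_real_mult of_real_diff of_real_1 complex_norm_square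
    by (simp add: algebra_simps)
  then have k: "(cmod (1 - cnj a * z))\<^sup>2 - (cmod (z - a))\<^sup>2 = (1 - (cmod a)\<^sup>2) * (1 - (cmod z)\<^sup>2)"
    using of_real_eq_iff by blast
  have "cmod (Moebius_function \<theta> a z) = cmod (z - a) / cmod (1 - cnj a * z)"
    by (simp add: Moebius_function_def norm_divide norm_mult)
  then show ?thesis
    using n by (simp add: k[symmetric] power_divide diff_divide_distrib)
qed

lemma Moebius_path:
  assumes a: "cmod a < 1" and p: "disk_path p z w"
  shows "disk_path (Moebius_function \<theta> a \<circ> p) (Moebius_function \<theta> a z) (Moebius_function \<theta> a w)"
    and "hlength (Moebius_function \<theta> a \<circ> p) = hlength p"
proof -
  let ?M = "Moebius_function \<theta> a"
  let ?M' = "\<lambda>z. exp (\<i> * of_real \<theta>) * (1 - cnj a * a) / (1 - cnj a * z)\<^sup>2"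
  have n1: "cmod (p t) < 1" if "t \<in> {0..1}" for t
    using p that by (auto simp: disk_path_def image_subset_iff)
  have nz: "1 - cnj a * p t \<noteq> 0" if "t \<in> {0..1}" for t
  proof -
    have "cmod (cnj a * p t) < 1"
      using a n1[OF that] by (metis complex_mod_cnj mult_strict_mono' norm_ge_zero norm_mult mult_1)
    then show ?thesis by force
  qed
  obtain D where D: "\<And>t. t \<in> {0..1} \<Longrightarrow> (p has_vector_derivative D t) (at t)"
      "continuous_on {0..1} D"
    using p unfolding disk_path_def C1_differentiable_on_def by blast
  have cp: "continuous_on {0..1} p"
    using D(1) by (meson continuous_at_imp_continuous_on has_vector_derivative_continuous)
  have d: "(?M \<circ> p has_vector_derivative D t * ?M' (p t)) (at t)" if "t \<in> {0..1}" for t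
    using field_vector_diff_chain_at[OF D(1)[OF that] Moebius_deriv[OF a n1[OF that]]] .
  have "continuous_on {0..1} (\<lambda>t. D t * ?M' (p t))"
    using nz by (intro continuous_intros D cp) auto
  then have "?M \<circ> p C1_differentiable_on {0..1}"
    unfolding C1_differentiable_on_def
    by (intro exI[of _ "\<lambda>t. D t * ?M' (p t)"] conjI ballI d) assumption+
  moreover have "(?M \<circ> p) ` {0..1} \<subseteq> disk"
    using n1 a by (auto intro!: Moebius_function_norm_lt_1)
  ultimately show "disk_path (?M \<circ> p) (?M z) (?M w)"
    using p by (auto simp: disk_path_def)
  show "hlength (?M \<circ> p) = hlength p"
    unfolding hlength_def
  proof (rule integral_cong)
    fix t :: real assume t: "t \<in> {0..1}"
    have "(cmod a)\<^sup>2 < 1" using a by (simp add: power_less_one_iff abs_square_less_1)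
    moreover have "cmod (1 - cnj a * a) = 1 - (cmod a)\<^sup>2"
    proof -
      have "1 - cnj a * a = of_real (1 - (cmod a)\<^sup>2)"
        unfolding of_real_diff of_real_1 complex_norm_square by (simp add: mult.commute)
      then show ?thesis using \<open>(cmod a)\<^sup>2 < 1\<close> by (metis abs_of_pos diff_gt_0_iff_gt norm_of_real)
    qed
    moreover have "(cmod (p t))\<^sup>2 < 1" using n1[OF t] by (simp add: power_less_one_iff abs_square_less_1)
    ultimately show "2 * cmod (vector_derivative (?M \<circ> p) (at t)) / (1 - (cmod ((?M \<circ> p) t))\<^sup>2)
        = 2 * cmod (vector_derivative p (at t)) / (1 - (cmod (p t))\<^sup>2)"
      using nz[OF t]
      by (simp add: vector_derivative_at[OF d[OF t]] vector_derivative_at[OF D(1)[OF t]]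
          Moebius_norm[OF a n1[OF t]] norm_mult norm_divide norm_power divide_simps del: vector_derivative_chain_at)
  qed
qed

lemma artanh_deriv:
  assumes f: "(f has_real_derivative f') (at t within S)" and "\<bar>f t\<bar> < 1"
  shows "((\<lambda>t. 2 * artanh (f t)) has_real_derivative 2 * f' / (1 - (f t)\<^sup>2)) (at t within S)"
proof -
  have "(artanh has_field_derivative 1 / (1 - (f t)\<^sup>2)) (at (f t))"
    by (rule artanh_real_has_field_derivative) fact
  from DERIV_cmult[OF DERIV_chain2[OF this f], of 2] show ?thesis by simp
qed

lemma hlength_radial_le:
  assumes p: "disk_path p 0 (of_real r)" and "0 \<le> r"
  shows "2 * artanh r \<le> hlength p"
proof -
  have n1: "cmod (p t) < 1" if "t \<in> {0..1}" for t
    using p that by (auto simp: disk_path_def image_subset_iff)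
  have s1: "(cmod (p t))\<^sup>2 < 1" if "t \<in> {0..1}" for t
    using n1[OF that] by (simp add: power_less_one_iff abs_square_less_1)
  have r1: "\<bar>Re (p t)\<bar> < 1" if "t \<in> {0..1}" for t
    using n1[OF that] abs_Re_le_cmod[of "p t"] by linarith
  obtain D where D: "\<And>t. t \<in> {0..1} \<Longrightarrow> (p has_vector_derivative D t) (at t)"
      "continuous_on {0..1} D"
    using p unfolding disk_path_def C1_differentiable_on_def by blast
  have cp: "continuous_on {0..1} p"
    using D(1) by (meson continuous_at_imp_continuous_on has_vector_derivative_continuous)
  have dR: "((\<lambda>t. 2 * artanh (Re (p t))) has_vector_derivative
      2 * Re (D t) / (1 - (Re (p t))\<^sup>2)) (at t within {0..1})" if t: "t \<in> {0..1}" for t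
  proof -
    have "((\<lambda>t. Re (p t)) has_field_derivative Re (D t)) (at t within {0..1})"
      using D(1)[OF t] has_vector_derivative_at_within
      by (metis bounded_linear.has_vector_derivative bounded_linear_Re
          has_real_derivative_iff_has_vector_derivative)
    then show ?thesis
      unfolding has_real_derivative_iff_has_vector_derivative[symmetric]
      using artanh_deriv r1[OF t] by blast
  qed
  have i1: "((\<lambda>t. 2 * Re (D t) / (1 - (Re (p t))\<^sup>2)) has_integral 2 * artanh r) {0..1}"
    using fundamental_theorem_of_calculus[OF _ dR] p by (auto simp: disk_path_def)
  have "continuous_on {0..1} (\<lambda>t. 2 * cmod (D t) / (1 - (cmod (p t))\<^sup>2))"
    using s1 by (intro continuous_intros D cp) fastforce
  then have i2: "(\<lambda>t. 2 * cmod (D t) / (1 - (cmod (p t))\<^sup>2)) integrable_on {0..1}"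
    by (rule integrable_continuous_interval)
  have "2 * artanh r \<le> integral {0..1} (\<lambda>t. 2 * cmod (D t) / (1 - (cmod (p t))\<^sup>2))"
  proof (rule has_integral_le[OF i1 integrable_integral[OF i2]])
    fix t :: real assume t: "t \<in> {0..1}"
    have "(Re (p t))\<^sup>2 \<le> (cmod (p t))\<^sup>2"
      using abs_Re_le_cmod[of "p t"] by (simp add: abs_le_square_iff[symmetric])
    then show "2 * Re (D t) / (1 - (Re (p t))\<^sup>2) \<le> 2 * cmod (D t) / (1 - (cmod (p t))\<^sup>2)"
      using s1[OF t] complex_Re_le_cmod[of "D t"] by (intro frac_le) auto
  qed
  also have "\<dots> = hlength p"
    unfolding hlength_def
    by (rule integral_cong) (simp add: vector_derivative_at[OF D(1)])
  finally show ?thesis .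
qed

lemma radial_path:
  assumes "0 \<le> r" "r < 1"
  shows "disk_path (\<lambda>t. of_real (t * r)) 0 (of_real r)"
    and "hlength (\<lambda>t. of_real (t * r)) = 2 * artanh r"
proof -
  have d: "((\<lambda>t. complex_of_real (t * r)) has_vector_derivative of_real r) (at t)" for t
    by (auto intro!: derivative_eq_intros simp: scaleR_conv_of_real)
  have b: "\<bar>t * r\<bar> < 1" if "t \<in> {0..1}" for t
  proof -
    have "t * r \<le> 1 * r" using that assms by (intro mult_right_mono) auto
    moreover have "0 \<le> t * r" using that assms by auto
    ultimately show ?thesis using assms by auto
  qed
  have "cmod (complex_of_real (t * r)) < 1" if "t \<in> {0..1}" for t
    using b[OF that] by (simp only: norm_of_real)
  then show "disk_path (\<lambda>t. of_real (t * r)) 0 (of_real r)"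
    unfolding disk_path_def C1_differentiable_on_def
    using d by (auto simp del: of_real_mult intro!: exI[of _ "\<lambda>_. of_real r"])
  have "((\<lambda>t. 2 * r / (1 - (t * r)\<^sup>2)) has_integral 2 * artanh (1 * r) - 2 * artanh (0 * r)) {0..1}"
  proof (rule fundamental_theorem_of_calculus)
    fix t :: real assume t: "t \<in> {0..1}"
    show "((\<lambda>t. 2 * artanh (t * r)) has_vector_derivative 2 * r / (1 - (t * r)\<^sup>2)) (at t within {0..1})"
      unfolding has_real_derivative_iff_has_vector_derivative[symmetric]
    proof (rule artanh_deriv)
      show "((\<lambda>t. t * r) has_real_derivative r) (at t within {0..1})"
        by (auto intro!: derivative_eq_intros)
    qed (rule b[OF t])
  qed auto
  then have "integral {0..1} (\<lambda>t. 2 * r / (1 - (t * r)\<^sup>2)) = 2 * artanh r"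
    by (simp add: integral_unique)
  then show "hlength (\<lambda>t. of_real (t * r)) = 2 * artanh r"
    unfolding hlength_def vector_derivative_at[OF d] norm_of_real
    using assms by simp
qed

theorem hdist_eq_artanh:
  assumes z: "z \<in> disk" and w: "w \<in> disk"
  shows "hdist z w = 2 * artanh (cmod (w - z) / cmod (1 - cnj z * w))"
proof -
  define u where "u = Moebius_function 0 z w"
  define r where "r = cmod u"
  define \<theta> where "\<theta> = - Arg u"
  have r1: "0 \<le> r" "r < 1"
    using z w by (auto simp: r_def u_def intro!: Moebius_function_norm_lt_1)
  have r_eq: "r = cmod (w - z) / cmod (1 - cnj z * w)"
    by (simp add: r_def u_def Moebius_function_def norm_divide)
  have u_pol: "u = of_real r * exp (\<i> * of_real (Arg u))"
    by (cases "u = 0") (auto simp: r_def Arg_eq)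
  have rot: "Moebius_function \<theta> 0 u = of_real r"
    by (subst u_pol) (simp add: Moebius_function_def \<theta>_def exp_minus)
  have rot': "Moebius_function (-\<theta>) 0 (of_real r) = u"
    using u_pol by (simp add: Moebius_function_def \<theta>_def mult.commute)
  have bk: "Moebius_function 0 (-z) u = w"
    unfolding u_def using Moebius_function_compose[of "-z" z w] z w by auto
  have zz: "Moebius_function 0 z z = 0" "Moebius_function \<theta> 0 0 = 0"
      "Moebius_function (-\<theta>) 0 0 = 0" "Moebius_function 0 (-z) 0 = z"
    by (simp_all add: Moebius_function_def)
  have lower: "2 * artanh r \<le> hlength p" if p: "disk_path p z w" for p
  proof -
    note m1 = Moebius_path[of z p z w 0, OF _ p]
    note m2 = Moebius_path[of 0 "Moebius_function 0 z \<circ> p" 0 u \<theta>]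
    show ?thesis
      using m1 m2 hlength_radial_le[of "Moebius_function \<theta> 0 \<circ> (Moebius_function 0 z \<circ> p)" r] z r1
      by (simp add: zz rot u_def[symmetric])
  qed
  have "\<exists>p. disk_path p z w \<and> hlength p = 2 * artanh r"
  proof -
    let ?l = "\<lambda>t. complex_of_real (t * r)"
    note m1 = Moebius_path[of 0 ?l 0 "of_real r" "-\<theta>"]
    note m2 = Moebius_path[of "-z" "Moebius_function (-\<theta>) 0 \<circ> ?l" 0 u 0]
    show ?thesis
      using m1 m2 radial_path[OF r1] z
      by (intro exI[of _ "Moebius_function 0 (-z) \<circ> (Moebius_function (-\<theta>) 0 \<circ> ?l)"])
         (simp add: zz rot' bk)
  qed
  then have "hdist z w = 2 * artanh r"
    unfolding hdist_def using lower by (intro cInf_eq_minimum) (force, blast)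
  then show ?thesis by (simp add: r_eq)
qed


section \<open>Closed hyperbolic surfaces\<close>

text \<open>For an isometry of the disk, preserving the orientation is the same as being holomorphic.
  Elements of the group \<open>BijGroup disk\<close> are extensional, so two isometries agreeing on the disk
  are equal, and \<open>discrete\<close> refers to the topology of pointwise convergence on the disk.\<close>

definition closed_surface_group :: "(complex \<Rightarrow> complex) set \<Rightarrow> bool"
  where "closed_surface_group \<Gamma> \<longleftrightarrow>
    subgroup \<Gamma> (BijGroup disk) \<and>
    (\<forall>g\<in>\<Gamma>. g holomorphic_on disk \<and> (\<forall>z\<in>disk. \<forall>w\<in>disk. hdist (g z) (g w) = hdist z w)) \<and>
    discrete \<Gamma> \<and>
    (\<forall>g\<in>\<Gamma>. \<forall>z\<in>disk. g z = z \<longrightarrow> g = \<one>\<^bsub>BijGroup disk\<^esub>) \<and>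
    (\<exists>K. compact K \<and> K \<subseteq> disk \<and> (\<Union>g\<in>\<Gamma>. g ` K) = disk)"

text \<open>The points of the surface \<open>disk / \<Gamma>\<close> are the \<open>\<Gamma>\<close>-orbits.\<close>

definition surface_proj :: "(complex \<Rightarrow> complex) set \<Rightarrow> complex \<Rightarrow> complex set"
  where "surface_proj \<Gamma> z = (\<lambda>g. g z) ` \<Gamma>"

definition surface :: "(complex \<Rightarrow> complex) set \<Rightarrow> complex set topology"
  where "surface \<Gamma> =
    topology (\<lambda>U. U \<subseteq> surface_proj \<Gamma> ` disk \<and> open {z \<in> disk. surface_proj \<Gamma> z \<in> U})"

lemma openin_surface:
  "openin (surface \<Gamma>) U \<longleftrightarrow> U \<subseteq> surface_proj \<Gamma> ` disk \<and> open {z \<in> disk. surface_proj \<Gamma> z \<in> U}"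
proof -
  have "istopology (\<lambda>U. U \<subseteq> surface_proj \<Gamma> ` disk \<and> open {z \<in> disk. surface_proj \<Gamma> z \<in> U})"
    unfolding istopology_def
  proof (intro conjI allI impI)
    fix S T
    assume S: "S \<subseteq> surface_proj \<Gamma> ` disk \<and> open {z \<in> disk. surface_proj \<Gamma> z \<in> S}"
      and T: "T \<subseteq> surface_proj \<Gamma> ` disk \<and> open {z \<in> disk. surface_proj \<Gamma> z \<in> T}"
    show "S \<inter> T \<subseteq> surface_proj \<Gamma> ` disk" using S by blast
    have eq: "{z \<in> disk. surface_proj \<Gamma> z \<in> S \<inter> T} = {z \<in> disk. surface_proj \<Gamma> z \<in> S} \<inter> {z \<in> disk. surface_proj \<Gamma> z \<in> T}"
      by blast
    show "open {z \<in> disk. surface_proj \<Gamma> z \<in> S \<inter> T}"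
      unfolding eq using S T by (intro open_Int) blast+
  next
    fix \<K> assume K: "\<forall>K\<in>\<K>. K \<subseteq> surface_proj \<Gamma> ` disk \<and> open {z \<in> disk. surface_proj \<Gamma> z \<in> K}"
    show "\<Union>\<K> \<subseteq> surface_proj \<Gamma> ` disk" using K by blast
    have eq: "{z \<in> disk. surface_proj \<Gamma> z \<in> \<Union>\<K>} = (\<Union>K\<in>\<K>. {z \<in> disk. surface_proj \<Gamma> z \<in> K})" by blast
    show "open {z \<in> disk. surface_proj \<Gamma> z \<in> \<Union>\<K>}"
      unfolding eq using K by (intro open_UN) blast
  qed
  then show ?thesis unfolding surface_def by (simp add: topology_inverse')
qed

lemma topspace_surface: "topspace (surface \<Gamma>) = surface_proj \<Gamma> ` disk"
proof -
  have "{z \<in> disk. surface_proj \<Gamma> z \<in> surface_proj \<Gamma> ` disk} = disk" by blast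
  then have "openin (surface \<Gamma>) (surface_proj \<Gamma> ` disk)" by (simp add: openin_surface)
  then have "surface_proj \<Gamma> ` disk \<subseteq> topspace (surface \<Gamma>)" by (rule openin_subset)
  moreover have "topspace (surface \<Gamma>) \<subseteq> surface_proj \<Gamma> ` disk"
    using openin_surface[of \<Gamma> "topspace (surface \<Gamma>)"] by simp
  ultimately show ?thesis by (rule subset_antisym[rotated])
qed

lemma quotient_map_proj: "quotient_map (top_of_set disk) (surface \<Gamma>) (surface_proj \<Gamma>)"
proof -
  have "openin (top_of_set disk) {z \<in> disk. surface_proj \<Gamma> z \<in> U} \<longleftrightarrow> open {z \<in> disk. surface_proj \<Gamma> z \<in> U}" for U
    by (subst openin_open_eq) (simp_all add: subset_iff)
  then show ?thesis
    unfolding quotient_map_def topspace_surface openin_surface topspace_euclidean_subtopology by blast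
qed

text \<open>\<open>q\<close> lifts the map \<open>\<phi>\<close> from \<open>S\<close> to the surface \<open>disk / \<Gamma>\<close> to the universal cover.\<close>

definition is_lift ::
    "(complex \<Rightarrow> complex) set \<Rightarrow> 'a::topological_space set \<Rightarrow> ('a \<Rightarrow> complex set) \<Rightarrow> ('a \<Rightarrow> complex) \<Rightarrow> bool"
  where "is_lift \<Gamma> S \<phi> q \<longleftrightarrow>
    continuous_on S q \<and> q ` S \<subseteq> disk \<and> (\<forall>s\<in>S. surface_proj \<Gamma> (q s) = \<phi> s)"


section \<open>Geodesic triangulations\<close>

text \<open>The vertex set of a triangulation is the finite type \<open>'v\<close>, edges and faces are sets of two and of three
  vertices.  The geometric realization of a complex is taken inside \<open>real ^ 'v\<close>, in barycentric
  coordinates.\<close>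

definition vertex :: "'v::finite \<Rightarrow> real ^ 'v"
  where "vertex i = axis i 1"

definition cell :: "'v::finite set \<Rightarrow> (real ^ 'v) set"
  where "cell \<sigma> = convex hull (vertex ` \<sigma>)"

definition carrier_1 :: "'v::finite set set \<Rightarrow> (real ^ 'v) set"
  where "carrier_1 E = range vertex \<union> (\<Union>e\<in>E. cell e)"

definition carrier_2 :: "'v::finite set set \<Rightarrow> 'v set set \<Rightarrow> (real ^ 'v) set"
  where "carrier_2 E F = carrier_1 E \<union> (\<Union>f\<in>F. cell f)"

text \<open>A geodesic triangulation is a homeomorphism \<open>\<tau>\<close> from the realization of a simplicial complex onto the
  surface such that every edge is the projection of a geodesic segment of the disk.  The
  restriction of \<open>\<tau>\<close> to \<open>carrier_1 E\<close> is the embedding of the 1-skeleton.\<close>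

definition geodesic_triangulation ::
    "(complex \<Rightarrow> complex) set \<Rightarrow> 'v::finite set set \<Rightarrow> 'v set set \<Rightarrow> (real ^ 'v \<Rightarrow> complex set) \<Rightarrow> bool"
  where "geodesic_triangulation \<Gamma> E F \<tau> \<longleftrightarrow>
    (\<forall>e\<in>E. card e = 2) \<and> (\<forall>f\<in>F. card f = 3) \<and>
    (\<forall>f\<in>F. \<forall>e. e \<subseteq> f \<and> card e = 2 \<longrightarrow> e \<in> E) \<and>
    homeomorphic_map (top_of_set (carrier_2 E F)) (surface \<Gamma>) \<tau> \<and>
    (\<forall>i j. {i, j} \<in> E \<longrightarrow> (\<exists>q p. is_lift \<Gamma> (cell {i, j}) \<tau> q \<and>
        hgeodesic (q (vertex i)) (q (vertex j)) p \<and> q ` cell {i, j} = p ` {0..1}))"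

text \<open>Edge lengths and angles are measured in a lift of the edge or face to the disk; they do not depend on
  the lift, as any two lifts differ by an isometry in \<open>\<Gamma>\<close>.  In \<open>face_angle \<Gamma> \<tau> k i j\<close> the angle of
  the face \<open>ijk\<close> is the one at \<open>k\<close>, opposite the edge \<open>ij\<close>.\<close>

definition edge_length ::
    "(complex \<Rightarrow> complex) set \<Rightarrow> (real ^ 'v::finite \<Rightarrow> complex set) \<Rightarrow> 'v \<Rightarrow> 'v \<Rightarrow> real"
  where "edge_length \<Gamma> \<tau> i j =
    (let q = (SOME q. is_lift \<Gamma> (cell {i, j}) \<tau> q) in hdist (q (vertex i)) (q (vertex j)))"

definition face_angle ::
    "(complex \<Rightarrow> complex) set \<Rightarrow> (real ^ 'v::finite \<Rightarrow> complex set) \<Rightarrow> 'v \<Rightarrow> 'v \<Rightarrow> 'v \<Rightarrow> real"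
  where "face_angle \<Gamma> \<tau> k i j =
    (let q = (SOME q. is_lift \<Gamma> (cell {i, j, k}) \<tau> q)
     in hangle (q (vertex k)) (q (vertex i)) (q (vertex j)))"

text \<open>In a triangulated closed surface the sum has exactly two terms, one for each face at \<open>ij\<close>.\<close>

definition canonical_weight ::
    "(complex \<Rightarrow> complex) set \<Rightarrow> 'v::finite set set \<Rightarrow> (real ^ 'v \<Rightarrow> complex set) \<Rightarrow> 'v \<Rightarrow> 'v \<Rightarrow> real"
  where "canonical_weight \<Gamma> F \<tau> i j =
    (\<Sum>k\<in>{k. {i, j, k} \<in> F}.
       tan ((face_angle \<Gamma> \<tau> i j k + face_angle \<Gamma> \<tau> j k i - face_angle \<Gamma> \<tau> k i j) / 2))
    * (tanh (edge_length \<Gamma> \<tau> i j / 2) / edge_length \<Gamma> \<tau> i j)"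


section \<open>Geodesic realizations in a homotopy class\<close>

definition edge_connected :: "'v set set \<Rightarrow> bool"
  where "edge_connected T \<longleftrightarrow> (\<forall>i j. (i, j) \<in> {(a, b). {a, b} \<in> T}\<^sup>*)"

definition has_cycle :: "'v set set \<Rightarrow> bool"
  where "has_cycle T \<longleftrightarrow> (\<exists>vs. 3 \<le> length vs \<and> distinct vs \<and> {last vs, hd vs} \<in> T \<and>
    (\<forall>n. Suc n < length vs \<longrightarrow> {vs ! n, vs ! Suc n} \<in> T))"

definition spanning_tree :: "'v set set \<Rightarrow> 'v set set \<Rightarrow> bool"
  where "spanning_tree E T \<longleftrightarrow> T \<subseteq> E \<and> edge_connected T \<and> \<not> has_cycle T"

text \<open>Here \<open>\<phi>\<close> maps the 1-skeleton to \<open>disk / \<Gamma>\<close> and \<open>q\<close> is a lift of \<open>\<phi>\<close> over a spanning tree.  The element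
  \<open>\<gamma>\<close> of \<open>\<Gamma>\<close> attached to the oriented edge \<open>ij\<close> is such that the lift of the edge starting at the
  lifted vertex \<open>i\<close> ends at \<open>\<gamma>\<close> applied to the lifted vertex \<open>j\<close>.\<close>

definition edge_element ::
    "(complex \<Rightarrow> complex) set \<Rightarrow> (real ^ 'v::finite \<Rightarrow> complex set) \<Rightarrow> (real ^ 'v \<Rightarrow> complex)
      \<Rightarrow> 'v \<Rightarrow> 'v \<Rightarrow> complex \<Rightarrow> complex"
  where "edge_element \<Gamma> \<phi> q i j = (THE \<gamma>. \<gamma> \<in> \<Gamma> \<and>
    (\<exists>p. is_lift \<Gamma> (cell {i, j}) \<phi> p \<and>
      p (vertex i) = q (vertex i) \<and> p (vertex j) = \<gamma> (q (vertex j))))"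

text \<open>A realization is given by the lifts \<open>x $ i\<close> of the images of the vertices; its edge \<open>ij\<close> is the projection
  of the geodesic segment from \<open>x $ i\<close> to \<open>\<gamma> i j (x $ j)\<close>.\<close>

definition realizations :: "(complex ^ 'v::finite) set"
  where "realizations = {x. \<forall>i. x $ i \<in> disk}"

definition realized_length ::
    "('v::finite \<Rightarrow> 'v \<Rightarrow> complex \<Rightarrow> complex) \<Rightarrow> complex ^ 'v \<Rightarrow> 'v \<Rightarrow> 'v \<Rightarrow> real"
  where "realized_length \<gamma> x i j = hdist (x $ i) (\<gamma> i j (x $ j))"

text \<open>The sum runs over oriented edges, so that every edge is counted twice; this accounts for the additional
  factor \<open>1/2\<close>.\<close>

definition dirichlet_energy ::
    "'v::finite set set \<Rightarrow> ('v \<Rightarrow> 'v \<Rightarrow> real) \<Rightarrow> ('v \<Rightarrow> 'v \<Rightarrow> complex \<Rightarrow> complex) \<Rightarrow> complex ^ 'v \<Rightarrow> real"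
  where "dirichlet_energy E c \<gamma> x =
    1/2 * (1/2 * (\<Sum>(i, j)\<in>{(i, j). {i, j} \<in> E}. c i j * (realized_length \<gamma> x i j)\<^sup>2))"


section \<open>The product hyperbolic metric and gradient flows\<close>

definition riem :: "complex ^ 'v::finite \<Rightarrow> complex ^ 'v \<Rightarrow> complex ^ 'v \<Rightarrow> real"
  where "riem x u v = (\<Sum>i\<in>UNIV. 4 / (1 - (cmod (x $ i))\<^sup>2)\<^sup>2 * (u $ i \<bullet> v $ i))"

definition riem_length :: "(real \<Rightarrow> complex ^ 'v::finite) \<Rightarrow> real"
  where "riem_length p = integral {0..1}
    (\<lambda>t. sqrt (riem (p t) (vector_derivative p (at t)) (vector_derivative p (at t))))"

definition riem_dist :: "complex ^ 'v::finite \<Rightarrow> complex ^ 'v \<Rightarrow> real"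
  where "riem_dist x y = Inf {riem_length p | p.
    p C1_differentiable_on {0..1} \<and> p ` {0..1} \<subseteq> realizations \<and> p 0 = x \<and> p 1 = y}"

definition riem_gradient :: "(complex ^ 'v::finite \<Rightarrow> real) \<Rightarrow> complex ^ 'v \<Rightarrow> complex ^ 'v"
  where "riem_gradient D x = (THE G. (D has_derivative (\<lambda>v. riem x G v)) (at x))"

definition negative_gradient_flow ::
    "(complex ^ 'v::finite \<Rightarrow> real) \<Rightarrow> real set \<Rightarrow> complex ^ 'v \<Rightarrow> (real \<Rightarrow> complex ^ 'v) \<Rightarrow> bool"
  where "negative_gradient_flow D I x\<^sub>0 x \<longleftrightarrow>
    x 0 = x\<^sub>0 \<and> (\<forall>t\<in>I. x t \<in> realizations \<and>
      (x has_vector_derivative - riem_gradient D (x t)) (at t within I))"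

end

theory Submission
  imports Defs
begin

text \<open>Write \<open>log\<^sub>a x\<close> for the initial velocity of the unit-time geodesic from \<open>a\<close> to \<open>x\<close>.  The gradient of
  \<open>d(a, x)\<^sup>2 / 2\<close> in \<open>a\<close> is \<open>- log\<^sub>a x\<close>, so the gradient flow of the energy moves every vertex along a weighted
  sum of such logarithms.  The law of cosines shows that \<open>exp\<^sub>a\<close> does not decrease distances, with a definite gain
  for non-collinear vectors; hence Reshetnyak's quadrilateral inequality, and the energy is geodesically convex.
  Consequently the distance of two gradient flow lines does not increase, which gives uniqueness of the flow and
  confines it to a compact set.

  The energy is proper: the lifted simplices show that the edge elements generate \<open>\<Gamma>\<close>, and the points which a
  generating set displaces by a bounded amount form a bounded set, because \<open>\<Gamma>\<close> is cocompact, acts properly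
  discontinuously and has trivial center.  If the Hessian at the minimizer were degenerate, the energy would be
  constant along a geodesic ray, contradicting properness.  So it is positive definite, and the squared distance
  to the minimizer decays exponentially along the flow.\<close>

subsection \<open>Real-variable preliminaries\<close>

text \<open>No second derivative of the distance is computed. Convexity is used in two-point form:
  along the geodesic from \<open>y\<close> to \<open>x\<close> the derivative of the energy grows by
  \<open>pull x y + pull y x\<close>, a weighted sum of \<open>corner_sum\<close> over the edges. In
  place of the Hessian stands the explicit form \<open>edge_form\<close>, which bounds
  \<open>corner_sum\<close> from below up to a factor. One of its terms is one-sided, since
  comparison bounds the first variation of an edge from above only; at a critical point the weighted
  sum of these variations vanishes, which supplies the other side. An edge may shrink to a point,
  where the distance is not differentiable. Hence squared distances are used, written through
  \<open>artanh_quot\<close>, the power series of artanh (sqrt \<rho>) / sqrt \<rho>, and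
  \<open>edge_form\<close> has an extra term for degenerate edges. The tangent vectors
  \<open>hlog\<close> are taken in orthonormal frames, so that inner products and norms are
  Euclidean; the conformal factor enters when derivatives are taken in disk coordinates.\<close>

definition artanh_quot :: "real \<Rightarrow> real"
  where "artanh_quot \<rho> = (\<Sum>n. (1 / real (2 * n + 1)) * \<rho> ^ n)"

lemma artanh_quot_summable:
  assumes "norm (\<rho>::real) < 1"
  shows "summable (\<lambda>n. (1 / real (2 * n + 1)) * \<rho> ^ n)"
proof (rule summable_comparison_test'[OF summable_geometric])
  show "norm (norm \<rho>) < 1" using assms by simp
  show "norm ((1 / real (2 * n + 1)) * \<rho> ^ n) \<le> norm \<rho> ^ n" if "n \<ge> 0" for n
    using mult_left_mono[of 1 "real (2 * n + 1)" "norm \<rho> ^ n"]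
    by (simp add: norm_mult power_abs divide_simps algebra_simps)
qed

lemma artanh_eq_quot:
  assumes "\<bar>r\<bar> < 1"
  shows "artanh r = r * artanh_quot (r\<^sup>2)"
proof -
  define x where "x = (1 + r) / (1 - r)"
  have x: "x > 0" "(x - 1) / (x + 1) = r"
    using assms by (auto simp: x_def field_simps)
  have "(\<lambda>n. (2 * r ^ (2*n+1) / of_nat (2*n+1))) sums ln x"
    using ln_series_quadratic[OF x(1)] unfolding x(2) .
  then have "(\<lambda>n. (2 * r ^ (2*n+1) / of_nat (2*n+1)) / 2) sums (ln x / 2)"
    by (rule sums_divide)
  moreover have "(2 * r ^ (2*n+1) / of_nat (2*n+1)) / 2 = r * ((1 / real (2 * n + 1)) * (r\<^sup>2) ^ n)" for n
  proof -
    have "2 * X / Y / 2 = r * (1 / Y * Z)" if "X = r * Z" for X Y Z :: real using that by simp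
    moreover have "r ^ (2*n+1) = r * (r\<^sup>2)^n" by (simp add: power_mult)
    ultimately show ?thesis by blast
  qed
  ultimately have s: "(\<lambda>n. r * ((1 / real (2 * n + 1)) * (r\<^sup>2) ^ n)) sums (artanh r)"
    by (simp only: artanh_def x_def)
  have "norm (r\<^sup>2) < 1" using assms by (simp add: abs_square_less_1)
  then have "(\<lambda>n. r * ((1 / real (2 * n + 1)) * (r\<^sup>2) ^ n)) sums (r * artanh_quot (r\<^sup>2))"
    unfolding artanh_quot_def by (intro sums_mult summable_sums artanh_quot_summable)
  with s show ?thesis by (rule sums_unique2)
qed

definition artanh_quot_deriv :: "real \<Rightarrow> real"
  where "artanh_quot_deriv \<rho> = (\<Sum>n. diffs (\<lambda>n. 1 / real (2 * n + 1)) n * \<rho> ^ n)"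

lemma artanh_quot_diffs_summable:
  assumes "norm (\<rho>::real) < 1"
  shows "summable (\<lambda>n. diffs (\<lambda>n. 1 / real (2 * n + 1)) n * \<rho> ^ n)"
  using assms artanh_quot_summable by (intro termdiff_converges[of \<rho> 1]) auto

lemma DERIV_artanh_quot:
  assumes "norm \<rho> < 1"
  shows "(artanh_quot has_field_derivative artanh_quot_deriv \<rho>) (at \<rho>)"
  unfolding artanh_quot_def[abs_def] artanh_quot_deriv_def
  by (rule termdiffs_strong'[OF artanh_quot_summable assms])

lemma continuous_on_artanh_quot_deriv: "continuous_on {-1<..<1} artanh_quot_deriv"
proof (rule continuous_at_imp_continuous_on, rule ballI)
  fix x :: real assume "x \<in> {-1<..<1}"
  then have x: "norm x < 1" by auto
  have "(artanh_quot_deriv has_field_derivative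
      (\<Sum>n. diffs (diffs (\<lambda>n. 1 / real (2 * n + 1))) n * x ^ n)) (at x)"
    unfolding artanh_quot_deriv_def[abs_def]
    by (rule termdiffs_strong'[OF artanh_quot_diffs_summable x])
  then show "isCont artanh_quot_deriv x" by (rule DERIV_isCont)
qed

text \<open>This is the derivative of artanh r = r * artanh_quot (r^2), proved on coefficients: the
  n-th one is (1 + 2 n) / (2 n + 1) = 1. It reduces the derivative of the squared distance to a
  multiple of \<open>artanh_quot\<close> alone.\<close>

lemma artanh_quot_ode:
  assumes "norm \<rho> < 1"
  shows "artanh_quot \<rho> + 2 * \<rho> * artanh_quot_deriv \<rho> = 1 / (1 - \<rho>)"
proof -
  let ?c = "\<lambda>n. 1 / real (2 * n + 1)"
  have 1: "(\<lambda>n. ?c n * \<rho> ^ n) sums artanh_quot \<rho>"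
    unfolding artanh_quot_def by (intro summable_sums artanh_quot_summable assms)
  have "(\<lambda>n. of_nat n * ?c n * \<rho> ^ (n - Suc 0)) sums artanh_quot_deriv \<rho>"
    unfolding artanh_quot_deriv_def by (intro diffs_equiv artanh_quot_diffs_summable assms)
  from sums_mult[OF this, of "2 * \<rho>"]
  have 2: "(\<lambda>n. 2 * \<rho> * (of_nat n * ?c n * \<rho> ^ (n - Suc 0))) sums (2 * \<rho> * artanh_quot_deriv \<rho>)" .
  have eq: "?c n * \<rho> ^ n + 2 * \<rho> * (of_nat n * ?c n * \<rho> ^ (n - Suc 0)) = \<rho> ^ n" for n
  proof (cases n)
    case (Suc m)
    define P where "P = \<rho> ^ n"
    have "2 * \<rho> * (of_nat n * ?c n * \<rho> ^ (n - Suc 0)) = 2 * (of_nat n * ?c n) * P"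
      by (simp add: Suc P_def)
    moreover have "?c n * P + 2 * (of_nat n * ?c n) * P = P"
      by (simp add: divide_simps) (simp add: algebra_simps)
    ultimately show ?thesis by (simp only: P_def)
  qed simp
  have "(\<lambda>n. \<rho> ^ n) sums (artanh_quot \<rho> + 2 * \<rho> * artanh_quot_deriv \<rho>)"
    using sums_add[OF 1 2] unfolding eq .
  with geometric_sums[of \<rho>] assms show ?thesis using sums_unique2 by blast
qed

lemma artanh_quot_pos:
  assumes "0 \<le> \<rho>" "\<rho> < 1"
  shows "artanh_quot \<rho> > 0"
  unfolding artanh_quot_def using assms
  by (intro suminf_pos2[where i=0] artanh_quot_summable) auto

section \<open>Hyperbolic functions and concavity of the square\<close>

lemma tanh_artanh:
  assumes "\<bar>r\<bar> < 1"
  shows "tanh (artanh r) = (r::real)"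
proof -
  have p: "(1 + r) / (1 - r) > 0" using assms by auto
  have "exp (- 2 * artanh r) = (1 - r) / (1 + r)"
    using p by (simp add: artanh_def exp_minus exp_ln)
  then have "tanh (artanh r) = (1 - (1 - r) / (1 + r)) / (1 + (1 - r) / (1 + r))"
    unfolding tanh_real_altdef by (simp only:)
  also have "\<dots> = r" using assms by (simp add: divide_simps)
  finally show ?thesis .
qed

lemma tanh_diff_real: "(tanh b - tanh a) / (1 - tanh a * tanh b) = tanh (b - a :: real)"
  using tanh_add[of b "-a"] by (simp add: mult.commute)

lemma sinh_ge_self:
  assumes "0 \<le> (x::real)"
  shows "x \<le> sinh x"
proof -
  have "sinh 0 - 0 \<le> sinh x - x"
    by (rule DERIV_nonneg_imp_nondecreasing[OF assms])
      (auto intro!: derivative_eq_intros exI simp: cosh_real_ge_1)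
  then show ?thesis by simp
qed

text \<open>The cubic order matters: in the concavity estimate the right-hand side has to dominate a
  multiple of (sinh x)^3 down to x = 0.\<close>

lemma sinh_le_self_cosh:
  assumes "0 \<le> (x::real)"
  shows "x ^ 3 / 3 \<le> x * cosh x - sinh x"
proof -
  have "0 * cosh 0 - sinh 0 - 0 ^ 3 / 3 \<le> x * cosh x - sinh x - x ^ 3 / 3"
  proof (rule DERIV_nonneg_imp_nondecreasing[OF assms])
    fix y :: real assume y: "0 \<le> y" "y \<le> x"
    have "((\<lambda>x. x * cosh x - sinh x - x ^ 3 / 3) has_real_derivative y * (sinh y - y)) (at y)"
      by (auto intro!: derivative_eq_intros simp: algebra_simps power2_eq_square)
    moreover have "0 \<le> y * (sinh y - y)" using sinh_ge_self y by simp
    ultimately show "\<exists>z. ((\<lambda>x. x * cosh x - sinh x - x ^ 3 / 3) has_real_derivative z) (at y) \<and> 0 \<le> z"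
      by blast
  qed
  then show ?thesis by simp
qed

lemma DERIV_sinh_half_sq: "((\<lambda>E. (sinh (E / 2))\<^sup>2) has_real_derivative (sinh y / 2)) (at (y::real))"
proof -
  have "sinh y = 2 * sinh (y/2) * cosh (y/2)" using sinh_double[of "y/2"] by simp
  then show ?thesis by (auto intro!: derivative_eq_intros simp: power2_eq_square)
qed

text \<open>As a function of t = sinh(E/2)^2 the square E^2 is strictly concave, with derivative 4 E
  / sinh E; the claim is the tangent estimate at D with a quadratic gap. The variable t is the one
  that the hyperbolic law of cosines interpolates linearly, so this is the analytic source of the
  comparison inequalities.\<close>

lemma square_concave_in_sinh_sq:
  fixes D E M :: real
  assumes D: "0 < D" "D \<le> M" and E: "0 \<le> E" "E \<le> M"
  shows "E\<^sup>2 \<le> D\<^sup>2 + (4 * D / sinh D) * ((sinh (E/2))\<^sup>2 - (sinh (D/2))\<^sup>2)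
    - (1 / cosh M ^ 3) * ((sinh (E/2))\<^sup>2 - (sinh (D/2))\<^sup>2)\<^sup>2"
proof -
  define k where "k = 1 / cosh M ^ 3"
  define t where "t E = (sinh (E/2))\<^sup>2" for E :: real
  have t': "(t has_real_derivative (sinh y / 2)) (at y)" for y
    unfolding t_def[abs_def] by (rule DERIV_sinh_half_sq)
  have k0: "0 < k" by (simp add: k_def)
  \<comment> \<open>With respect to t, \<open>j\<close> is half the derivative of E^2 + k t^2, so
    its monotonicity is the concavity of that sum. The value of \<open>k\<close> comes from sinh z
    <= z cosh z <= z cosh M.\<close>
  define j where "j x = 2 * x / sinh x + k * t x" for x
  have j: "j y \<le> j x" if "0 < x" "x \<le> y" "y \<le> M" for x y
  proof (rule DERIV_nonpos_imp_nonincreasing[OF that(2)])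
    fix z assume z: "x \<le> z" "z \<le> y"
    then have z0: "0 < z" "z \<le> M" using that by auto
    have s: "sinh z > 0" using z0 by simp
    have "k * sinh z ^ 3 \<le> k * (z * cosh z) ^ 3"
    proof -
      have "0 < z ^ 3" "z ^ 3 / 3 \<le> z * cosh z - sinh z" using sinh_le_self_cosh[of z] z0 by auto
      then have "sinh z \<le> z * cosh z" by linarith
      then show ?thesis using k0 s by (intro mult_left_mono power_mono) auto
    qed
    also have "\<dots> = (k * cosh z ^ 3) * z ^ 3" by (simp add: power_mult_distrib)
    also have "\<dots> \<le> 1 * z ^ 3"
    proof (rule mult_right_mono)
      have "cosh z ^ 3 \<le> cosh M ^ 3" using z0 by (intro power_mono) (auto simp: cosh_real_nonneg_le_iff)
      then show "k * cosh z ^ 3 \<le> 1" by (simp add: k_def divide_simps)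
    qed (use z0 in auto)
    also have "\<dots> \<le> 4 * (z * cosh z - sinh z)"
    proof -
      have "1 * a \<le> 4 * w" if "0 < a" "a / 3 \<le> w" for a w :: real using that by linarith
      from this[of "z ^ 3" "z * cosh z - sinh z"] sinh_le_self_cosh[of z] z0 show ?thesis by force
    qed
    finally have le: "k * sinh z ^ 3 \<le> 4 * (z * cosh z - sinh z)" .
    have "(j has_real_derivative (2 * sinh z - 2 * z * cosh z) / (sinh z)\<^sup>2 + k * (sinh z / 2)) (at z)"
      unfolding j_def[abs_def] using s
      by (auto intro!: derivative_eq_intros t' simp: power2_eq_square)
    moreover have "(2 * sinh z - 2 * z * cosh z) / (sinh z)\<^sup>2 + k * (sinh z / 2) \<le> 0"
      using le s by (simp add: field_simps power2_eq_square power3_eq_cube)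
    ultimately show "\<exists>d. (j has_real_derivative d) (at z) \<and> d \<le> 0" by blast
  qed
  define f where "f E = D\<^sup>2 + (4 * D / sinh D) * (t E - t D) - k * (t E - t D)\<^sup>2 - E\<^sup>2" for E
  have sD: "sinh D > 0" using D by simp
  have fA: "(f has_real_derivative ((4 * D / sinh D) * (sinh y / 2)
        - k * (2 * (t y - t D) * (sinh y / 2)) - 2 * y)) (at y)" for y
  proof -
    have "((\<lambda>E. D\<^sup>2 + A * (t E - t D) - k * (t E - t D)\<^sup>2 - E\<^sup>2) has_real_derivative
        (A * (sinh y / 2) - k * (2 * (t y - t D) * (sinh y / 2)) - 2 * y)) (at y)" for A
      by (auto intro!: derivative_eq_intros t' simp: field_simps)
    then show ?thesis unfolding f_def[abs_def] .
  qed
  have f': "(f has_real_derivative (sinh y * (j D - j y))) (at y)" if "y > 0" for y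
  proof -
    have "sinh y > 0" using that by simp
    have "(4 * D / sinh D) * (sinh y / 2) - k * (2 * (t y - t D) * (sinh y / 2)) - 2 * y
        = sinh y * (j D - j y)"
    proof -
      have "(2 * R) * (s / 2) - k * (2 * (t y - t D) * (s / 2)) - 2 * y
        = s * (R + k * t D - (2 * y / s + k * t y))" if "s > 0" for s R
        using that by (simp add: field_simps)
      from this[OF \<open>sinh y > 0\<close>, of "2 * D / sinh D"]
      have "(2 * (2 * D / sinh D)) * (sinh y / 2) - k * (2 * (t y - t D) * (sinh y / 2)) - 2 * y
        = sinh y * (j D - j y)" unfolding j_def .
      moreover have "2 * (2 * D / sinh D) = 4 * D / sinh D" by simp
      ultimately show ?thesis by (simp only:)
    qed
    then show ?thesis using fA[of y] by simp
  qed
  \<comment> \<open>At 0 the quotient in \<open>j\<close> has the default value 0 instead of the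
    limit 2, so the monotonicity of \<open>j\<close> says nothing there; the derivative of
    \<open>f\<close> vanishes anyway.\<close>
  have f0: "(f has_real_derivative 0) (at 0)"
    using fA[of 0] by simp
  \<comment> \<open>\<open>f\<close> vanishes at D and, by the sign of \<open>j D - j y\<close>,
    does not increase before D and does not decrease after it.\<close>
  have "f D \<le> f E"
  proof (cases "D \<le> E")
    case True
    show ?thesis
    proof (rule DERIV_nonneg_imp_nondecreasing[OF True])
      fix x assume x: "D \<le> x" "x \<le> E"
      have "0 \<le> sinh x * (j D - j x)" using j[of D x] x D E by (intro mult_nonneg_nonneg) auto
      then show "\<exists>y. (f has_real_derivative y) (at x) \<and> 0 \<le> y"
        using f'[of x] x D by (metis less_le_trans)
    qed
  next
    case False
    then have "E \<le> D" by simp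
    then show ?thesis
    proof (rule DERIV_nonpos_imp_nonincreasing)
      fix x assume x: "E \<le> x" "x \<le> D"
      show "\<exists>y. (f has_real_derivative y) (at x) \<and> y \<le> 0"
      proof (cases "x = 0")
        case True then show ?thesis using f0 by blast
      next
        case False
        then have x0: "0 < x" using x E by simp
        have "sinh x * (j D - j x) \<le> 0" using j[of x D] x D x0 by (intro mult_nonneg_nonpos) auto
        then show ?thesis using f'[OF x0] by blast
      qed
    qed
  qed
  then show ?thesis by (simp add: f_def t_def k_def)
qed

subsection \<open>The logarithm map of the disk\<close>

abbreviation moebius :: "complex \<Rightarrow> complex \<Rightarrow> complex"
  where "moebius \<equiv> Moebius_function 0"

text \<open>The value of sinh(d/2)^2 for the distance d of z and w, see
  \<open>sinh_half_hdist\<close>. It is a rational expression in coordinates and squared norms, so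
  distances can be compared without \<open>artanh\<close>.\<close>

definition hratio :: "complex \<Rightarrow> complex \<Rightarrow> real"
  where "hratio z w = (cmod (z - w))\<^sup>2 / ((1 - (cmod z)\<^sup>2) * (1 - (cmod w)\<^sup>2))"

lemma disk_sq: "z \<in> disk \<Longrightarrow> (cmod z)\<^sup>2 < 1"
  by (simp add: power_less_one_iff abs_square_less_1)

lemma one_minus_cnj_mult:
  "(cmod (1 - cnj z * w))\<^sup>2 = (cmod (w - z))\<^sup>2 + (1 - (cmod z)\<^sup>2) * (1 - (cmod w)\<^sup>2)"
proof -
  have "complex_of_real ((cmod (1 - cnj z * w))\<^sup>2)
      = complex_of_real ((cmod (w - z))\<^sup>2 + (1 - (cmod z)\<^sup>2) * (1 - (cmod w)\<^sup>2))"
    unfolding of_real_mult of_real_diff of_real_add of_real_1 complex_norm_square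
    by (simp add: algebra_simps)
  then show ?thesis using of_real_eq_iff by blast
qed

lemma one_minus_cnj_nz:
  assumes "z \<in> disk" "w \<in> disk"
  shows "1 - cnj z * w \<noteq> 0"
proof -
  have "0 < (1 - (cmod z)\<^sup>2) * (1 - (cmod w)\<^sup>2)"
    using disk_sq[OF assms(1)] disk_sq[OF assms(2)] by simp
  then have "(cmod (1 - cnj z * w))\<^sup>2 > 0"
    unfolding one_minus_cnj_mult by (simp add: add_nonneg_pos)
  then show ?thesis by auto
qed

lemma moebius_disk: "a \<in> disk \<Longrightarrow> z \<in> disk \<Longrightarrow> moebius a z \<in> disk"
  using Moebius_function_norm_lt_1 by simp

lemma moebius_norm_diff:
  assumes "a \<in> disk" "z \<in> disk"
  shows "1 - (cmod (moebius a z))\<^sup>2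
    = (1 - (cmod a)\<^sup>2) * (1 - (cmod z)\<^sup>2) / (cmod (1 - cnj a * z))\<^sup>2"
  using assms by (intro Moebius_norm) auto

lemma moebius_inverse:
  assumes "a \<in> disk" "z \<in> disk"
  shows "moebius (-a) (moebius a z) = z" "moebius a (moebius (-a) z) = z"
  using assms Moebius_function_compose[of "-a" a z] Moebius_function_compose[of a "-a" z] by auto

lemma moebius_simps [simp]: "moebius a a = 0" "moebius 0 z = z" "moebius a 0 = - a"
  by (simp_all add: Moebius_function_def)

lemma hdist_moebius_norm:
  assumes "z \<in> disk" "w \<in> disk"
  shows "hdist z w = 2 * artanh (cmod (moebius z w))"
  using hdist_eq_artanh[OF assms] by (simp add: Moebius_function_simple norm_divide)

lemma hdist_nonneg:
  assumes "z \<in> disk" "w \<in> disk"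
  shows "0 \<le> hdist z w"
proof -
  have "artanh (cmod (moebius z w)) \<ge> 0"
    using moebius_disk[OF assms] artanh_quot_pos[of "(cmod (moebius z w))\<^sup>2"] disk_sq[OF moebius_disk[OF assms]]
    by (subst artanh_eq_quot) (auto intro!: mult_nonneg_nonneg)
  then show ?thesis using hdist_moebius_norm[OF assms] by simp
qed

lemma tanh_half_hdist:
  assumes "z \<in> disk" "w \<in> disk"
  shows "tanh (hdist z w / 2) = cmod (moebius z w)"
  using moebius_disk[OF assms] by (simp add: hdist_moebius_norm[OF assms] tanh_artanh)

lemma one_minus_tanh_sq: "1 - (tanh (x::real))\<^sup>2 = 1 / (cosh x)\<^sup>2"
proof -
  have "1 - (tanh x)\<^sup>2 = ((cosh x)\<^sup>2 - (sinh x)\<^sup>2) / (cosh x)\<^sup>2"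
    by (simp add: tanh_def power_divide diff_divide_distrib)
  then show ?thesis by (simp only: hyperbolic_pythagoras)
qed

lemma sinh_sq_tanh: "(sinh (x::real))\<^sup>2 = (tanh x)\<^sup>2 / (1 - (tanh x)\<^sup>2)"
  unfolding one_minus_tanh_sq by (simp add: tanh_def power_divide)

lemma sinh_half_hdist:
  assumes "z \<in> disk" "w \<in> disk"
  shows "(sinh (hdist z w / 2))\<^sup>2 = hratio z w"
proof -
  have n: "cmod (1 - cnj z * w) \<noteq> 0" using one_minus_cnj_nz[OF assms] by simp
  have "(cmod (moebius z w))\<^sup>2 = (cmod (z - w))\<^sup>2 / (cmod (1 - cnj z * w))\<^sup>2"
    by (simp add: Moebius_function_simple norm_divide power_divide norm_minus_commute)
  then show ?thesis
    using disk_sq[OF assms(1)] disk_sq[OF assms(2)] n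
    unfolding sinh_sq_tanh tanh_half_hdist[OF assms] moebius_norm_diff[OF assms] hratio_def
    by simp
qed

lemma hdist_le_iff:
  assumes "z \<in> disk" "w \<in> disk" "0 \<le> d"
  shows "hdist z w \<le> d \<longleftrightarrow> hratio z w \<le> (sinh (d / 2))\<^sup>2"
proof -
  have "hdist z w \<le> d \<longleftrightarrow> sinh (hdist z w / 2) \<le> sinh (d / 2)" by simp
  also have "\<dots> \<longleftrightarrow> (sinh (hdist z w / 2))\<^sup>2 \<le> (sinh (d / 2))\<^sup>2"
    using hdist_nonneg[OF assms(1,2)] assms(3) by (subst power_mono_iff) auto
  finally show ?thesis unfolding sinh_half_hdist[OF assms(1,2)] .
qed

lemma hdist_eqI:
  assumes "z \<in> disk" "w \<in> disk" "z' \<in> disk" "w' \<in> disk" "hratio z w = hratio z' w'"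
  shows "hdist z w = hdist z' w'"
proof -
  have "hdist z w \<le> hdist z' w'" "hdist z' w' \<le> hdist z w"
    using assms hdist_le_iff sinh_half_hdist hdist_nonneg by simp_all
  then show ?thesis by simp
qed

lemma hdist_commute: "z \<in> disk \<Longrightarrow> w \<in> disk \<Longrightarrow> hdist z w = hdist w z"
  by (rule hdist_eqI) (auto simp: hratio_def norm_minus_commute mult.commute)

lemma hdist_self [simp]: "z \<in> disk \<Longrightarrow> hdist z z = 0"
  by (simp add: hdist_moebius_norm)

lemma hdist_eq_0_iff: "z \<in> disk \<Longrightarrow> w \<in> disk \<Longrightarrow> hdist z w = 0 \<longleftrightarrow> z = w"
  using sinh_half_hdist[of z w] disk_sq[of z] disk_sq[of w] by (auto simp: hratio_def)

lemma moebius_diff: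
  assumes "a \<in> disk" "x \<in> disk" "y \<in> disk"
  shows "moebius a x - moebius a y
    = (1 - cnj a * a) * (x - y) / ((1 - cnj a * x) * (1 - cnj a * y))"
  using one_minus_cnj_nz[OF assms(1,2)] one_minus_cnj_nz[OF assms(1,3)]
  by (simp add: Moebius_function_simple field_simps)

lemma hdist_moebius:
  assumes "a \<in> disk" "x \<in> disk" "y \<in> disk"
  shows "hdist (moebius a x) (moebius a y) = hdist x y"
proof (rule hdist_eqI)
  have nx: "cmod (1 - cnj a * x) \<noteq> 0" "cmod (1 - cnj a * y) \<noteq> 0"
    using one_minus_cnj_nz assms by simp_all
  have "1 - cnj a * a = of_real (1 - (cmod a)\<^sup>2)"
    unfolding of_real_diff of_real_1 complex_norm_square by (simp add: mult.commute)
  then have ca: "(cmod (1 - cnj a * a))\<^sup>2 = (1 - (cmod a)\<^sup>2)\<^sup>2"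
    by (simp only: norm_of_real power2_abs)
  show "hratio (moebius a x) (moebius a y) = hratio x y"
    using nx disk_sq[OF assms(1)] disk_sq[OF assms(2)] disk_sq[OF assms(3)]
    unfolding hratio_def moebius_diff[OF assms] moebius_norm_diff[OF assms(1,2)] moebius_norm_diff[OF assms(1,3)]
    by (simp add: norm_mult norm_divide power_divide power_mult_distrib ca)
       (simp add: power2_eq_square)
qed (use assms moebius_disk in auto)

text \<open>\<open>moebius a\<close> moves a to 0 with positive derivative 1 / (1 - |a|^2) at a, and
  the metric at 0 is twice the Euclidean one. The scaling makes the norm equal to the distance: this
  is the initial velocity in an orthonormal frame at a, that is, 2 / (1 - |a|^2) times the velocity
  in disk coordinates.\<close>

definition hlog :: "complex \<Rightarrow> complex \<Rightarrow> complex"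
  where "hlog a z = (2 * artanh_quot ((cmod (moebius a z))\<^sup>2)) *\<^sub>R moebius a z"

text \<open>For v = 0 the quotient is 0 / 0 = 0, which gives the intended value a.\<close>

definition hexp :: "complex \<Rightarrow> complex \<Rightarrow> complex"
  where "hexp a v = moebius (- a) ((tanh (norm v / 2) / norm v) *\<^sub>R v)"

lemma hlog_polar:
  assumes "moebius a z = T *\<^sub>R u" "\<bar>T\<bar> < 1" "norm u = 1"
  shows "hlog a z = (2 * artanh T) *\<^sub>R u"
  using assms by (simp add: hlog_def artanh_eq_quot)

lemma norm_hlog:
  assumes "a \<in> disk" "z \<in> disk"
  shows "norm (hlog a z) = hdist a z"
proof -
  have "artanh_quot ((cmod (moebius a z))\<^sup>2) > 0"
    using disk_sq[OF moebius_disk[OF assms]] by (intro artanh_quot_pos) auto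
  then show ?thesis
    using moebius_disk[OF assms]
    by (simp add: hlog_def hdist_moebius_norm[OF assms] artanh_eq_quot)
qed

lemma hlog_self [simp]: "hlog a a = 0"
  by (simp add: hlog_def)

lemma hexp_arg_norm:
  "cmod ((tanh (norm v / 2) / norm v) *\<^sub>R (v::complex)) = tanh (norm v / 2)"
  by (cases "v = 0") auto

lemma hexp_disk: "a \<in> disk \<Longrightarrow> hexp a v \<in> disk"
  unfolding hexp_def by (rule moebius_disk) (auto simp: hexp_arg_norm tanh_real_lt_1 simp del: norm_scaleR)

lemma hlog_hexp:
  assumes "a \<in> disk"
  shows "hlog a (hexp a v) = v"
proof (cases "v = 0")
  case True
  then show ?thesis using assms by (simp add: hexp_def)
next
  case False
  have "moebius a (hexp a v) = (tanh (norm v / 2)) *\<^sub>R (sgn v)"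
  proof -
    have "(tanh (norm v / 2) / norm v) *\<^sub>R v \<in> disk"
      by (simp only: mem_ball_0 hexp_arg_norm tanh_real_lt_1)
    then show ?thesis
      unfolding hexp_def by (simp only: moebius_inverse(2)[OF assms]) (simp only: sgn_div_norm divide_inverse scaleR_scaleR)
  qed
  then have "hlog a (hexp a v) = (2 * artanh (tanh (norm v / 2))) *\<^sub>R sgn v"
    using False tanh_real_bounds[of "norm v / 2"] by (intro hlog_polar) (auto simp: norm_sgn)
  also have "\<dots> = norm v *\<^sub>R sgn v" by (simp only: artanh_tanh_real) simp
  also have "\<dots> = v" using False by (simp add: sgn_div_norm)
  finally show ?thesis .
qed

lemma hexp_hlog:
  assumes "a \<in> disk" "z \<in> disk"
  shows "hexp a (hlog a z) = z"
proof -
  define u where "u = moebius a z"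
  have u: "u \<in> disk" unfolding u_def by (rule moebius_disk[OF assms])
  have q: "artanh_quot ((cmod u)\<^sup>2) > 0" using disk_sq[OF u] by (intro artanh_quot_pos) auto
  have n: "norm (hlog a z) = 2 * artanh_quot ((cmod u)\<^sup>2) * cmod u"
    using q by (simp add: hlog_def u_def)
  have "tanh (norm (hlog a z) / 2) = cmod u"
    unfolding norm_hlog[OF assms] u_def by (rule tanh_half_hdist[OF assms])
  then have "(tanh (norm (hlog a z) / 2) / norm (hlog a z)) *\<^sub>R hlog a z = u"
    unfolding n using q by (cases "u = 0") (simp_all add: hlog_def u_def[symmetric])
  then show ?thesis
    unfolding hexp_def using moebius_inverse(1)[OF assms] u_def by simp
qed

lemma hlog_inject:
  assumes "a \<in> disk" "z \<in> disk" "w \<in> disk" "hlog a z = hlog a w"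
  shows "z = w"
  using hexp_hlog assms by metis

lemma hdist_hexp: "a \<in> disk \<Longrightarrow> hdist a (hexp a v) = norm v"
  by (subst norm_hlog[symmetric]) (simp_all only: hlog_hexp hexp_disk)

subsection \<open>Comparison with the Euclidean plane\<close>

text \<open>Here k = (1 - cos) / 2 for the angle at a. In this form the law interpolates between the
  two triangles folded onto a line, whose third sides are |p - m| for k = 0 and p + m for k = 1, and
  Jensen's inequality becomes applicable. If x or y equals a, there is no angle; sgn 0 = 0 then
  gives k = 1/2, and both formulas still hold.\<close>

lemma law_of_cosines:
  assumes a: "a \<in> disk" and x: "x \<in> disk" and y: "y \<in> disk"
  obtains k where "0 \<le> k" "k \<le> 1"
    "hlog a x \<bullet> hlog a y = (1 - 2 * k) * (hdist a x * hdist a y)"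
    "(sinh (hdist x y / 2))\<^sup>2 = (1 - k) * (sinh ((hdist a x - hdist a y) / 2))\<^sup>2
      + k * (sinh ((hdist a x + hdist a y) / 2))\<^sup>2"
proof -
  define p where "p = hdist a x / 2"
  define m where "m = hdist a y / 2"
  define u where "u = moebius a x"
  define v where "v = moebius a y"
  have u: "u \<in> disk" and v: "v \<in> disk" unfolding u_def v_def using moebius_disk a x y by auto
  define c where "c = sgn u \<bullet> sgn v"
  define k where "k = (1 - c) / 2"
  have "\<bar>c\<bar> \<le> norm (sgn u) * norm (sgn v)" unfolding c_def by (rule Cauchy_Schwarz_ineq2)
  also have "\<dots> \<le> 1" by (simp add: norm_sgn)
  finally have c: "\<bar>c\<bar> \<le> 1" .
  have pu: "u = tanh p *\<^sub>R sgn u"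
    unfolding p_def tanh_half_hdist[OF a x] u_def[symmetric] by (cases "u = 0") (auto simp: sgn_div_norm)
  have mv: "v = tanh m *\<^sub>R sgn v"
    unfolding m_def tanh_half_hdist[OF a y] v_def[symmetric] by (cases "v = 0") (auto simp: sgn_div_norm)
  have nu: "cmod u = tanh p" "cmod v = tanh m"
    unfolding p_def m_def tanh_half_hdist[OF a x] tanh_half_hdist[OF a y] u_def v_def by auto
  have lx: "hlog a x = (2 * p) *\<^sub>R sgn u"
  proof (cases "u = 0")
    case True
    then show ?thesis by (simp add: hlog_def u_def)
  next
    case False
    have "\<bar>tanh p\<bar> < 1" using tanh_real_bounds[of p] by auto
    then show ?thesis
      using hlog_polar[of a x "tanh p" "sgn u"] pu False
      by (simp add: u_def[symmetric] norm_sgn artanh_tanh_real)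
  qed
  have ly: "hlog a y = (2 * m) *\<^sub>R sgn v"
  proof (cases "v = 0")
    case True
    then show ?thesis by (simp add: hlog_def v_def)
  next
    case False
    have "\<bar>tanh m\<bar> < 1" using tanh_real_bounds[of m] by auto
    then show ?thesis
      using hlog_polar[of a y "tanh m" "sgn v"] mv False
      by (simp add: v_def[symmetric] norm_sgn artanh_tanh_real)
  qed
  have uv: "u \<bullet> v = tanh p * tanh m * c"
    using pu mv unfolding c_def by (metis inner_scaleR_left inner_scaleR_right mult.assoc)
  have alg: "((S / C)\<^sup>2 + (S' / C')\<^sup>2 - 2 * (S / C * (S' / C') * c)) / (1 / C\<^sup>2 * (1 / C'\<^sup>2))
      = (S * C')\<^sup>2 + (C * S')\<^sup>2 - 2 * c * (S * C') * (C * S')"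
    if "C \<noteq> 0" "C' \<noteq> 0" for S C S' C' :: real
    using that by (simp add: field_simps power2_eq_square)
  have "(cmod (u - v))\<^sup>2 = (cmod u)\<^sup>2 + (cmod v)\<^sup>2 - 2 * (u \<bullet> v)"
    by (simp add: power2_norm_eq_inner inner_diff_left inner_diff_right inner_commute)
  then have "(cmod (u - v))\<^sup>2 = (tanh p)\<^sup>2 + (tanh m)\<^sup>2 - 2 * (tanh p * tanh m * c)"
    by (simp add: uv nu)
  then have "hratio u v = (sinh p * cosh m)\<^sup>2 + (cosh p * sinh m)\<^sup>2
      - 2 * c * (sinh p * cosh m) * (cosh p * sinh m)"
    unfolding hratio_def nu one_minus_tanh_sq
    by (simp only: tanh_def alg cosh_real_nonzero not_False_eq_True)
  also have "\<dots> = (1 - k) * (sinh (p - m))\<^sup>2 + k * (sinh (p + m))\<^sup>2"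
    unfolding sinh_add sinh_diff k_def by (simp add: field_simps power2_eq_square)
  finally have "(sinh (hdist x y / 2))\<^sup>2 = (1 - k) * (sinh (p - m))\<^sup>2 + k * (sinh (p + m))\<^sup>2"
    using sinh_half_hdist[OF u v] hdist_moebius[OF a x y] by (simp add: u_def v_def)
  moreover have "hlog a x \<bullet> hlog a y = (1 - 2 * k) * (hdist a x * hdist a y)"
    unfolding lx ly by (simp add: c_def[symmetric] k_def p_def m_def field_simps)
  ultimately show ?thesis
    using that[of k] c by (simp add: k_def p_def m_def diff_divide_distrib add_divide_distrib)
qed

text \<open>The interpolation in the law of cosines is largest at k = 1, where the third side is the
  sum of the other two.\<close>

lemma hdist_triangle:
  assumes "x \<in> disk" "a \<in> disk" "y \<in> disk"
  shows "hdist x y \<le> hdist x a + hdist a y"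
proof -
  obtain k where k: "0 \<le> k" "k \<le> 1"
    and eq: "(sinh (hdist x y / 2))\<^sup>2 = (1 - k) * (sinh ((hdist a x - hdist a y) / 2))\<^sup>2
      + k * (sinh ((hdist a x + hdist a y) / 2))\<^sup>2"
    using law_of_cosines[OF assms(2,1,3)] by metis
  define p where "p = hdist a x"
  define m where "m = hdist a y"
  have pm: "0 \<le> p" "0 \<le> m" using hdist_nonneg assms by (auto simp: p_def m_def)
  have "(sinh ((p - m) / 2))\<^sup>2 \<le> (sinh ((p + m) / 2))\<^sup>2"
    unfolding abs_le_square_iff[symmetric] sinh_real_abs[symmetric] using pm by auto
  then have "(sinh (hdist x y / 2))\<^sup>2 \<le> (1 - k) * (sinh ((p + m) / 2))\<^sup>2 + k * (sinh ((p + m) / 2))\<^sup>2"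
    unfolding eq p_def[symmetric] m_def[symmetric] using k by (intro add_mono mult_left_mono) auto
  then have "hdist x y \<le> p + m"
    using assms pm by (subst hdist_le_iff) (auto simp: sinh_half_hdist algebra_simps)
  then show ?thesis using hdist_commute assms by (simp add: p_def m_def)
qed

text \<open>The Euclidean triangle spanned by the two logarithms has third side squared (1 - k) (p -
  m)^2 + k (p + m)^2: the interpolation of the law of cosines, but applied to squares. Concavity of
  the square in sinh(E/2)^2 gives the inequality, and its quadratic gap gives the gain, because the
  Gram determinant equals 4 k (1 - k) (p m)^2. \<open>M\<close> has to bound all three sides, whence
  the hypothesis on the sum of two.\<close>

lemma cat0_strict:
  assumes a: "a \<in> disk" and x: "x \<in> disk" and y: "y \<in> disk"
    and M: "hdist a x + hdist a y \<le> M"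
  shows "(norm (hlog a x - hlog a y))\<^sup>2
      + ((hdist a x)\<^sup>2 * (hdist a y)\<^sup>2 - (hlog a x \<bullet> hlog a y)\<^sup>2) / (4 * cosh M ^ 3) \<le> (hdist x y)\<^sup>2"
proof -
  obtain k where k: "0 \<le> k" "k \<le> 1"
    and ip: "hlog a x \<bullet> hlog a y = (1 - 2 * k) * (hdist a x * hdist a y)"
    and eq: "(sinh (hdist x y / 2))\<^sup>2 = (1 - k) * (sinh ((hdist a x - hdist a y) / 2))\<^sup>2
      + k * (sinh ((hdist a x + hdist a y) / 2))\<^sup>2"
    using law_of_cosines[OF a x y] by metis
  define p where "p = hdist a x"
  define m where "m = hdist a y"
  define D where "D = hdist x y"
  have pm: "0 \<le> p" "0 \<le> m" "0 \<le> D" "p + m \<le> M"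
    using hdist_nonneg assms by (auto simp: p_def m_def D_def)
  define t where "t E = (sinh (E/2))\<^sup>2" for E :: real
  define s where "s = 1 / cosh M ^ 3"
  have s: "0 < s" by (simp add: s_def)
  have tabs: "t \<bar>E\<bar> = t E" for E unfolding t_def by (simp add: abs_if)
  have tD: "t D = (1 - k) * t \<bar>p - m\<bar> + k * t (p + m)"
    using eq unfolding tabs unfolding t_def D_def p_def m_def .
  have tt: "t (p + m) - t \<bar>p - m\<bar> = sinh p * sinh m"
  proof -
    have "t (p + m) - t (p - m) = (2 * sinh (p/2) * cosh (p/2)) * (2 * sinh (m/2) * cosh (m/2))"
      unfolding t_def add_divide_distrib diff_divide_distrib sinh_add sinh_diff
      by (simp add: power2_eq_square algebra_simps)
    then show ?thesis using sinh_double[of "p/2"] sinh_double[of "m/2"] by (simp add: tabs)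
  qed
  have key: "(1 - k) * (p - m)\<^sup>2 + k * (p + m)\<^sup>2 + s * k * (1 - k) * (sinh p * sinh m)\<^sup>2 \<le> D\<^sup>2"
  proof (cases "D = 0")
    case True
    have ge: "0 \<le> (1 - k) * t \<bar>p - m\<bar>" "0 \<le> k * t (p + m)"
      using k by (auto simp: t_def)
    have "(1 - k) * t \<bar>p - m\<bar> = 0" "k * t (p + m) = 0"
      using tD True ge by (auto simp add: t_def[of 0] add_nonneg_eq_0_iff)
    then have "k = 1 \<or> p = m" "k = 0 \<or> p + m = 0" by (auto simp: t_def)
    then show ?thesis using True pm by auto
  next
    case False
    then have D0: "0 < D" using pm by simp
    have DM: "D \<le> M" using hdist_triangle[OF x a y] M hdist_commute[OF x a] by (simp add: D_def)
    define A where "A = 4 * D / sinh D"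
    define b where "b = \<bar>p - m\<bar>"
    have 1: "b\<^sup>2 \<le> D\<^sup>2 + A * (t b - t D) - s * (t b - t D)\<^sup>2"
      using square_concave_in_sinh_sq[OF D0 DM, of b] pm by (auto simp: t_def A_def s_def b_def)
    have 2: "(p + m)\<^sup>2 \<le> D\<^sup>2 + A * (t (p + m) - t D) - s * (t (p + m) - t D)\<^sup>2"
      using square_concave_in_sinh_sq[OF D0 DM, of "p + m"] pm by (auto simp: t_def A_def s_def)
    \<comment> \<open>Relative to the value of t at D, the two extreme values are -k B and (1 - k)
      B. With the weights 1 - k and k the linear terms cancel and the quadratic ones leave s k (1 -
      k) B^2.\<close>
    define B where "B = t (p + m) - t b"
    have e: "t b - t D = - k * B" "t (p + m) - t D = (1 - k) * B"
      using tD by (simp_all add: B_def b_def algebra_simps)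
    have "(1 - k) * b\<^sup>2 + k * (p + m)\<^sup>2
      \<le> (1 - k) * (D\<^sup>2 + A * (- k * B) - s * (- k * B)\<^sup>2) + k * (D\<^sup>2 + A * ((1 - k) * B) - s * ((1 - k) * B)\<^sup>2)"
      using 1 2 k unfolding e by (intro add_mono mult_left_mono) auto
    also have "\<dots> = D\<^sup>2 - s * k * (1 - k) * B\<^sup>2"
      by (simp add: power2_eq_square algebra_simps)
    finally show ?thesis using tt by (simp add: b_def B_def)
  qed
  have "(p * m)\<^sup>2 \<le> (sinh p * sinh m)\<^sup>2"
    using sinh_ge_self pm by (intro power_mono mult_mono) auto
  then have "s * k * (1 - k) * (p * m)\<^sup>2 \<le> s * k * (1 - k) * (sinh p * sinh m)\<^sup>2"
    using k s by (intro mult_left_mono mult_nonneg_nonneg) auto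
  with key have "(1 - k) * (p - m)\<^sup>2 + k * (p + m)\<^sup>2 + s * k * (1 - k) * (p * m)\<^sup>2 \<le> D\<^sup>2" by linarith
  moreover have "(norm (hlog a x - hlog a y))\<^sup>2 = p\<^sup>2 + m\<^sup>2 - 2 * ((1 - 2 * k) * (p * m))"
  proof -
    have "(norm (hlog a x - hlog a y))\<^sup>2 = (norm (hlog a x))\<^sup>2 + (norm (hlog a y))\<^sup>2 - 2 * (hlog a x \<bullet> hlog a y)"
      by (simp add: power2_norm_eq_inner inner_diff_left inner_diff_right inner_commute)
    then show ?thesis unfolding ip norm_hlog[OF a x] norm_hlog[OF a y] p_def m_def .
  qed
  moreover have "(p\<^sup>2 * m\<^sup>2 - (hlog a x \<bullet> hlog a y)\<^sup>2) / (4 * cosh M ^ 3) = s * k * (1 - k) * (p * m)\<^sup>2"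
    unfolding ip p_def[symmetric] m_def[symmetric] s_def by (simp add: field_simps power2_eq_square)
  moreover have "(1 - k) * (p - m)\<^sup>2 + k * (p + m)\<^sup>2 = p\<^sup>2 + m\<^sup>2 - 2 * ((1 - 2 * k) * (p * m))"
    by (simp add: power2_eq_square algebra_simps)
  ultimately show ?thesis
    unfolding p_def[symmetric] m_def[symmetric] D_def[symmetric] by linarith
qed

lemma hlog_inner_le: "a \<in> disk \<Longrightarrow> x \<in> disk \<Longrightarrow> y \<in> disk \<Longrightarrow> (hlog a x \<bullet> hlog a y)\<^sup>2 \<le> (hdist a x)\<^sup>2 * (hdist a y)\<^sup>2"
  using Cauchy_Schwarz_ineq[of "hlog a x" "hlog a y"] by (simp add: norm_hlog power2_norm_eq_inner[symmetric])

lemma cat0: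
  assumes "a \<in> disk" "x \<in> disk" "y \<in> disk"
  shows "(norm (hlog a x - hlog a y))\<^sup>2 \<le> (hdist x y)\<^sup>2"
proof -
  have "0 \<le> ((hdist a x)\<^sup>2 * (hdist a y)\<^sup>2 - (hlog a x \<bullet> hlog a y)\<^sup>2) / (4 * cosh (hdist a x + hdist a y) ^ 3)"
    using hlog_inner_le[OF assms] by (intro divide_nonneg_pos) auto
  then show ?thesis using cat0_strict[OF assms order_refl] by linarith
qed

text \<open>On a diameter, \<open>\<alpha>\<close> is signed arc length, and logarithms are
  differences by the addition theorem of tanh. Collinear configurations are reduced to this one by a
  Moebius map.\<close>

lemma hlog_line:
  assumes u: "norm (u::complex) = 1"
  shows "hlog (tanh (\<alpha> / 2) *\<^sub>R u) (tanh (\<beta> / 2) *\<^sub>R u) = (\<beta> - \<alpha>) *\<^sub>R u"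
proof -
  have cu: "cnj u * u = 1"
    using complex_norm_square[of u] u by (simp add: mult.commute)
  have "cnj (tanh (\<alpha> / 2) *\<^sub>R u) * (tanh (\<beta> / 2) *\<^sub>R u)
      = of_real (tanh (\<alpha> / 2) * tanh (\<beta> / 2)) * (cnj u * u)"
    by (simp add: scaleR_conv_of_real mult_ac)
  then have "moebius (tanh (\<alpha> / 2) *\<^sub>R u) (tanh (\<beta> / 2) *\<^sub>R u)
      = (of_real (tanh (\<beta> / 2) - tanh (\<alpha> / 2)) * u) / of_real (1 - tanh (\<alpha> / 2) * tanh (\<beta> / 2))"
    using cu by (simp add: Moebius_function_simple scaleR_conv_of_real left_diff_distrib)
  also have "\<dots> = of_real ((tanh (\<beta> / 2) - tanh (\<alpha> / 2)) / (1 - tanh (\<alpha> / 2) * tanh (\<beta> / 2))) * u"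
    by (simp only: of_real_divide times_divide_eq_left)
  also have "\<dots> = tanh ((\<beta> - \<alpha>) / 2) *\<^sub>R u"
    by (simp only: tanh_diff_real diff_divide_distrib[symmetric] scaleR_conv_of_real)
  finally have "hlog (tanh (\<alpha> / 2) *\<^sub>R u) (tanh (\<beta> / 2) *\<^sub>R u)
      = (2 * artanh (tanh ((\<beta> - \<alpha>) / 2))) *\<^sub>R u"
    using u tanh_real_bounds[of "(\<beta> - \<alpha>) / 2"] by (intro hlog_polar) auto
  then show ?thesis by (simp add: artanh_tanh_real)
qed

lemma line_disk:
  assumes "norm (u::complex) = 1"
  shows "tanh (\<alpha> / 2) *\<^sub>R u \<in> disk"
  using assms tanh_real_bounds[of "\<alpha>/2"] by auto

lemma moebius_polar:
  assumes "a \<in> disk" "z \<in> disk"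
  obtains u where "norm u = 1" "moebius a z = tanh (hdist a z / 2) *\<^sub>R u"
proof (cases "moebius a z = 0")
  case True
  then show ?thesis using that[of 1] tanh_half_hdist[OF assms] by simp
next
  case False
  then show ?thesis using that[of "sgn (moebius a z)"] tanh_half_hdist[OF assms]
    by (simp add: norm_sgn) (simp add: sgn_div_norm)
qed

subsection \<open>Isometries\<close>

definition disk_isometry :: "(complex \<Rightarrow> complex) \<Rightarrow> bool"
  where "disk_isometry g \<longleftrightarrow> g holomorphic_on disk \<and> g ` disk \<subseteq> disk \<and>
    (\<forall>z\<in>disk. \<forall>w\<in>disk. hdist (g z) (g w) = hdist z w)"

lemma disk_isometry_moebius: "a \<in> disk \<Longrightarrow> disk_isometry (moebius a)"
  unfolding disk_isometry_def using moebius_disk hdist_moebius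
  by (auto intro: Moebius_function_holomorphic)

text \<open>Conjugating g by the Moebius maps that bring a and g a to 0 gives a holomorphic map that
  preserves the norm, hence a rotation by the equality case of the Schwarz lemma. So
  \<open>\<omega>\<close> is the differential of g at a, read in the orthonormal frames.\<close>

lemma hlog_isometry:
  assumes g: "disk_isometry g" and a: "a \<in> disk"
  obtains \<omega> where "norm \<omega> = 1" "\<And>z. z \<in> disk \<Longrightarrow> hlog (g a) (g z) = \<omega> * hlog a z"
proof -
  have gd: "g z \<in> disk" if "z \<in> disk" for z
    using g that unfolding disk_isometry_def by blast
  have ma: "- a \<in> disk" using a by simp
  define \<phi> where "\<phi> = moebius (g a) \<circ> g \<circ> moebius (- a)"
  have "moebius (- a) holomorphic_on disk" "moebius (- a) ` disk \<subseteq> disk"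
      "moebius (g a) holomorphic_on disk" "g holomorphic_on disk" "g ` disk \<subseteq> disk"
    using disk_isometry_moebius[OF ma] disk_isometry_moebius[OF gd[OF a]] g
    by (auto simp: disk_isometry_def)
  then have hol: "\<phi> holomorphic_on disk"
    unfolding \<phi>_def by (intro holomorphic_on_compose_gen[where t = disk]) auto
  have n: "norm (\<phi> z) = norm z" if z: "z \<in> disk" for z
  proof -
    have w: "moebius (- a) z \<in> disk" by (rule moebius_disk[OF ma z])
    have "norm (\<phi> z) = tanh (hdist (g a) (g (moebius (- a) z)) / 2)"
      unfolding \<phi>_def by (simp add: tanh_half_hdist[OF gd[OF a] gd[OF w]])
    also have "\<dots> = tanh (hdist a (moebius (- a) z) / 2)"
      using g a w unfolding disk_isometry_def by simp
    also have "\<dots> = norm z"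
      unfolding tanh_half_hdist[OF a w] moebius_inverse(2)[OF a z] ..
    finally show ?thesis .
  qed
  have "\<phi> 0 = 0" using n[of 0] by simp
  moreover have "norm (\<phi> z) < 1" if "norm z < 1" for z using n[of z] that by simp
  moreover have "\<exists>z. norm z < 1 \<and> z \<noteq> 0 \<and> norm (\<phi> z) = norm z"
    using n[of "1/2"] by (intro exI[of _ "1/2"]) simp
  ultimately obtain \<omega> where \<omega>: "\<And>z. norm z < 1 \<Longrightarrow> \<phi> z = \<omega> * z" "norm \<omega> = 1"
    using Schwarz_Lemma(3)[OF hol, of 0] by auto
  show ?thesis
  proof (rule that[OF \<omega>(2)])
    fix z assume z: "z \<in> disk"
    have "moebius (g a) (g z) = \<omega> * moebius a z"
      using \<omega>(1)[of "moebius a z"] moebius_disk[OF a z] moebius_inverse(1)[OF a z] by (simp add: \<phi>_def)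
    then show "hlog (g a) (g z) = \<omega> * hlog a z"
      by (simp add: hlog_def norm_mult \<omega>(2))
  qed
qed

subsection \<open>First variation of the squared distance\<close>

text \<open>The direction \<open>moebius z w\<close> with its denominator cleared, as it appears in
  the derivative of the quotient in \<open>moebius_norm_sq\<close>.\<close>

lemma moebius_inner:
  assumes z: "z \<in> disk" and w: "w \<in> disk"
  shows "(cmod (1 - cnj z * w))\<^sup>2 * (moebius z w \<bullet> \<zeta>)
    = (1 - (cmod z)\<^sup>2) * ((w - z) \<bullet> \<zeta>) - (cmod (w - z))\<^sup>2 * (z \<bullet> \<zeta>)"
proof -
  have nz: "1 - cnj z * w \<noteq> 0" by (rule one_minus_cnj_nz[OF z w])
  have c: "of_real ((cmod x)\<^sup>2) = x * cnj x" for x by (rule complex_norm_square)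
  have "of_real ((cmod (1 - cnj z * w))\<^sup>2) * moebius z w = (w - z) * cnj (1 - cnj z * w)"
    using nz unfolding c Moebius_function_simple by simp
  also have "\<dots> = of_real (1 - (cmod z)\<^sup>2) * (w - z) - of_real ((cmod (w - z))\<^sup>2) * z"
    unfolding of_real_diff c by (simp add: algebra_simps)
  finally have "((cmod (1 - cnj z * w))\<^sup>2) *\<^sub>R moebius z w
      = (1 - (cmod z)\<^sup>2) *\<^sub>R (w - z) - ((cmod (w - z))\<^sup>2) *\<^sub>R z"
    by (simp only: scaleR_conv_of_real)
  then have "((cmod (1 - cnj z * w))\<^sup>2) *\<^sub>R moebius z w \<bullet> \<zeta>
      = ((1 - (cmod z)\<^sup>2) *\<^sub>R (w - z) - ((cmod (w - z))\<^sup>2) *\<^sub>R z) \<bullet> \<zeta>" by simp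
  then show ?thesis by (simp only: inner_scaleR_left inner_diff_left[of "_ *\<^sub>R _"])
qed

lemma hdist_sq_eq:
  assumes "z \<in> disk" "w \<in> disk"
  shows "(hdist z w)\<^sup>2 = (let \<rho> = (cmod (moebius z w))\<^sup>2 in 4 * \<rho> * (artanh_quot \<rho>)\<^sup>2)"
  using moebius_disk[OF assms]
  by (simp add: hdist_moebius_norm[OF assms] artanh_eq_quot power_mult_distrib Let_def)

lemma moebius_norm_sq:
  "(cmod (moebius z w))\<^sup>2 = ((w - z) \<bullet> (w - z)) / ((w - z) \<bullet> (w - z) + (1 - z \<bullet> z) * (1 - w \<bullet> w))"
  using one_minus_cnj_mult[of z w]
  by (simp add: Moebius_function_simple norm_divide power_divide power2_norm_eq_inner)

lemma moebius_norm_sq_less: "z \<in> disk \<Longrightarrow> w \<in> disk \<Longrightarrow> (cmod (moebius z w))\<^sup>2 < 1"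
  using disk_sq moebius_disk by blast

text \<open>The squared distance is 4 \<rho> (artanh_quot \<rho>)^2 with \<rho> = |moebius z w|^2,
  hence differentiable across the diagonal too. The coefficient 4 / (1 - |z|^2) is the 2 from the
  square times the factor 2 / (1 - |z|^2) that converts coordinate vectors to the frame of
  \<open>hlog\<close>.\<close>

lemma hdist_sq_has_derivative:
  assumes z: "z \<in> disk" and w: "w \<in> disk"
  shows "((\<lambda>(z, w). (hdist z w)\<^sup>2) has_derivative
    (\<lambda>(\<zeta>, \<eta>). - (4 / (1 - (cmod z)\<^sup>2)) * (hlog z w \<bullet> \<zeta>) - (4 / (1 - (cmod w)\<^sup>2)) * (hlog w z \<bullet> \<eta>))) (at (z, w))"
proof -
  define R where "R = (\<lambda>(z::complex, w). ((w - z) \<bullet> (w - z)) / ((w - z) \<bullet> (w - z) + (1 - z \<bullet> z) * (1 - w \<bullet> w)))"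
  define N where "N = (w - z) \<bullet> (w - z)"
  define A where "A = 1 - z \<bullet> z"
  define B where "B = 1 - w \<bullet> w"
  define M where "M = N + A * B"
  define \<rho> where "\<rho> = R (z, w)"
  have AB: "A > 0" "B > 0" "N \<ge> 0"
    using disk_sq[OF z] disk_sq[OF w] by (simp_all add: A_def B_def N_def power2_norm_eq_inner)
  then have M: "M > 0" by (simp add: M_def add_nonneg_pos)
  have Rz: "R (z, w) = (cmod (moebius z w))\<^sup>2" for z w unfolding R_def moebius_norm_sq by simp
  have \<rho>: "\<rho> = N / M" unfolding \<rho>_def R_def M_def N_def A_def B_def by simp
  have \<rho>1: "norm \<rho> < 1" unfolding \<rho>_def Rz using moebius_norm_sq_less[OF z w] by simp
  have \<rho>': "1 - \<rho> = A * B / M" using M unfolding \<rho> by (simp add: M_def field_simps)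
  have M1: "(cmod (1 - cnj z * w))\<^sup>2 = M" "(cmod (1 - cnj w * z))\<^sup>2 = M"
  proof -
    have "M = (cmod (w - z))\<^sup>2 + (1 - (cmod z)\<^sup>2) * (1 - (cmod w)\<^sup>2)"
      unfolding M_def N_def A_def B_def power2_norm_eq_inner ..
    then show "(cmod (1 - cnj z * w))\<^sup>2 = M" "(cmod (1 - cnj w * z))\<^sup>2 = M"
      unfolding one_minus_cnj_mult by (simp_all add: norm_minus_commute mult.commute)
  qed
  have i1: "M * (moebius z w \<bullet> \<zeta>) = A * ((w - z) \<bullet> \<zeta>) - N * (z \<bullet> \<zeta>)" for \<zeta>
    using moebius_inner[OF z w, of \<zeta>, unfolded M1] unfolding A_def N_def power2_norm_eq_inner .
  have N': "N = (z - w) \<bullet> (z - w)" unfolding N_def by (simp add: inner_diff_left inner_diff_right inner_commute)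
  have i2: "M * (moebius w z \<bullet> \<eta>) = B * ((z - w) \<bullet> \<eta>) - N * (w \<bullet> \<eta>)" for \<eta>
    using moebius_inner[OF w z, of \<eta>, unfolded M1] unfolding B_def N' power2_norm_eq_inner .
  define dR where "dR = (\<lambda>(\<zeta>::complex, \<eta>::complex). - 2 * (1 - \<rho>) / A * (moebius z w \<bullet> \<zeta>) - 2 * (1 - \<rho>) / B * (moebius w z \<bullet> \<eta>))"
  have "(R has_derivative (\<lambda>(\<zeta>, \<eta>).
     ((2 * ((w - z) \<bullet> (\<eta> - \<zeta>))) * M
       - N * (2 * ((w - z) \<bullet> (\<eta> - \<zeta>)) + (- 2 * (z \<bullet> \<zeta>)) * B + A * (- 2 * (w \<bullet> \<eta>)))) / (M * M))) (at (z, w))"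
    unfolding R_def case_prod_beta M_def N_def A_def B_def
    using M unfolding M_def N_def A_def B_def
    by (auto intro!: derivative_eq_intros simp: inner_commute algebra_simps)
  moreover have "((2 * ((w - z) \<bullet> (\<eta> - \<zeta>))) * M
       - N * (2 * ((w - z) \<bullet> (\<eta> - \<zeta>)) + (- 2 * (z \<bullet> \<zeta>)) * B + A * (- 2 * (w \<bullet> \<eta>)))) / (M * M)
      = dR (\<zeta>, \<eta>)" for \<zeta> \<eta>
  proof -
    define p where "p = (w - z) \<bullet> \<zeta>"
    define q where "q = (z - w) \<bullet> \<eta>"
    have e: "(w - z) \<bullet> (\<eta> - \<zeta>) = - p - q" by (simp add: p_def q_def algebra_simps inner_diff_left inner_diff_right)
    have "dR (\<zeta>, \<eta>) = (- 2 * B * (M * (moebius z w \<bullet> \<zeta>)) - 2 * A * (M * (moebius w z \<bullet> \<eta>))) / (M * M)"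
      unfolding dR_def \<rho>' using AB M by (simp add: field_simps)
    then have "dR (\<zeta>, \<eta>) = (- 2 * B * (A * p - N * (z \<bullet> \<zeta>)) - 2 * A * (B * q - N * (w \<bullet> \<eta>))) / (M * M)"
      unfolding i1 i2 p_def q_def .
    moreover have "(2 * ((w - z) \<bullet> (\<eta> - \<zeta>))) * M
       - N * (2 * ((w - z) \<bullet> (\<eta> - \<zeta>)) + (- 2 * (z \<bullet> \<zeta>)) * B + A * (- 2 * (w \<bullet> \<eta>)))
      = - 2 * B * (A * p - N * (z \<bullet> \<zeta>)) - 2 * A * (B * q - N * (w \<bullet> \<eta>))"
      unfolding e M_def by (simp add: algebra_simps)
    ultimately show ?thesis by simp
  qed
  ultimately have R': "(R has_derivative dR) (at (z, w))" by (simp add: case_prod_beta)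
  have "((\<lambda>\<rho>. 4 * \<rho> * (artanh_quot \<rho>)\<^sup>2) has_real_derivative
      (4 * artanh_quot \<rho> * (artanh_quot \<rho> + 2 * \<rho> * artanh_quot_deriv \<rho>))) (at \<rho>)"
    by (auto intro!: derivative_eq_intros DERIV_artanh_quot[OF \<rho>1] simp: power2_eq_square algebra_simps)
  \<comment> \<open>\<open>artanh_quot_ode\<close> turns the bracket into 1 / (1 - \<rho>), which
    will cancel against the factor 1 - \<rho> in \<open>dR\<close>.\<close>
  then have "((\<lambda>\<rho>. 4 * \<rho> * (artanh_quot \<rho>)\<^sup>2) has_derivative (*) (4 * artanh_quot \<rho> / (1 - \<rho>))) (at (R (z, w)))"
    unfolding artanh_quot_ode[OF \<rho>1] has_field_derivative_def \<rho>_def[symmetric] by simp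
  from has_derivative_compose[OF R' this]
  have 1: "((\<lambda>p. 4 * R p * (artanh_quot (R p))\<^sup>2) has_derivative (\<lambda>v. 4 * artanh_quot \<rho> / (1 - \<rho>) * dR v)) (at (z, w))"
    by simp
  have c: "cmod (moebius w z) = cmod (moebius z w)"
    using tanh_half_hdist[OF z w] tanh_half_hdist[OF w z] hdist_commute[OF z w] by simp
  have dd: "4 * artanh_quot \<rho> / (1 - \<rho>) * dR (\<zeta>, \<eta>)
      = - (4 / A) * (hlog z w \<bullet> \<zeta>) - (4 / B) * (hlog w z \<bullet> \<eta>)" for \<zeta> \<eta>
    using \<rho>1 AB unfolding dR_def hlog_def c Rz[symmetric] \<rho>_def[symmetric]
    by (simp add: field_simps)
  have A': "A = 1 - (cmod z)\<^sup>2" "B = 1 - (cmod w)\<^sup>2" by (simp_all add: A_def B_def power2_norm_eq_inner)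
  show ?thesis
  proof (rule has_derivative_transform_within_open[where s = "disk \<times> disk"])
    show "((\<lambda>p. 4 * R p * (artanh_quot (R p))\<^sup>2) has_derivative
      (\<lambda>(\<zeta>, \<eta>). - (4 / (1 - (cmod z)\<^sup>2)) * (hlog z w \<bullet> \<zeta>) - (4 / (1 - (cmod w)\<^sup>2)) * (hlog w z \<bullet> \<eta>))) (at (z, w))"
    proof -
      have "(\<lambda>v. 4 * artanh_quot \<rho> / (1 - \<rho>) * dR v)
        = (\<lambda>(\<zeta>, \<eta>). - (4 / (1 - (cmod z)\<^sup>2)) * (hlog z w \<bullet> \<zeta>) - (4 / (1 - (cmod w)\<^sup>2)) * (hlog w z \<bullet> \<eta>))"
        using dd unfolding A' by (intro ext) (simp only: split_paired_all case_prod_conv)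
      then show ?thesis using 1 by (simp only:)
    qed
    show "open (disk \<times> disk)" by (intro open_Times) auto
    show "(z, w) \<in> disk \<times> disk" using z w by simp
    show "4 * R p * (artanh_quot (R p))\<^sup>2 = (case p of (z, w) \<Rightarrow> (hdist z w)\<^sup>2)" if "p \<in> disk \<times> disk" for p
      using that hdist_sq_eq[of "fst p" "snd p"] by (auto simp: Rz Let_def)
  qed
qed

subsection \<open>Geodesic quadrilaterals\<close>

lemma hlog_inner_ge:
  assumes "a \<in> disk" "x \<in> disk" "y \<in> disk"
  shows "2 * (hlog a x \<bullet> hlog a y) \<ge> (hdist a x)\<^sup>2 + (hdist a y)\<^sup>2 - (hdist x y)\<^sup>2"
  using cat0[OF assms] norm_hlog[OF assms(1,2)] norm_hlog[OF assms(1,3)]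
  by (simp add: power2_norm_eq_inner inner_diff_left inner_diff_right inner_commute flip: power2_norm_eq_inner[of "hlog a x"] power2_norm_eq_inner[of "hlog a y"])

text \<open>At the point z that divides the segment from a to y at parameter t, the logarithms of a
  and y are opposite vectors of lengths t m and (1 - t) m. In the sum of the comparison inequalities
  at z with weights 1 - t and t, their inner products with \<open>hlog z b\<close> cancel.\<close>

lemma stewart_inequality:
  assumes a: "a \<in> disk" and y: "y \<in> disk" and t: "0 \<le> t" "t \<le> 1"
  obtains z where "z \<in> disk"
    "\<And>b. b \<in> disk \<Longrightarrow> (hdist z b)\<^sup>2 \<le> (1 - t) * (hdist a b)\<^sup>2 + t * (hdist y b)\<^sup>2 - t * (1 - t) * (hdist a y)\<^sup>2"
proof -
  define m where "m = hdist a y"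
  obtain u where u: "norm u = 1" and y0: "moebius a y = tanh (m / 2) *\<^sub>R u"
    using moebius_polar[OF a y] by (metis m_def)
  define z0 where "z0 = tanh (t * m / 2) *\<^sub>R u"
  have z0: "z0 \<in> disk" unfolding z0_def by (rule line_disk[OF u])
  have ma: "- a \<in> disk" using a by simp
  define z where "z = moebius (- a) z0"
  have z: "z \<in> disk" unfolding z_def by (rule moebius_disk[OF ma z0])
  have mz: "moebius a z = z0" unfolding z_def by (rule moebius_inverse(2)[OF a z0])
  have l0: "hlog z0 0 = - (t * m) *\<^sub>R u"
    using hlog_line[OF u, of "t * m" 0] by (simp add: z0_def)
  have l1: "hlog z0 (moebius a y) = ((1 - t) * m) *\<^sub>R u"
    using hlog_line[OF u, of "t * m" m] by (simp add: z0_def y0 algebra_simps)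
  have "(hdist z b)\<^sup>2 \<le> (1 - t) * (hdist a b)\<^sup>2 + t * (hdist y b)\<^sup>2 - t * (1 - t) * (hdist a y)\<^sup>2"
    if b: "b \<in> disk" for b
  proof -
    define b0 where "b0 = moebius a b"
    have b0: "b0 \<in> disk" unfolding b0_def by (rule moebius_disk[OF a b])
    have y0d: "moebius a y \<in> disk" by (rule moebius_disk[OF a y])
    have d: "hdist z b = hdist z0 b0" "hdist a b = hdist 0 b0" "hdist y b = hdist (moebius a y) b0"
      using hdist_moebius[OF a z b] hdist_moebius[OF a a b] hdist_moebius[OF a y b]
      by (simp_all add: mz b0_def)
    have n0: "(hdist z0 0)\<^sup>2 = (t * m)\<^sup>2" "(hdist z0 (moebius a y))\<^sup>2 = ((1 - t) * m)\<^sup>2"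
      using norm_hlog[OF z0, of 0] norm_hlog[OF z0 y0d] u unfolding l0 l1
      by (simp_all flip: power2_abs[of "_ * _"] add: abs_mult)
    define L where "L = u \<bullet> hlog z0 b0"
    have c1: "2 * (- (t * m) * L) \<ge> (t * m)\<^sup>2 + (hdist z0 b0)\<^sup>2 - (hdist 0 b0)\<^sup>2"
      using hlog_inner_ge[OF z0 _ b0, of 0] by (simp add: l0 n0 L_def)
    have c2: "2 * ((1 - t) * m * L) \<ge> ((1 - t) * m)\<^sup>2 + (hdist z0 b0)\<^sup>2 - (hdist (moebius a y) b0)\<^sup>2"
      using hlog_inner_ge[OF z0 y0d b0] by (simp add: l1 n0 L_def)
    have "(1 - t) * ((t * m)\<^sup>2 + (hdist z0 b0)\<^sup>2 - (hdist 0 b0)\<^sup>2)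
        + t * (((1 - t) * m)\<^sup>2 + (hdist z0 b0)\<^sup>2 - (hdist (moebius a y) b0)\<^sup>2)
      \<le> (1 - t) * (2 * (- (t * m) * L)) + t * (2 * ((1 - t) * m * L))"
      using c1 c2 t by (intro add_mono mult_left_mono) auto
    then show ?thesis unfolding d m_def[symmetric] by (simp add: power2_eq_square algebra_simps)
  qed
  with z show ?thesis by (rule that)
qed

lemma square_sum_le_weighted:
  fixes p q t :: real
  assumes "0 < t" "t < 1"
  shows "(p + q)\<^sup>2 \<le> p\<^sup>2 / (1 - t) + q\<^sup>2 / t"
proof -
  have "(1 - t) * t * (p\<^sup>2 / (1 - t) + q\<^sup>2 / t - (p + q)\<^sup>2) = (t * p - (1 - t) * q)\<^sup>2"
    using assms by (simp add: field_simps power2_eq_square)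
  then have "0 \<le> (1 - t) * t * (p\<^sup>2 / (1 - t) + q\<^sup>2 / t - (p + q)\<^sup>2)" by simp
  moreover have "0 < (1 - t) * t" using assms by simp
  ultimately show ?thesis by (smt (verit) zero_le_mult_iff)
qed

text \<open>Reshetnyak's quadrilateral inequality: compare both diagonals through the point dividing one of them
  in the ratio of the two opposite sides.\<close>

lemma quadrilateral_inequality:
  assumes a: "a \<in> disk" and b: "b \<in> disk" and x: "x \<in> disk" and y: "y \<in> disk"
  shows "(hdist a y)\<^sup>2 + (hdist b x)\<^sup>2
    \<le> (hdist a b)\<^sup>2 + (hdist x y)\<^sup>2 + 2 * hdist a x * hdist b y"
proof -
  define p where "p = hdist a x"
  define q where "q = hdist b y"
  define m where "m = hdist a b"
  define n where "n = hdist x y"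
  define \<delta> where "\<delta> = hdist a y"
  have nn: "0 \<le> p" "0 \<le> q" using hdist_nonneg assms by (auto simp: p_def q_def)
  consider "p = 0" | "q = 0" | "p > 0" "q > 0" using nn by linarith
  then show ?thesis
  proof cases
    case 1
    then have "a = x" using hdist_eq_0_iff a x by (simp add: p_def)
    then show ?thesis using hdist_commute b x by simp
  next
    case 2
    then have "b = y" using hdist_eq_0_iff b y by (simp add: q_def)
    then show ?thesis using hdist_commute x y by simp
  next
    case 3
    \<comment> \<open>This \<open>t\<close> minimizes the error (t / (1 - t)) q^2 + ((1 - t) / t)
      p^2, whose least value is 2 p q. It lies strictly between 0 and 1 because p and q are positive
      here.\<close>
    define t where "t = p / (p + q)"
    have t: "0 < t" "t < 1" "1 - t = q / (p + q)" using 3 by (simp_all add: t_def field_simps)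
    obtain z where z: "z \<in> disk" and st: "\<And>b. b \<in> disk \<Longrightarrow>
        (hdist z b)\<^sup>2 \<le> (1 - t) * (hdist a b)\<^sup>2 + t * (hdist y b)\<^sup>2 - t * (1 - t) * (hdist a y)\<^sup>2"
      using stewart_inequality[OF a y, of t] t by auto
    have s1: "(hdist z b)\<^sup>2 \<le> (1 - t) * m\<^sup>2 + t * q\<^sup>2 - t * (1 - t) * \<delta>\<^sup>2"
      using st[OF b] hdist_commute[OF b y] by (simp add: m_def q_def \<delta>_def)
    have s2: "(hdist z x)\<^sup>2 \<le> (1 - t) * p\<^sup>2 + t * n\<^sup>2 - t * (1 - t) * \<delta>\<^sup>2"
      using st[OF x] hdist_commute[OF x y] by (simp add: n_def p_def \<delta>_def)
    have "(hdist b x)\<^sup>2 \<le> (hdist z b + hdist z x)\<^sup>2"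
      using hdist_triangle[OF b z x] hdist_commute[OF b z] hdist_nonneg[OF b x] by (intro power_mono) auto
    also have "\<dots> \<le> (hdist z b)\<^sup>2 / (1 - t) + (hdist z x)\<^sup>2 / t"
      by (rule square_sum_le_weighted[OF t(1,2)])
    also have "\<dots> \<le> ((1 - t) * m\<^sup>2 + t * q\<^sup>2 - t * (1 - t) * \<delta>\<^sup>2) / (1 - t)
        + ((1 - t) * p\<^sup>2 + t * n\<^sup>2 - t * (1 - t) * \<delta>\<^sup>2) / t"
      using s1 s2 t by (intro add_mono divide_right_mono) auto
    also have "\<dots> = m\<^sup>2 + n\<^sup>2 - \<delta>\<^sup>2 + (t / (1 - t)) * q\<^sup>2 + ((1 - t) / t) * p\<^sup>2"
      using t(1,2) by (simp add: field_simps)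
    also have "t / (1 - t) = p / q" unfolding t(3) unfolding t_def using 3 by simp
    also have "(1 - t) / t = q / p" unfolding t(3) unfolding t_def using 3 by simp
    also have "p / q * q\<^sup>2 = p * q" using 3 by (simp add: power2_eq_square)
    also have "q / p * p\<^sup>2 = p * q" using 3 by (simp add: power2_eq_square)
    finally show ?thesis by (simp add: m_def n_def p_def q_def \<delta>_def)
  qed
qed

text \<open>The derivative of \<open>hdist\<^sup>2 / 2\<close> along a pair of geodesics from \<open>(a, b)\<close> to \<open>(x, y)\<close> increases by
  \<open>corner_sum a b x y\<close> between the two ends.\<close>

definition corner_sum :: "complex \<Rightarrow> complex \<Rightarrow> complex \<Rightarrow> complex \<Rightarrow> real"
  where "corner_sum a b x y = hlog x a \<bullet> hlog x y + hlog y b \<bullet> hlog y x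
    + hlog a x \<bullet> hlog a b + hlog b y \<bullet> hlog b a"

text \<open>Here \<open>U\<close> and \<open>U'\<close> are the velocities, at the two ends, of the geodesic to the other end.  The form vanishes
  if the velocities \<open>v\<close> and \<open>w\<close> of the ends translate the edge along itself; conversely, a zero is such a
  translation once the first variation \<open>- (v \<bullet> U + w \<bullet> U')\<close> is known to vanish.\<close>

definition edge_form :: "complex \<Rightarrow> complex \<Rightarrow> complex \<Rightarrow> complex \<Rightarrow> real"
  where "edge_form U U' v w = ((norm v)\<^sup>2 * (norm U)\<^sup>2 - (v \<bullet> U)\<^sup>2) + (norm v - norm w)\<^sup>2
    + (max 0 (- (v \<bullet> U + w \<bullet> U')))\<^sup>2 + (if U = 0 then (norm (v - w))\<^sup>2 else 0)"

text \<open>\<open>Q\<close> is the defect of a geodesic quadrilateral. Adding the comparison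
  inequalities at the four corners counts every side and every diagonal twice, which gives
  \<open>Q\<close>; the strict form at the corner a contributes the last term, the 8 being twice the
  4 of \<open>cat0_strict\<close>. The two lower bounds on \<open>Q\<close> are the quadrilateral
  inequality for either pair of opposite sides.\<close>

lemma corner_sum_defect:
  assumes a: "a \<in> disk" and b: "b \<in> disk" and x: "x \<in> disk" and y: "y \<in> disk"
  defines "Q \<equiv> (hdist a x)\<^sup>2 + (hdist b y)\<^sup>2 + (hdist a b)\<^sup>2 + (hdist x y)\<^sup>2 - (hdist a y)\<^sup>2 - (hdist b x)\<^sup>2"
  assumes M: "hdist a x + hdist a b \<le> M"
  shows "corner_sum a b x y \<ge> Q
      + ((hdist a x)\<^sup>2 * (hdist a b)\<^sup>2 - (hlog a x \<bullet> hlog a b)\<^sup>2) / (8 * cosh M ^ 3)"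
    and "Q \<ge> (hdist a x - hdist b y)\<^sup>2" and "Q \<ge> (hdist a b - hdist x y)\<^sup>2"
proof -
  have c: "hdist x a = hdist a x" "hdist y b = hdist b y" "hdist b a = hdist a b" "hdist y x = hdist x y"
      "hdist y a = hdist a y" "hdist x b = hdist b x"
    using hdist_commute assms by blast+
  have "(norm (hlog a x - hlog a b))\<^sup>2 = (hdist a x)\<^sup>2 + (hdist a b)\<^sup>2 - 2 * (hlog a x \<bullet> hlog a b)"
    unfolding norm_hlog[OF a x, symmetric] norm_hlog[OF a b, symmetric]
    by (simp add: power2_norm_eq_inner inner_diff_left inner_diff_right inner_commute)
  then have "2 * (hlog a x \<bullet> hlog a b) \<ge> (hdist a x)\<^sup>2 + (hdist a b)\<^sup>2 - (hdist b x)\<^sup>2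
      + ((hdist a x)\<^sup>2 * (hdist a b)\<^sup>2 - (hlog a x \<bullet> hlog a b)\<^sup>2) / (4 * cosh M ^ 3)"
    using cat0_strict[OF a x b M] by (simp add: c)
  moreover have "2 * (hlog x a \<bullet> hlog x y) \<ge> (hdist a x)\<^sup>2 + (hdist x y)\<^sup>2 - (hdist a y)\<^sup>2"
    using hlog_inner_ge[OF x a y] by (simp add: c)
  moreover have "2 * (hlog y b \<bullet> hlog y x) \<ge> (hdist b y)\<^sup>2 + (hdist x y)\<^sup>2 - (hdist b x)\<^sup>2"
    using hlog_inner_ge[OF y b x] by (simp add: c)
  moreover have "2 * (hlog b y \<bullet> hlog b a) \<ge> (hdist b y)\<^sup>2 + (hdist a b)\<^sup>2 - (hdist a y)\<^sup>2"
    using hlog_inner_ge[OF b y a] by (simp add: c)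
  moreover have "X / (8 * cosh M ^ 3) = X / (4 * cosh M ^ 3) / 2" for X by simp
  ultimately show "corner_sum a b x y \<ge> Q
      + ((hdist a x)\<^sup>2 * (hdist a b)\<^sup>2 - (hlog a x \<bullet> hlog a b)\<^sup>2) / (8 * cosh M ^ 3)"
    unfolding corner_sum_def Q_def by simp
  show "Q \<ge> (hdist a x - hdist b y)\<^sup>2"
    using quadrilateral_inequality[OF a b x y] unfolding Q_def by (simp add: power2_diff)
  show "Q \<ge> (hdist a b - hdist x y)\<^sup>2"
    using quadrilateral_inequality[OF a x b y] unfolding Q_def by (simp add: power2_diff c)
qed

lemma corner_sum_nonneg:
  assumes a: "a \<in> disk" and b: "b \<in> disk" and x: "x \<in> disk" and y: "y \<in> disk"
  shows "corner_sum a b x y \<ge> 0"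
proof -
  have "0 \<le> ((hdist a x)\<^sup>2 * (hdist a b)\<^sup>2 - (hlog a x \<bullet> hlog a b)\<^sup>2) / (8 * cosh (hdist a x + hdist a b) ^ 3)"
    using hlog_inner_le[OF a x b] by (intro divide_nonneg_pos) auto
  with corner_sum_defect(1,2)[OF assms order_refl] zero_le_power2[of "hdist a x - hdist b y"]
  show ?thesis by linarith
qed

text \<open>Each term of the form has its own source: the Gram determinant comes from the strict
  gain, the difference of speeds from the first lower bound on the defect, the one-sided variation
  and the term for a = b from the second. The gain weakens as the triangle grows, so
  \<open>P\<close> is needed to make the factor uniform.\<close>

lemma corner_sum_ge_edge_form:
  assumes a: "a \<in> disk" and b: "b \<in> disk" and x: "x \<in> disk" and y: "y \<in> disk"
    and P: "hdist a x \<le> P" "hdist a b \<le> P"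
  shows "edge_form (hlog a b) (hlog b a) (hlog a x) (hlog b y)
    \<le> (3 * (1 + P\<^sup>2) + 8 * cosh (2 * P) ^ 3) * corner_sum a b x y"
proof -
  define p where "p = hdist a x"
  define q where "q = hdist b y"
  define m where "m = hdist a b"
  define n where "n = hdist x y"
  define Q where "Q = p\<^sup>2 + q\<^sup>2 + m\<^sup>2 + n\<^sup>2 - (hdist a y)\<^sup>2 - (hdist b x)\<^sup>2"
  define cr where "cr = p\<^sup>2 * m\<^sup>2 - (hlog a x \<bullet> hlog a b)\<^sup>2"
  define C where "C = 8 * cosh (2 * P) ^ 3"
  have C: "C > 0" by (simp add: C_def)
  have cr: "0 \<le> cr" using hlog_inner_le[OF a x b] by (simp add: cr_def p_def m_def)
  have M: "hdist a x + hdist a b \<le> 2 * P" using P by simp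
  have m0: "0 \<le> m" "m \<le> P" using hdist_nonneg[OF a b] P by (simp_all add: m_def)
  note W = corner_sum_defect[OF a b x y M, folded p_def q_def m_def n_def, folded Q_def cr_def C_def]
  \<comment> \<open>\<open>\<delta>\<close> is the first variation of half the squared length. The
    bound \<open>\<delta> \<le> m * (n - m)\<close> is convexity of the length, multiplied by m; it
    is an estimate from above, hence the \<open>max\<close> in the form.\<close>
  have mx: "(max 0 (- (hlog a x \<bullet> hlog a b + hlog b y \<bullet> hlog b a)))\<^sup>2 \<le> P\<^sup>2 * Q"
  proof -
    define \<delta> where "\<delta> = - (hlog a x \<bullet> hlog a b + hlog b y \<bullet> hlog b a)"
    have c: "hdist b a = m" "hdist y a = hdist a y" "hdist x b = hdist b x"
      using hdist_commute assms by (auto simp: m_def)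
    have "2 * (hlog a x \<bullet> hlog a b) \<ge> p\<^sup>2 + m\<^sup>2 - (hdist b x)\<^sup>2"
      using hlog_inner_ge[OF a x b] by (simp add: p_def m_def c)
    moreover have "2 * (hlog b y \<bullet> hlog b a) \<ge> q\<^sup>2 + m\<^sup>2 - (hdist a y)\<^sup>2"
      using hlog_inner_ge[OF b y a] by (simp add: q_def c)
    moreover have "(hdist a y)\<^sup>2 + (hdist b x)\<^sup>2 \<le> p\<^sup>2 + q\<^sup>2 + 2 * m * n"
      using quadrilateral_inequality[OF a x b y] by (simp add: p_def q_def m_def n_def c)
    ultimately have "\<delta> \<le> m * (n - m)" unfolding \<delta>_def by (simp add: algebra_simps power2_eq_square)
    then have "\<bar>max 0 \<delta>\<bar> \<le> \<bar>m * (n - m)\<bar>" by linarith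
    then have "(max 0 \<delta>)\<^sup>2 \<le> (m * (n - m))\<^sup>2" by (simp only: abs_le_square_iff)
    also have "\<dots> = m\<^sup>2 * (m - n)\<^sup>2" by (simp add: power2_eq_square algebra_simps)
    also have "\<dots> \<le> P\<^sup>2 * Q" using W(3) m0 by (intro mult_mono power_mono) auto
    finally show ?thesis by (simp add: \<delta>_def)
  qed
  have z: "(if hlog a b = 0 then (norm (hlog a x - hlog b y))\<^sup>2 else 0) \<le> Q"
  proof (cases "hlog a b = 0")
    case True
    then have "m = 0" "a = b" using norm_hlog[OF a b] hdist_eq_0_iff[OF a b] by (auto simp: m_def)
    then have "(norm (hlog a x - hlog b y))\<^sup>2 \<le> n\<^sup>2" using cat0[OF a x y] by (simp add: n_def)
    also have "\<dots> \<le> Q" using W(3) \<open>m = 0\<close> by simp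
    finally show ?thesis using True by simp
  next
    case False
    have "0 \<le> Q" using W(2) zero_le_power2[of "p - q"] by linarith
    then show ?thesis using False by simp
  qed
  have Q0: "0 \<le> Q" using W(2) zero_le_power2[of "p - q"] by linarith
  have "edge_form (hlog a b) (hlog b a) (hlog a x) (hlog b y) \<le> cr + Q + P\<^sup>2 * Q + Q"
    unfolding edge_form_def norm_hlog[OF a b] norm_hlog[OF a x] norm_hlog[OF b y]
    using mx z W(2) by (simp add: p_def m_def q_def cr_def)
  also have "\<dots> \<le> 3 * (1 + P\<^sup>2) * Q + C * (cr / C)" using C Q0 by (simp add: algebra_simps)
  also have "\<dots> \<le> (3 * (1 + P\<^sup>2) + C) * Q + (3 * (1 + P\<^sup>2) + C) * (cr / C)"
    using C Q0 cr by (intro add_mono mult_right_mono) (auto intro!: divide_nonneg_pos)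
  also have "\<dots> = (3 * (1 + P\<^sup>2) + C) * (Q + cr / C)" by (simp add: algebra_simps)
  also have "\<dots> \<le> (3 * (1 + P\<^sup>2) + C) * corner_sum a b x y"
    using W(1) C by (intro mult_left_mono) (auto intro: add_nonneg_nonneg)
  finally show ?thesis by (simp add: C_def)
qed

lemma parallel_of_inner_eq:
  fixes u v :: complex
  assumes "norm u = 1" "(norm v)\<^sup>2 = (v \<bullet> u)\<^sup>2"
  shows "v = (v \<bullet> u) *\<^sub>R u"
proof -
  have "u \<bullet> u = 1" using assms(1) by (simp add: norm_eq_1)
  then have "(norm (v - (v \<bullet> u) *\<^sub>R u))\<^sup>2 = (norm v)\<^sup>2 - (v \<bullet> u)\<^sup>2"
    unfolding power2_norm_eq_inner
    by (simp add: inner_diff_left inner_diff_right inner_commute[of u v] power2_eq_square)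
  then show ?thesis using assms(2) by simp
qed

lemma mult_unit_inner:
  assumes "norm (\<omega>::complex) = 1"
  shows "(\<omega> * v) \<bullet> (\<omega> * w) = v \<bullet> w"
proof -
  have "(Re \<omega>)\<^sup>2 + (Im \<omega>)\<^sup>2 = 1" using assms cmod_power2[of \<omega>] by simp
  moreover have "(\<omega> * v) \<bullet> (\<omega> * w) = ((Re \<omega>)\<^sup>2 + (Im \<omega>)\<^sup>2) * (v \<bullet> w)"
    by (simp add: inner_complex_def power2_eq_square algebra_simps)
  ultimately show ?thesis by simp
qed

text \<open>A vanishing Gram determinant makes v parallel to the edge; equal norms and vanishing
  first variation make w the same translation at the other end. Both ends then slide by s \<tau>
  along one geodesic. The form yields only that the sum of inner products is nonnegative, and
  \<open>crit\<close> turns this into equality. For a = b there is no direction, and the extra term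
  of the form gives v = w.\<close>

lemma edge_translation_rigid:
  assumes a: "a \<in> disk" and b: "b \<in> disk"
    and form: "edge_form (hlog a b) (hlog b a) v w = 0"
    and crit: "v \<bullet> hlog a b + w \<bullet> hlog b a \<ge> 0 \<Longrightarrow> v \<bullet> hlog a b + w \<bullet> hlog b a = 0"
  shows "hdist (hexp a (s *\<^sub>R v)) (hexp b (s *\<^sub>R w)) = hdist a b"
proof -
  define m where "m = hdist a b"
  have nU: "norm (hlog a b) = m" unfolding m_def by (rule norm_hlog[OF a b])
  have C: "(v \<bullet> hlog a b)\<^sup>2 \<le> (norm v)\<^sup>2 * m\<^sup>2"
    using Cauchy_Schwarz_ineq[of v "hlog a b"] unfolding nU[symmetric] power2_norm_eq_inner .
  define Z where "Z = (if hlog a b = 0 then (norm (v - w))\<^sup>2 else 0)"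
  have Z: "Z \<ge> 0" by (simp add: Z_def)
  have "((norm v)\<^sup>2 * m\<^sup>2 - (v \<bullet> hlog a b)\<^sup>2) + (norm v - norm w)\<^sup>2
      + (max 0 (- (v \<bullet> hlog a b + w \<bullet> hlog b a)))\<^sup>2 + Z = 0"
    using form unfolding edge_form_def nU Z_def .
  then have f: "(norm v)\<^sup>2 * m\<^sup>2 - (v \<bullet> hlog a b)\<^sup>2 = 0" "(norm v - norm w)\<^sup>2 = 0"
      "(max 0 (- (v \<bullet> hlog a b + w \<bullet> hlog b a)))\<^sup>2 = 0" "Z = 0"
    using C Z zero_le_power2[of "norm v - norm w"]
      zero_le_power2[of "max 0 (- (v \<bullet> hlog a b + w \<bullet> hlog b a))"] by linarith+
  have vw: "norm v = norm w" using f(2) by simp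
  have crit0: "v \<bullet> hlog a b + w \<bullet> hlog b a = 0"
    using f(3) crit by (auto simp: max_def split: if_splits)
  show ?thesis
  proof (cases "a = b")
    case True
    then have "v = w" using f(4) by (simp add: Z_def)
    then show ?thesis using True b hexp_disk by simp
  next
    case False
    then have m: "m > 0" using hdist_nonneg[OF a b] hdist_eq_0_iff[OF a b] by (simp add: m_def less_le)
    obtain u where u: "norm u = 1" and b0: "moebius a b = tanh (m / 2) *\<^sub>R u"
      using moebius_polar[OF a b] by (metis m_def)
    have h0: "hlog 0 (moebius a z) = hlog a z" for z by (simp add: hlog_def)
    have l: "hlog 0 (tanh (\<alpha> / 2) *\<^sub>R u) = \<alpha> *\<^sub>R u" for \<alpha>
      using hlog_line[OF u, of 0 \<alpha>] by simp
    have U: "hlog a b = m *\<^sub>R u" using h0[of b] l[of m] b0 by simp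
    define \<tau> where "\<tau> = v \<bullet> u"
    have "(norm v)\<^sup>2 = \<tau>\<^sup>2" using f(1) m by (simp add: U \<tau>_def power_mult_distrib)
    then have v: "v = \<tau> *\<^sub>R u" using parallel_of_inner_eq[OF u, of v] by (simp add: \<tau>_def)
    \<comment> \<open>After moving a to 0 the edge lies on a diameter; the frame at b turns by
      \<open>\<omega>\<close>, so w has to be compared with u as
      \<open>\<omega> * w\<close>.\<close>
    obtain \<omega> where \<omega>: "norm \<omega> = 1" "\<And>z. z \<in> disk \<Longrightarrow> hlog (moebius a b) (moebius a z) = \<omega> * hlog b z"
      using hlog_isometry[OF disk_isometry_moebius[OF a] b] by metis
    have "\<omega> * hlog b a = - m *\<^sub>R u"
      using \<omega>(2)[OF a] hlog_line[OF u, of m 0] by (simp add: b0)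
    then have "w \<bullet> hlog b a = - m * ((\<omega> * w) \<bullet> u)"
      using mult_unit_inner[OF \<omega>(1), of w "hlog b a"] by simp
    then have wu: "(\<omega> * w) \<bullet> u = \<tau>" using crit0 m by (simp add: U \<tau>_def)
    have "norm (\<omega> * w) = norm v" using vw \<omega>(1) by (simp add: norm_mult)
    then have "(norm (\<omega> * w))\<^sup>2 = ((\<omega> * w) \<bullet> u)\<^sup>2" unfolding wu using \<open>(norm v)\<^sup>2 = \<tau>\<^sup>2\<close> by simp
    then have w: "\<omega> * w = \<tau> *\<^sub>R u" using parallel_of_inner_eq[OF u, of "\<omega> * w"] wu by simp
    define x where "x = hexp a (s *\<^sub>R v)"
    define y where "y = hexp b (s *\<^sub>R w)"
    have x: "x \<in> disk" and y: "y \<in> disk" unfolding x_def y_def using hexp_disk a b by auto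
    have 0: "0 \<in> disk" by simp
    have "hlog 0 (moebius a x) = (s * \<tau>) *\<^sub>R u"
      unfolding h0 x_def hlog_hexp[OF a] by (simp add: v)
    then have x0: "moebius a x = tanh (s * \<tau> / 2) *\<^sub>R u"
      using hlog_inject[OF 0 moebius_disk[OF a x] line_disk[OF u]] l[of "s * \<tau>"] by metis
    have "hlog (moebius a b) (moebius a y) = \<omega> * (s *\<^sub>R w)"
      unfolding \<omega>(2)[OF y] unfolding y_def hlog_hexp[OF b] ..
    also have "\<dots> = (s * \<tau>) *\<^sub>R u" using w by simp
    also have "\<dots> = hlog (moebius a b) (tanh ((m + s * \<tau>) / 2) *\<^sub>R u)"
      using hlog_line[OF u, of m "m + s * \<tau>"] by (simp add: b0)
    finally have y0: "moebius a y = tanh ((m + s * \<tau>) / 2) *\<^sub>R u"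
      by (rule hlog_inject[OF moebius_disk[OF a b] moebius_disk[OF a y] line_disk[OF u]])
    have "hdist x y = norm (hlog (moebius a x) (moebius a y))"
      using norm_hlog[OF moebius_disk[OF a x] moebius_disk[OF a y]] hdist_moebius[OF a x y] by simp
    also have "\<dots> = m" unfolding x0 y0 hlog_line[OF u] using u m by simp
    finally show ?thesis by (simp add: x_def y_def m_def)
  qed
qed

subsection \<open>Ordinary differential equations with a bounded Lipschitz right-hand side\<close>

text \<open>Picard iteration is a contraction with factor \<open>1/2\<close> for the norm weighted by \<open>exp (- 2 L t)\<close>.\<close>

lemma lipschitz_flow_exists:
  fixes G :: "'a::euclidean_space \<Rightarrow> 'a"
  assumes lip: "L-lipschitz_on UNIV G" and L: "L > 0" and bd: "\<And>x. norm (G x) \<le> M"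
  obtains x where "x 0 = x\<^sub>0" "\<And>t. t \<ge> 0 \<Longrightarrow> (x has_vector_derivative G (x t)) (at t within {0..})"
proof -
  have contG: "continuous_on UNIV G" using lip by (rule lipschitz_on_continuous_on)
  have M: "M \<ge> 0" using bd[of 0] norm_ge_zero[of "G 0"] by linarith
  \<comment> \<open>The substitution x t = x0 + exp (2 L t) y t turns the weighted norm into the
    supremum norm, so that the contraction principle applies in the space of bounded continuous
    functions.\<close>
  define g where "g y s = G (x\<^sub>0 + exp (2 * L * s) *\<^sub>R y s)" for y :: "real \<Rightarrow> 'a" and s
  define I where "I y t = integral {0..t} (g y)" for y :: "real \<Rightarrow> 'a" and t
  \<comment> \<open>\<open>max 0 t\<close> extends the iterate to negative times by its value at 0,
    because the bounded continuous functions here live on the whole line. The exponential factor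
    keeps the linearly growing integral bounded.\<close>
  define T where "T y t = exp (- 2 * L * max 0 t) *\<^sub>R I y (max 0 t)" for y :: "real \<Rightarrow> 'a" and t
  have cg: "continuous_on S (g y)" if "continuous_on UNIV y" for y S
    unfolding g_def
    by (intro continuous_on_compose2[OF contG] continuous_intros continuous_on_subset[OF that]) auto
  have ig: "g y integrable_on {0..t}" if "continuous_on UNIV y" for y t
    by (rule integrable_continuous_interval[OF cg[OF that]])
  have cI: "continuous_on {0..} (I y)" if y: "continuous_on UNIV y" for y
  proof (rule continuous_on_eq_continuous_within[THEN iffD2], rule ballI)
    fix t :: real assume t: "t \<in> {0..}"
    have "continuous_on {0..t + 1} (I y)"
      unfolding I_def[abs_def] by (rule indefinite_integral_continuous_1[OF ig[OF y]])
    then have "continuous (at t within {0..t + 1}) (I y)"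
      using t by (simp add: continuous_on_eq_continuous_within)
    moreover have "at t within {0..} = at t within {0..t + 1}"
      using t by (intro at_within_nhd[of _ "{t - 1<..<t + 1}"]) auto
    ultimately show "continuous (at t within {0..}) (I y)" by simp
  qed
  have cT: "continuous_on UNIV (T y)" if "continuous_on UNIV y" for y
    unfolding T_def[abs_def]
    by (intro continuous_intros continuous_on_compose2[OF cI[OF that]]) (auto simp: le_max_iff_disj)
  have te: "t * exp (- 2 * L * t) \<le> 1 / (2 * L)" for t
  proof -
    have "2 * L * t \<le> exp (2 * L * t)" using exp_ge_add_one_self[of "2 * L * t"] by linarith
    then have "(2 * L * t) * exp (- (2 * L * t)) \<le> exp (2 * L * t) * exp (- (2 * L * t))"
      by (intro mult_right_mono) auto
    also have "\<dots> = 1" by (simp add: exp_minus)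
    finally show ?thesis using L by (simp add: field_simps)
  qed
  have bT: "norm (T y t) \<le> M / (2 * L)" if y: "continuous_on UNIV y" for y t
  proof -
    define s where "s = max 0 t"
    have s: "0 \<le> s" by (simp add: s_def)
    have "norm (I y s) \<le> integral {0..s} (\<lambda>_. M)"
      unfolding I_def using bd by (intro integral_norm_bound_integral ig[OF y]) (auto simp: g_def)
    then have "norm (I y s) \<le> s * M" using s by simp
    then have "exp (- 2 * L * s) * norm (I y s) \<le> exp (- 2 * L * s) * (s * M)"
      by (intro mult_left_mono) auto
    also have "\<dots> = (s * exp (- 2 * L * s)) * M" by simp
    also have "\<dots> \<le> 1 / (2 * L) * M" using te M by (intro mult_right_mono) auto
    finally show ?thesis by (simp add: T_def s_def)
  qed
  have Tb: "T y \<in> bcontfun" if "continuous_on UNIV y" for y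
    unfolding bcontfun_def using cT[OF that] bT[OF that] by (auto intro!: boundedI)
  define \<Phi> where "\<Phi> y = Bcontfun (T (apply_bcontfun y))" for y :: "real \<Rightarrow>\<^sub>C 'a"
  have \<Phi>: "apply_bcontfun (\<Phi> y) = T (apply_bcontfun y)" for y
    unfolding \<Phi>_def by (rule Bcontfun_inverse[OF Tb]) simp
  have contr: "dist (\<Phi> y) (\<Phi> z) \<le> (1/2) * dist y z" for y z
  proof (rule dist_bound)
    fix t :: real
    define s where "s = max 0 t"
    have s: "0 \<le> s" by (simp add: s_def)
    define d where "d = dist y z"
    have i: "((\<lambda>r. L * (exp (2 * L * r) * d)) has_integral
        (exp (2 * L * s) * d / 2 - exp (2 * L * 0) * d / 2)) {0..s}"
    proof (rule fundamental_theorem_of_calculus[OF s])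
      fix r
      have "((\<lambda>r. exp (2 * L * r) * d / 2) has_real_derivative L * (exp (2 * L * r) * d)) (at r within {0..s})"
        by (auto intro!: derivative_eq_intros)
      then show "((\<lambda>r. exp (2 * L * r) * d / 2) has_vector_derivative L * (exp (2 * L * r) * d)) (at r within {0..s})"
        by (simp add: has_real_derivative_iff_has_vector_derivative)
    qed
    have "norm (I (apply_bcontfun y) s - I (apply_bcontfun z) s)
        = norm (integral {0..s} (\<lambda>r. g (apply_bcontfun y) r - g (apply_bcontfun z) r))"
      unfolding I_def by (subst integral_diff[OF ig ig]) auto
    also have "\<dots> \<le> integral {0..s} (\<lambda>r. L * (exp (2 * L * r) * d))"
    proof (rule integral_norm_bound_integral)
      show "(\<lambda>r. g (apply_bcontfun y) r - g (apply_bcontfun z) r) integrable_on {0..s}"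
        by (intro integrable_diff ig) auto
      show "(\<lambda>r. L * (exp (2 * L * r) * d)) integrable_on {0..s}" using i by blast
      fix r assume "r \<in> {0..s}"
      have "norm (g (apply_bcontfun y) r - g (apply_bcontfun z) r)
          \<le> L * norm (exp (2 * L * r) *\<^sub>R apply_bcontfun y r - exp (2 * L * r) *\<^sub>R apply_bcontfun z r)"
        using lipschitz_onD[OF lip, of "x\<^sub>0 + exp (2 * L * r) *\<^sub>R apply_bcontfun y r" "x\<^sub>0 + exp (2 * L * r) *\<^sub>R apply_bcontfun z r"]
        by (simp add: g_def dist_norm)
      also have "\<dots> = L * (exp (2 * L * r) * dist (apply_bcontfun y r) (apply_bcontfun z r))"
        by (simp add: dist_norm flip: scaleR_diff_right)
      also have "\<dots> \<le> L * (exp (2 * L * r) * d)"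
        using L dist_bounded[of y r z] unfolding d_def by (intro mult_left_mono) auto
      finally show "norm (g (apply_bcontfun y) r - g (apply_bcontfun z) r) \<le> L * (exp (2 * L * r) * d)" .
    qed
    also have "\<dots> = exp (2 * L * s) * d / 2 - d / 2" using integral_unique[OF i] by simp
    also have "\<dots> \<le> exp (2 * L * s) * d / 2" by (simp add: d_def)
    finally have "exp (- 2 * L * s) * norm (I (apply_bcontfun y) s - I (apply_bcontfun z) s)
        \<le> exp (- 2 * L * s) * (exp (2 * L * s) * d / 2)" by (intro mult_left_mono) auto
    also have "\<dots> = d / 2" by (simp add: exp_minus)
    finally show "dist (apply_bcontfun (\<Phi> y) t) (apply_bcontfun (\<Phi> z) t) \<le> (1/2) * dist y z"
      unfolding \<Phi> T_def s_def[symmetric] d_def dist_norm by (simp flip: scaleR_diff_right)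
  qed
  have "\<exists>!y. \<Phi> y = y" using contr by (intro banach_fix_type[of "1/2"]) auto
  then obtain y where y: "\<Phi> y = y" by blast
  have cy: "continuous_on UNIV (apply_bcontfun y)" by simp
  define x where "x t = x\<^sub>0 + I (apply_bcontfun y) t" for t
  have gx: "g (apply_bcontfun y) t = G (x t)" if "t \<ge> 0" for t
  proof -
    have "apply_bcontfun y t = exp (- 2 * L * t) *\<^sub>R I (apply_bcontfun y) t"
      using \<Phi>[of y] that unfolding y by (simp add: fun_eq_iff T_def)
    then have "exp (2 * L * t) *\<^sub>R apply_bcontfun y t = I (apply_bcontfun y) t"
      by (simp add: exp_minus)
    then show ?thesis by (simp add: g_def x_def)
  qed
  show ?thesis
  proof (rule that)
    show "x 0 = x\<^sub>0" by (simp add: x_def I_def)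
    fix t :: real assume t: "t \<ge> 0"
    have "(I (apply_bcontfun y) has_vector_derivative g (apply_bcontfun y) t) (at t within {0..t + 1})"
      unfolding I_def[abs_def] using t by (intro integral_has_vector_derivative cg[OF cy]) auto
    then have "(x has_vector_derivative G (x t)) (at t within {0..t + 1})"
      unfolding x_def[abs_def] gx[OF t, symmetric, unfolded x_def]
      by (auto intro!: derivative_eq_intros)
    moreover have "at t within {0..} = at t within {0..t + 1}"
      using t by (intro at_within_nhd[of _ "{t - 1<..<t + 1}"]) auto
    ultimately show "(x has_vector_derivative G (x t)) (at t within {0..})" by simp
  qed
qed

subsection \<open>Bounded Lipschitz functions\<close>

text \<open>Boundedness is carried along because products of Lipschitz functions need not be
  Lipschitz without it; the pair of properties is stable under all operations that build the vector
  field.\<close>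

definition bounded_lipschitz :: "'a::metric_space set \<Rightarrow> ('a \<Rightarrow> 'b::real_normed_vector) \<Rightarrow> bool"
  where "bounded_lipschitz S f \<longleftrightarrow> (\<exists>L. L-lipschitz_on S f) \<and> (\<exists>B. \<forall>x\<in>S. norm (f x) \<le> B)"

lemma bounded_lipschitz_const: "bounded_lipschitz S (\<lambda>x. c)"
  unfolding bounded_lipschitz_def using lipschitz_on_constant by blast

lemma bounded_lipschitz_add:
  assumes "bounded_lipschitz S f" "bounded_lipschitz S g"
  shows "bounded_lipschitz S (\<lambda>x. f x + g x)"
proof -
  obtain L M B C where "L-lipschitz_on S f" "M-lipschitz_on S g"
      and b: "\<And>x. x \<in> S \<Longrightarrow> norm (f x) \<le> B" "\<And>x. x \<in> S \<Longrightarrow> norm (g x) \<le> C"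
    using assms unfolding bounded_lipschitz_def by metis
  then have "(L + M)-lipschitz_on S (\<lambda>x. f x + g x)" by (intro lipschitz_on_add)
  moreover have "norm (f x + g x) \<le> B + C" if "x \<in> S" for x
    using norm_triangle_ineq[of "f x" "g x"] b[OF that] by linarith
  ultimately show ?thesis unfolding bounded_lipschitz_def by blast
qed

lemma bounded_lipschitz_sum:
  assumes "\<And>i. i \<in> I \<Longrightarrow> bounded_lipschitz S (f i)"
  shows "bounded_lipschitz S (\<lambda>x. \<Sum>i\<in>I. f i x)"
  using assms
  by (induction I rule: infinite_finite_induct) (auto intro: bounded_lipschitz_const bounded_lipschitz_add)

lemma (in bounded_bilinear) bounded_lipschitz:
  assumes "bounded_lipschitz S f" "bounded_lipschitz S g"
  shows "bounded_lipschitz S (\<lambda>x. prod (f x) (g x))"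
proof -
  obtain L M B C where l: "L-lipschitz_on S f" "M-lipschitz_on S g"
      and b: "\<And>x. x \<in> S \<Longrightarrow> norm (f x) \<le> B" "\<And>x. x \<in> S \<Longrightarrow> norm (g x) \<le> C"
    using assms unfolding bounded_lipschitz_def by metis
  obtain K where K: "K \<ge> 0" "\<And>a b. norm (prod a b) \<le> norm a * norm b * K" using nonneg_bounded by blast
  note L0 = lipschitz_on_nonneg[OF l(1)] lipschitz_on_nonneg[OF l(2)]
  have "((L * \<bar>C\<bar> + \<bar>B\<bar> * M) * K)-lipschitz_on S (\<lambda>x. prod (f x) (g x))"
  proof (rule lipschitz_onI)
    fix x y assume xy: "x \<in> S" "y \<in> S"
    have "prod (f x) (g x) - prod (f y) (g y) = prod (f x - f y) (g x) + prod (f y) (g x - g y)"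
      by (simp add: diff_left diff_right)
    then have "dist (prod (f x) (g x)) (prod (f y) (g y)) \<le> norm (prod (f x - f y) (g x)) + norm (prod (f y) (g x - g y))"
      by (simp add: dist_norm norm_triangle_ineq)
    also have "\<dots> \<le> norm (f x - f y) * norm (g x) * K + norm (f y) * norm (g x - g y) * K"
      by (intro add_mono K)
    also have "\<dots> \<le> (L * dist x y) * \<bar>C\<bar> * K + \<bar>B\<bar> * (M * dist x y) * K"
      using lipschitz_onD[OF l(1) xy] lipschitz_onD[OF l(2) xy] b(2)[OF xy(1)] b(1)[OF xy(2)] K(1) L0
      by (intro add_mono mult_right_mono mult_mono) (auto simp: dist_norm)
    finally show "dist (prod (f x) (g x)) (prod (f y) (g y)) \<le> (L * \<bar>C\<bar> + \<bar>B\<bar> * M) * K * dist x y"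
      by (simp add: algebra_simps)
  qed (use L0 K in auto)
  moreover have "norm (prod (f x) (g x)) \<le> \<bar>B\<bar> * \<bar>C\<bar> * K" if "x \<in> S" for x
  proof -
    have "norm (f x) * norm (g x) * K \<le> \<bar>B\<bar> * \<bar>C\<bar> * K"
      using b[OF that] K(1) by (intro mult_right_mono mult_mono) auto
    then show ?thesis using K(2)[of "f x" "g x"] by linarith
  qed
  ultimately show ?thesis unfolding bounded_lipschitz_def by blast
qed

lemma (in bounded_linear) bounded_lipschitz:
  assumes "bounded_lipschitz S g"
  shows "bounded_lipschitz S (\<lambda>x. f (g x))"
proof -
  obtain L B where l: "L-lipschitz_on S g" and b: "\<And>x. x \<in> S \<Longrightarrow> norm (g x) \<le> B"
    using assms unfolding bounded_lipschitz_def by metis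
  obtain K where K: "K \<ge> 0" "\<And>a. norm (f a) \<le> norm a * K" using nonneg_bounded by blast
  have "(K * L)-lipschitz_on S (\<lambda>x. f (g x))"
  proof (rule lipschitz_onI)
    fix x y assume xy: "x \<in> S" "y \<in> S"
    have "dist (f (g x)) (f (g y)) \<le> norm (g x - g y) * K" using K(2)[of "g x - g y"] by (simp add: dist_norm diff)
    also have "\<dots> \<le> (L * dist x y) * K" using lipschitz_onD[OF l xy] K(1) by (intro mult_right_mono) (auto simp: dist_norm)
    finally show "dist (f (g x)) (f (g y)) \<le> K * L * dist x y" by (simp add: mult_ac)
  qed (use lipschitz_on_nonneg[OF l] K in auto)
  moreover have "norm (f (g x)) \<le> B * K" if "x \<in> S" for x
    using K(2)[of "g x"] mult_right_mono[OF b[OF that] K(1)] by linarith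
  ultimately show ?thesis unfolding bounded_lipschitz_def by blast
qed

lemma bounded_lipschitz_compose:
  assumes "bounded_lipschitz S f" "bounded_lipschitz T g" "f ` S \<subseteq> T"
  shows "bounded_lipschitz S (\<lambda>x. g (f x))"
proof -
  obtain L M C where l: "L-lipschitz_on S f" "M-lipschitz_on T g" and c: "\<And>x. x \<in> T \<Longrightarrow> norm (g x) \<le> C"
    using assms unfolding bounded_lipschitz_def by metis
  have "(M * L)-lipschitz_on S (\<lambda>x. g (f x))"
    using lipschitz_on_compose2[OF l(1) lipschitz_on_subset[OF l(2) assms(3)]] by (simp add: o_def)
  then show ?thesis unfolding bounded_lipschitz_def using c assms(3) by blast
qed

lemma bounded_lipschitz_of_deriv:
  fixes f f' :: "'a::{real_normed_field, heine_borel} \<Rightarrow> 'a"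
  assumes "convex S" "compact S" "\<And>x. x \<in> S \<Longrightarrow> (f has_field_derivative f' x) (at x)" "continuous_on S f'"
  shows "bounded_lipschitz S f"
proof -
  obtain B where B: "\<And>x. x \<in> S \<Longrightarrow> norm (f' x) \<le> B"
    using compact_imp_bounded[OF compact_continuous_image[OF assms(4,2)]] unfolding bounded_iff by auto
  have "\<bar>B\<bar>-lipschitz_on S f"
  proof (rule lipschitz_onI)
    fix x y assume xy: "x \<in> S" "y \<in> S"
    show "dist (f x) (f y) \<le> \<bar>B\<bar> * dist x y"
      unfolding dist_norm
      by (rule field_differentiable_bound[OF assms(1), of f f'])
         (use xy assms(3) B has_field_derivative_at_within abs_ge_self order_trans in blast)+
  qed simp
  moreover have "continuous_on S f"
    using assms(3) by (meson DERIV_isCont continuous_at_imp_continuous_on)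
  then have "bounded (f ` S)" by (intro compact_imp_bounded compact_continuous_image assms(2))
  then obtain C where "\<And>x. x \<in> S \<Longrightarrow> norm (f x) \<le> C" unfolding bounded_iff by (metis imageI)
  ultimately show ?thesis unfolding bounded_lipschitz_def by blast
qed

lemma bounded_lipschitz_norm:
  assumes "bounded_lipschitz S f"
  shows "bounded_lipschitz S (\<lambda>x. norm (f x))"
proof -
  obtain L B where l: "L-lipschitz_on S f" and b: "\<And>x. x \<in> S \<Longrightarrow> norm (f x) \<le> B"
    using assms unfolding bounded_lipschitz_def by metis
  have "L-lipschitz_on S (\<lambda>x. norm (f x))"
  proof (rule lipschitz_onI)
    fix x y assume xy: "x \<in> S" "y \<in> S"
    have "dist (norm (f x)) (norm (f y)) \<le> dist (f x) (f y)"
      by (simp add: dist_norm norm_triangle_ineq3)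
    then show "dist (norm (f x)) (norm (f y)) \<le> L * dist x y" using lipschitz_onD[OF l xy] by linarith
  qed (rule lipschitz_on_nonneg[OF l])
  then show ?thesis unfolding bounded_lipschitz_def using b by auto
qed

lemma bounded_lipschitz_inverse:
  fixes f :: "'a::metric_space \<Rightarrow> complex"
  assumes "bounded_lipschitz S f" "e > 0" "\<And>x. x \<in> S \<Longrightarrow> e \<le> norm (f x)"
  shows "bounded_lipschitz S (\<lambda>x. inverse (f x))"
proof -
  obtain L where l: "L-lipschitz_on S f"
    using assms unfolding bounded_lipschitz_def by metis
  have "(L / e\<^sup>2)-lipschitz_on S (\<lambda>x. inverse (f x))"
  proof (rule lipschitz_onI)
    fix x y assume xy: "x \<in> S" "y \<in> S"
    have nz: "f x \<noteq> 0" "f y \<noteq> 0" using assms(2,3) xy by fastforce+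
    have "inverse (f x) - inverse (f y) = (f y - f x) / (f x * f y)" using nz by (simp add: field_simps)
    then have "dist (inverse (f x)) (inverse (f y)) = dist (f x) (f y) / (norm (f x) * norm (f y))"
      by (simp add: dist_norm norm_divide norm_mult norm_minus_commute)
    also have "\<dots> \<le> (L * dist x y) / (e * e)"
      using lipschitz_onD[OF l xy] lipschitz_on_nonneg[OF l] assms(2,3) xy
      by (intro frac_le mult_mono) (auto intro: less_imp_le)
    finally show "dist (inverse (f x)) (inverse (f y)) \<le> L / e\<^sup>2 * dist x y" by (simp add: power2_eq_square)
  qed (use lipschitz_on_nonneg[OF l] in auto)
  moreover have "norm (inverse (f x)) \<le> inverse e" if "x \<in> S" for x
    using assms(2,3) that by (simp add: norm_inverse le_imp_inverse_le)
  ultimately show ?thesis unfolding bounded_lipschitz_def by blast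
qed

subsection \<open>Hyperbolic balls\<close>

lemma hdist_0_tanh: "z \<in> disk \<Longrightarrow> cmod z = tanh (hdist 0 z / 2)"
  using tanh_half_hdist[of 0 z] by simp

lemma hdist_bounded_on_cball:
  assumes R: "R < 1"
  obtains B where "\<And>z w. cmod z \<le> R \<Longrightarrow> cmod w \<le> R \<Longrightarrow> hdist z w \<le> B"
proof -
  have b: "hdist 0 z \<le> 2 * artanh R" if "cmod z \<le> R" for z
  proof -
    have z: "z \<in> disk" using that R by simp
    have "\<bar>R\<bar> < 1" using R that norm_ge_zero[of z] by linarith
    then have "tanh (hdist 0 z / 2) \<le> tanh (artanh R)"
      using that hdist_0_tanh[OF z] tanh_artanh by simp
    then show ?thesis by simp
  qed
  show ?thesis
  proof (rule that)
    fix z w assume zw: "cmod z \<le> R" "cmod w \<le> R"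
    then have d: "z \<in> disk" "w \<in> disk" "0 \<in> disk" using R by auto
    show "hdist z w \<le> 2 * artanh R + 2 * artanh R"
      using hdist_triangle[OF d(1,3,2)] b[OF zw(1)] b[OF zw(2)] hdist_commute[OF d(1,3)] by linarith
  qed
qed

lemma cmod_le_of_hdist:
  assumes "z \<in> disk" "hdist 0 z \<le> B"
  shows "cmod z \<le> tanh (B / 2)"
  using assms by (simp only: hdist_0_tanh) simp

lemma cmod_diff_le_hdist:
  assumes z: "z \<in> disk" and w: "w \<in> disk"
  shows "cmod (z - w) \<le> hdist z w"
proof -
  define d where "d = hdist z w / 2"
  have d: "0 \<le> d" using hdist_nonneg[OF z w] by (simp add: d_def)
  have "cmod (cnj z * w) \<le> 1" using z w by (simp add: norm_mult mult_le_one)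
  then have "cmod (1 - cnj z * w) \<le> 2" using norm_triangle_ineq4[of 1 "cnj z * w"] by simp
  moreover have "cmod (z - w) = tanh d * cmod (1 - cnj z * w)"
    using one_minus_cnj_nz[OF z w]
    by (simp add: d_def tanh_half_hdist[OF z w] Moebius_function_simple norm_divide norm_minus_commute)
  ultimately have "cmod (z - w) \<le> tanh d * 2" using d by (simp add: mult_left_mono)
  also have "tanh d \<le> d"
  proof -
    have "sinh d \<le> d * cosh d" using sinh_le_self_cosh[OF d] d zero_le_power[OF d, of 3] by linarith
    then show ?thesis by (simp add: tanh_def field_simps)
  qed
  finally show ?thesis by (simp add: d_def)
qed

text \<open>On a smaller closed disk distances are bounded, so the norm of the Moebius quotient
  stays below some r < 1 and \<open>artanh_quot\<close> is evaluated away from its singularity at 1.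
  The denominator stays above 1 - R^2.\<close>

lemma bounded_lipschitz_hlog:
  fixes f g :: "'a::metric_space \<Rightarrow> complex"
  assumes f: "bounded_lipschitz S f" "\<And>x. x \<in> S \<Longrightarrow> cmod (f x) \<le> R"
    and g: "bounded_lipschitz S g" "\<And>x. x \<in> S \<Longrightarrow> cmod (g x) \<le> R" and R: "R < 1"
  shows "bounded_lipschitz S (\<lambda>x. hlog (f x) (g x))"
proof (cases "S = {}")
  case True
  then show ?thesis by (simp add: bounded_lipschitz_def) (meson lipschitz_on_empty_iff order_refl)
next
  case False
  then have R0: "0 \<le> R" using f(2) norm_ge_zero order_trans by (metis all_not_in_conv)
  obtain B where B: "\<And>z w. cmod z \<le> R \<Longrightarrow> cmod w \<le> R \<Longrightarrow> hdist z w \<le> B"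
    using hdist_bounded_on_cball[OF R] by metis
  define r where "r = tanh (B / 2)"
  define u where "u x = moebius (f x) (g x)" for x
  have ur: "cmod (u x) \<le> r" if "x \<in> S" for x
  proof -
    have d: "f x \<in> disk" "g x \<in> disk" using f(2)[OF that] g(2)[OF that] R by auto
    show ?thesis unfolding u_def r_def tanh_half_hdist[OF d, symmetric]
      using B[OF f(2)[OF that] g(2)[OF that]] by simp
  qed
  have r: "0 \<le> r" "r < 1" using ur False norm_ge_zero order_trans tanh_real_lt_1 unfolding r_def by (metis all_not_in_conv, blast)
  have i: "bounded_lipschitz S (\<lambda>x. inverse (1 + (- 1) * (cnj (f x) * g x)))"
  proof (rule bounded_lipschitz_inverse)
    show "bounded_lipschitz S (\<lambda>x. 1 + (- 1) * (cnj (f x) * g x))"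
      by (intro bounded_lipschitz_add bounded_lipschitz_const
          bounded_bilinear.bounded_lipschitz[OF bounded_bilinear_mult]
          bounded_linear.bounded_lipschitz[OF bounded_linear_cnj] f g)
    have "R * R \<le> R * 1" using R R0 by (intro mult_left_mono) auto
    then show "0 < 1 - R * R" using R by simp
    fix x assume x: "x \<in> S"
    have "cmod (cnj (f x) * g x) \<le> R * R"
      using f(2)[OF x] g(2)[OF x] R0 by (simp add: norm_mult mult_mono)
    then show "1 - R * R \<le> cmod (1 + (- 1) * (cnj (f x) * g x))"
      using norm_triangle_ineq2[of 1 "cnj (f x) * g x"] by simp
  qed
  have "bounded_lipschitz S (\<lambda>x. (g x + (- 1) * f x) * inverse (1 + (- 1) * (cnj (f x) * g x)))"
    by (intro bounded_lipschitz_add bounded_lipschitz_const i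
          bounded_bilinear.bounded_lipschitz[OF bounded_bilinear_mult] f g)
  then have u: "bounded_lipschitz S u"
    by (simp add: u_def[abs_def] Moebius_function_simple divide_inverse)
  have "bounded_lipschitz {0..r\<^sup>2} artanh_quot"
  proof (rule bounded_lipschitz_of_deriv[where f' = artanh_quot_deriv])
    have r2: "r\<^sup>2 < 1" using r by (simp add: power_less_one_iff abs_square_less_1)
    show "(artanh_quot has_field_derivative artanh_quot_deriv x) (at x)" if "x \<in> {0..r\<^sup>2}" for x
      using that r2 by (intro DERIV_artanh_quot) auto
    show "continuous_on {0..r\<^sup>2} artanh_quot_deriv"
      using r2 by (intro continuous_on_subset[OF continuous_on_artanh_quot_deriv]) auto
  qed auto
  then have q: "bounded_lipschitz S (\<lambda>x. artanh_quot (cmod (u x) * cmod (u x)))"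
  proof (rule bounded_lipschitz_compose[rotated])
    show "bounded_lipschitz S (\<lambda>x. cmod (u x) * cmod (u x))"
      by (intro bounded_bilinear.bounded_lipschitz[OF bounded_bilinear_mult] bounded_lipschitz_norm u)
    show "(\<lambda>x. cmod (u x) * cmod (u x)) ` S \<subseteq> {0..r\<^sup>2}"
      using ur r by (auto simp: power2_eq_square mult_mono)
  qed
  have "bounded_lipschitz S (\<lambda>x. (2 * artanh_quot (cmod (u x) * cmod (u x))) *\<^sub>R u x)"
    by (intro bounded_bilinear.bounded_lipschitz[OF bounded_bilinear_scaleR]
        bounded_bilinear.bounded_lipschitz[OF bounded_bilinear_mult] bounded_lipschitz_const q u)
  then show ?thesis by (simp add: hlog_def u_def power2_eq_square)
qed

subsection \<open>The energy of a weighted graph of isometries\<close>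

text \<open>The chain rule leaves the unknown derivative d of g in the second slot. It is eliminated
  by differentiating the distance from \<open>g' z\<close> to w' as well: this is the same function
  of w', since g is an isometry and maps \<open>g' z\<close> to z, and derivatives are
  unique.\<close>

lemma hdist_sq_isometry_has_derivative:
  assumes g: "disk_isometry g" and g': "disk_isometry g'" and inv: "\<And>w. w \<in> disk \<Longrightarrow> g (g' w) = w"
    and z: "z \<in> disk" and w: "w \<in> disk"
  shows "((\<lambda>(z, w). (hdist z (g w))\<^sup>2) has_derivative
    (\<lambda>(\<zeta>, \<eta>). - (4 / (1 - (cmod z)\<^sup>2)) * (hlog z (g w) \<bullet> \<zeta>) - (4 / (1 - (cmod w)\<^sup>2)) * (hlog w (g' z) \<bullet> \<eta>))) (at (z, w))"
proof -
  have gw: "g w \<in> disk" and g'z: "g' z \<in> disk" using g g' z w unfolding disk_isometry_def by blast+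
  have "g holomorphic_on disk" using g by (simp add: disk_isometry_def)
  then have "(g has_field_derivative deriv g w) (at w)" using w by (intro holomorphic_derivI[of _ disk]) auto
  then have dg: "(g has_derivative (\<lambda>\<eta>. deriv g w * \<eta>)) (at w)" by (simp add: has_field_derivative_def)
  define d where "d = deriv g w"
  have "((\<lambda>p. (fst p, g (snd p))) has_derivative (\<lambda>v. (fst v, d * snd v))) (at (z, w))"
    unfolding d_def
    by (intro has_derivative_Pair has_derivative_compose[of snd snd _ _ g] dg) (auto intro!: derivative_eq_intros dg)
  moreover have "((\<lambda>(z, w). (hdist z w)\<^sup>2) has_derivative
    (\<lambda>(\<zeta>, \<eta>). - (4 / (1 - (cmod z)\<^sup>2)) * (hlog z (g w) \<bullet> \<zeta>) - (4 / (1 - (cmod (g w))\<^sup>2)) * (hlog (g w) z \<bullet> \<eta>)))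
      (at (fst (z, w), g (snd (z, w))))"
    using hdist_sq_has_derivative[OF z gw] by simp
  ultimately have "((\<lambda>p. (\<lambda>(z, w). (hdist z w)\<^sup>2) (fst p, g (snd p))) has_derivative
    (\<lambda>v. (\<lambda>(\<zeta>, \<eta>). - (4 / (1 - (cmod z)\<^sup>2)) * (hlog z (g w) \<bullet> \<zeta>) - (4 / (1 - (cmod (g w))\<^sup>2)) * (hlog (g w) z \<bullet> \<eta>))
       (fst v, d * snd v))) (at (z, w))"
    by (rule has_derivative_compose)
  then have 1: "((\<lambda>p. (hdist (fst p) (g (snd p)))\<^sup>2) has_derivative
    (\<lambda>v. - (4 / (1 - (cmod z)\<^sup>2)) * (hlog z (g w) \<bullet> fst v) - (4 / (1 - (cmod (g w))\<^sup>2)) * (hlog (g w) z \<bullet> (d * snd v))))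
    (at (z, w))" by simp
  have pr: "((\<lambda>w. (a, w)) has_derivative (\<lambda>\<eta>. (0, \<eta>))) (at w)" for a :: complex
    by (auto intro!: derivative_eq_intros)
  have 2: "((\<lambda>w'. (hdist z (g w'))\<^sup>2) has_derivative (\<lambda>\<eta>. - (4 / (1 - (cmod (g w))\<^sup>2)) * (hlog (g w) z \<bullet> (d * \<eta>)))) (at w)"
    using has_derivative_compose[OF pr[of z] 1] by simp
  have 3: "((\<lambda>w'. (hdist (g' z) w')\<^sup>2) has_derivative (\<lambda>\<eta>. - (4 / (1 - (cmod w)\<^sup>2)) * (hlog w (g' z) \<bullet> \<eta>))) (at w)"
    using has_derivative_compose[OF pr[of "g' z"] hdist_sq_has_derivative[OF g'z w]] by simp
  have eq: "(hdist (g' z) w')\<^sup>2 = (hdist z (g w'))\<^sup>2" if w': "w' \<in> disk" for w'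
  proof -
    have "hdist (g (g' z)) (g w') = hdist (g' z) w'" using g g'z w' unfolding disk_isometry_def by blast
    then show ?thesis using inv[OF z] by simp
  qed
  have "((\<lambda>w'. (hdist z (g w'))\<^sup>2) has_derivative (\<lambda>\<eta>. - (4 / (1 - (cmod w)\<^sup>2)) * (hlog w (g' z) \<bullet> \<eta>))) (at w)"
    by (rule has_derivative_transform_within_open[OF 3, of disk]) (use w eq in auto)
  from has_derivative_unique[OF 2 this]
  have "- (4 / (1 - (cmod (g w))\<^sup>2)) * (hlog (g w) z \<bullet> (d * \<eta>)) = - (4 / (1 - (cmod w)\<^sup>2)) * (hlog w (g' z) \<bullet> \<eta>)" for \<eta>
    by (rule fun_cong)
  then have "- (4 / (1 - (cmod z)\<^sup>2)) * (hlog z (g w) \<bullet> \<zeta>) - (4 / (1 - (cmod (g w))\<^sup>2)) * (hlog (g w) z \<bullet> (d * \<eta>))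
      = - (4 / (1 - (cmod z)\<^sup>2)) * (hlog z (g w) \<bullet> \<zeta>) - (4 / (1 - (cmod w)\<^sup>2)) * (hlog w (g' z) \<bullet> \<eta>)" for \<zeta> \<eta>
    by (metis (no_types) add_uminus_conv_diff mult_minus_left)
  then show ?thesis using 1 by (simp only: case_prod_beta')
qed

lemma hlog_inner_isometry:
  assumes g: "disk_isometry g" and g': "disk_isometry g'" and inv: "\<And>w. w \<in> disk \<Longrightarrow> g (g' w) = w"
    and a: "a \<in> disk" and x: "x \<in> disk" and y: "y \<in> disk"
  shows "hlog (g a) (g x) \<bullet> hlog (g a) y = hlog a x \<bullet> hlog a (g' y)"
proof -
  obtain \<omega> where \<omega>: "norm \<omega> = 1" "\<And>z. z \<in> disk \<Longrightarrow> hlog (g a) (g z) = \<omega> * hlog a z"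
    using hlog_isometry[OF g a] by metis
  have "g' y \<in> disk" using g' y unfolding disk_isometry_def by blast
  then show ?thesis using \<omega>(2)[OF x] \<omega>(2)[of "g' y"] inv[OF y] mult_unit_inner[OF \<omega>(1)] by simp
qed

lemma norm_axis: "norm (axis i x :: 'a::real_inner ^ 'n) = norm x"
  by (simp add: norm_eq_sqrt_inner inner_axis_axis)

lemma bounded_linear_axis: "bounded_linear (axis i :: 'a::real_inner \<Rightarrow> 'a ^ 'n)"
proof (rule bounded_linear_intro[where K = 1])
  show "norm (axis i x :: 'a ^ 'n) \<le> norm x * 1" for x :: 'a
    by (simp add: norm_axis)
qed (auto simp: axis_def vec_eq_iff)

lemma bounded_lipschitz_vec:
  fixes f :: "'a::metric_space \<Rightarrow> 'b::real_inner ^ 'n"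
  assumes "\<And>i. bounded_lipschitz S (\<lambda>x. f x $ i)"
  shows "bounded_lipschitz S f"
proof -
  have "bounded_lipschitz S (\<lambda>x. \<Sum>i\<in>UNIV. axis i (f x $ i))"
    by (intro bounded_lipschitz_sum bounded_linear.bounded_lipschitz[OF bounded_linear_axis] assms)
  moreover have "(\<lambda>x. \<Sum>i\<in>UNIV. axis i (f x $ i)) = f"
  proof
    fix x
    have "(\<Sum>i\<in>UNIV. axis i (f x $ i)) $ j = f x $ j" for j
      unfolding sum_component axis_def vec_lambda_beta by (simp only: sum.delta sum.delta' finite UNIV_I if_True)
    then show "(\<Sum>i\<in>UNIV. axis i (f x $ i)) = f x" by (simp add: vec_eq_iff)
  qed
  ultimately show ?thesis by simp
qed

lemma DERIV_nonpos_within_imp_le: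
  fixes r :: "real \<Rightarrow> real"
  assumes "a \<le> b" and d: "\<And>t. t \<in> {a..b} \<Longrightarrow> (r has_real_derivative r' t) (at t within {a..b})"
    and "\<And>t. t \<in> {a..b} \<Longrightarrow> r' t \<le> 0"
  shows "r b \<le> r a"
proof (rule DERIV_nonpos_imp_decreasing_open[OF assms(1)])
  show "\<exists>y. (r has_real_derivative y) (at t) \<and> y \<le> 0" if "a < t" "t < b" for t
    using d[of t] assms(3)[of t] that by (auto simp: at_within_Icc_at)
  show "continuous_on {a..b} r"
    using d by (intro DERIV_continuous_on) auto
qed

section \<open>Comparison of the Riemannian distance with the Euclidean norm\<close>

lemma riem_nonneg: "0 \<le> riem x v v"
  unfolding riem_def by (intro sum_nonneg mult_nonneg_nonneg) auto

lemma riem_length_nonneg: "0 \<le> riem_length p"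
proof -
  let ?f = "\<lambda>t. sqrt (riem (p t) (vector_derivative p (at t)) (vector_derivative p (at t)))"
  show ?thesis
  proof (cases "?f integrable_on {0..1}")
    case True
    then show ?thesis unfolding riem_length_def by (rule integral_nonneg) (simp add: riem_nonneg)
  next
    case False
    then show ?thesis unfolding riem_length_def by (simp add: not_integrable_integral)
  qed
qed

text \<open>The straight segment is a competitor: it stays in the convex polydisk of radius R, where
  the conformal factor is at most 2 / (1 - R^2).\<close>

lemma riem_dist_le_norm:
  fixes x y :: "complex ^ 'v::finite"
  assumes R: "0 \<le> R" "R < 1" and x: "\<And>i. cmod (x $ i) \<le> R" and y: "\<And>i. cmod (y $ i) \<le> R"
  shows "riem_dist x y \<le> 2 / (1 - R\<^sup>2) * norm (x - y)"
proof -
  define p where "p t = x + t *\<^sub>R (y - x)" for t :: real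
  have R2: "R\<^sup>2 < 1" using R by (simp add: power_less_one_iff abs_square_less_1)
  have pR: "cmod (p t $ i) \<le> R" if "t \<in> {0..1}" for t i
  proof -
    have "p t $ i = (1 - t) *\<^sub>R x $ i + t *\<^sub>R y $ i" by (simp add: p_def algebra_simps)
    then have "cmod (p t $ i) \<le> (1 - t) * cmod (x $ i) + t * cmod (y $ i)"
      using that norm_triangle_ineq[of "(1 - t) *\<^sub>R x $ i" "t *\<^sub>R y $ i"] by simp
    also have "\<dots> \<le> (1 - t) * R + t * R" using that x y by (intro add_mono mult_left_mono) auto
    finally show ?thesis by (simp add: algebra_simps)
  qed
  have d: "(p has_vector_derivative (y - x)) (at t)" for t
    unfolding p_def[abs_def] by (auto intro!: derivative_eq_intros)
  define C where "C = 2 / (1 - R\<^sup>2) * norm (x - y)"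
  have C0: "0 \<le> C" using R2 by (simp add: C_def)
  have le: "sqrt (riem (p t) (y - x) (y - x)) \<le> C" if t: "t \<in> {0..1}" for t
  proof -
    have "riem (p t) (y - x) (y - x) \<le> (\<Sum>i\<in>UNIV. 4 / (1 - R\<^sup>2)\<^sup>2 * ((y - x) $ i \<bullet> (y - x) $ i))"
      unfolding riem_def
    proof (intro sum_mono mult_right_mono)
      fix i
      have "(cmod (p t $ i))\<^sup>2 \<le> R\<^sup>2" using pR[OF t] by (intro power_mono) auto
      then show "4 / (1 - (cmod (p t $ i))\<^sup>2)\<^sup>2 \<le> 4 / (1 - R\<^sup>2)\<^sup>2"
        using R2 by (intro divide_left_mono power_mono mult_pos_pos) auto
    qed auto
    also have "\<dots> = 4 / (1 - R\<^sup>2)\<^sup>2 * (norm (x - y))\<^sup>2"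
      unfolding norm_minus_commute[of x y] power2_norm_eq_inner inner_vec_def sum_distrib_left ..
    also have "\<dots> = C\<^sup>2" by (simp add: C_def power_mult_distrib power_divide)
    finally show ?thesis using C0 by (simp add: real_le_lsqrt riem_nonneg)
  qed
  have v: "vector_derivative p (at t) = y - x" for t using d by (rule vector_derivative_at)
  have "riem_length p \<le> C"
  proof (cases "(\<lambda>t. sqrt (riem (p t) (y - x) (y - x))) integrable_on {0..1}")
    case True
    then have "integral {0..1} (\<lambda>t. sqrt (riem (p t) (y - x) (y - x))) \<le> integral {0..1::real} (\<lambda>t. C)"
      by (rule Henstock_Kurzweil_Integration.integral_le) (auto intro: le)
    then show ?thesis by (simp add: riem_length_def v)
  next
    \<comment> \<open>The integral of a non-integrable speed is 0 by convention, which is below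
      \<open>C\<close> too.\<close>
    case False
    then show ?thesis by (simp add: riem_length_def v not_integrable_integral C0)
  qed
  moreover have "riem_dist x y \<le> riem_length p"
    unfolding riem_dist_def
  proof (rule cInf_lower)
    have "p C1_differentiable_on {0..1}"
      unfolding C1_differentiable_on_def using d by (intro exI[of _ "\<lambda>_. y - x"]) auto
    moreover have "p ` {0..1} \<subseteq> realizations"
      using le_less_trans[OF pR R(2)] by (auto simp: realizations_def)
    ultimately show "riem_length p \<in> {riem_length p | p. p C1_differentiable_on {0..1} \<and>
        p ` {0..1} \<subseteq> realizations \<and> p 0 = x \<and> p 1 = y}"
      by (intro CollectI exI[of _ p]) (simp add: p_def)
    show "bdd_below {riem_length p | p. p C1_differentiable_on {0..1} \<and>
        p ` {0..1} \<subseteq> realizations \<and> p 0 = x \<and> p 1 = y}"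
      by (rule bdd_belowI[of _ 0]) (auto simp: riem_length_nonneg)
  qed
  ultimately show ?thesis by (simp add: C_def)
qed

lemma open_realizations: "open (realizations :: (complex ^ 'v::finite) set)"
proof -
  have "realizations = (\<Inter>i\<in>UNIV. (\<lambda>x :: complex ^ 'v. x $ i) -` disk)"
    by (auto simp: realizations_def)
  moreover have "open \<dots>"
    by (intro open_INT ballI open_vimage) (auto intro!: continuous_intros)
  ultimately show ?thesis by simp
qed

lemma edge_form_nonneg: "0 \<le> edge_form U U' v w"
proof -
  have "(v \<bullet> U)\<^sup>2 \<le> (norm v)\<^sup>2 * (norm U)\<^sup>2"
    using Cauchy_Schwarz_ineq[of v U] by (simp add: power2_norm_eq_inner)
  then show ?thesis unfolding edge_form_def by (auto intro!: add_nonneg_nonneg)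
qed

lemma edge_form_scale:
  assumes "0 \<le> s"
  shows "edge_form U U' (s *\<^sub>R v) (s *\<^sub>R w) = s\<^sup>2 * edge_form U U' v w"
proof -
  have "max 0 (- (s * a + s * b)) = s * max 0 (- (a + b))" for a b :: real
    using assms by (simp add: max_mult_distrib_left distrib_left right_diff_distrib)
  moreover have "norm (s *\<^sub>R v - s *\<^sub>R w) = s * norm (v - w)"
    using assms by (simp flip: scaleR_diff_right)
  moreover have "s * a - s * b = s * (a - b)" for a b by (simp add: algebra_simps)
  ultimately show ?thesis
    unfolding edge_form_def using assms
    by (simp only: norm_scaleR abs_of_nonneg inner_scaleR_left power_mult_distrib)
       (simp add: distrib_left right_diff_distrib mult_ac)
qed

text \<open>The topology of the surface enters the analysis only through \<open>sublevel\<close>,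
  which confines realizations of bounded energy to a polydisk of radius below 1. The factor 1/4 is
  the 1/2 of the energy times 1/2 for the two orientations of an edge.\<close>

locale isometry_graph =
  fixes EE :: "('v::finite \<times> 'v) set" and c :: "'v \<Rightarrow> 'v \<Rightarrow> real"
    and \<gamma> \<gamma>' :: "'v \<Rightarrow> 'v \<Rightarrow> complex \<Rightarrow> complex" and D :: "complex ^ 'v \<Rightarrow> real"
  assumes c_pos: "(i, j) \<in> EE \<Longrightarrow> c i j > 0"
    and iso: "(i, j) \<in> EE \<Longrightarrow> disk_isometry (\<gamma> i j)"
    and iso': "(i, j) \<in> EE \<Longrightarrow> disk_isometry (\<gamma>' i j)"
    and inverse: "(i, j) \<in> EE \<Longrightarrow> z \<in> disk \<Longrightarrow> \<gamma> i j (\<gamma>' i j z) = z"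
    and D_eq: "D x = 1/4 * (\<Sum>(i, j)\<in>EE. c i j * (hdist (x $ i) (\<gamma> i j (x $ j)))\<^sup>2)"
    and sublevel: "\<And>L. \<exists>R<1. \<forall>x\<in>realizations. D x \<le> L \<longrightarrow> (\<forall>i. cmod (x $ i) \<le> R)"
begin

lemma iso_disk: "(i, j) \<in> EE \<Longrightarrow> z \<in> disk \<Longrightarrow> \<gamma> i j z \<in> disk"
    "(i, j) \<in> EE \<Longrightarrow> z \<in> disk \<Longrightarrow> \<gamma>' i j z \<in> disk"
  using iso iso' unfolding disk_isometry_def by blast+

text \<open>The negative gradient of \<open>D\<close> in the orthonormal frames of
  \<open>hlog\<close>. The factor 1/2 is the 1/4 of \<open>D\<close> times the 2 from
  differentiating a square; each pair in \<open>EE\<close> acts on both of its ends.\<close>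

definition force :: "complex ^ 'v \<Rightarrow> complex ^ 'v"
  where "force x = (\<chi> i. (1/2) *\<^sub>R (\<Sum>(k, l)\<in>EE. c k l *\<^sub>R
    ((if k = i then hlog (x $ k) (\<gamma> k l (x $ l)) else 0) + (if l = i then hlog (x $ l) (\<gamma>' k l (x $ k)) else 0))))"

text \<open>The same vector in disk coordinates, in which the flow is formulated: the factor undoes
  the orthonormal frame.\<close>

definition field :: "complex ^ 'v \<Rightarrow> complex ^ 'v"
  where "field x = (\<chi> i. ((1 - (cmod (x $ i))\<^sup>2) / 2) *\<^sub>R force x $ i)"

text \<open>\<open>pull x y\<close> is minus the derivative of \<open>D\<close> at x in the
  direction of the geodesic to y. Hence \<open>pull x y + pull y x\<close> is the growth of the
  derivative of \<open>D\<close> along the geodesic between the two, and convexity says that it is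
  nonnegative.\<close>

abbreviation pull :: "complex ^ 'v \<Rightarrow> complex ^ 'v \<Rightarrow> real"
  where "pull x y \<equiv> (\<Sum>i\<in>UNIV. hlog (x $ i) (y $ i) \<bullet> force x $ i)"

lemma sum_inner_force:
  "(\<Sum>i\<in>UNIV. A i \<bullet> force x $ i) = 1/2 * (\<Sum>(k, l)\<in>EE. c k l *
    (A k \<bullet> hlog (x $ k) (\<gamma> k l (x $ l)) + A l \<bullet> hlog (x $ l) (\<gamma>' k l (x $ k))))"
proof -
  have "A i \<bullet> force x $ i = 1/2 * (\<Sum>(k, l)\<in>EE. c k l *
    ((if k = i then A i \<bullet> hlog (x $ k) (\<gamma> k l (x $ l)) else 0) + (if l = i then A i \<bullet> hlog (x $ l) (\<gamma>' k l (x $ k)) else 0)))" for i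
    unfolding force_def
    by (auto simp: inner_sum_right case_prod_beta inner_add_right intro!: sum.cong arg_cong[of _ _ "\<lambda>x. x / 2"])
  then have "(\<Sum>i\<in>UNIV. A i \<bullet> force x $ i) = 1/2 * (\<Sum>i\<in>UNIV. \<Sum>(k, l)\<in>EE. c k l *
    ((if k = i then A i \<bullet> hlog (x $ k) (\<gamma> k l (x $ l)) else 0) + (if l = i then A i \<bullet> hlog (x $ l) (\<gamma>' k l (x $ k)) else 0)))"
    by (simp add: sum_distrib_left)
  also have "(\<Sum>i\<in>UNIV. \<Sum>(k, l)\<in>EE. c k l *
    ((if k = i then A i \<bullet> hlog (x $ k) (\<gamma> k l (x $ l)) else 0) + (if l = i then A i \<bullet> hlog (x $ l) (\<gamma>' k l (x $ k)) else 0)))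
    = (\<Sum>(k, l)\<in>EE. \<Sum>i\<in>UNIV. c k l *
    ((if k = i then A i \<bullet> hlog (x $ k) (\<gamma> k l (x $ l)) else 0) + (if l = i then A i \<bullet> hlog (x $ l) (\<gamma>' k l (x $ k)) else 0)))"
    unfolding case_prod_beta by (rule sum.swap)
  also have "\<dots> = (\<Sum>(k, l)\<in>EE. c k l *
    (A k \<bullet> hlog (x $ k) (\<gamma> k l (x $ l)) + A l \<bullet> hlog (x $ l) (\<gamma>' k l (x $ k))))"
    by (simp add: sum_distrib_left[symmetric] sum.distrib)
  finally show ?thesis .
qed

lemma D_has_derivative:
  assumes x: "x \<in> realizations"
  shows "(D has_derivative (\<lambda>w. - (\<Sum>i\<in>UNIV. (2 / (1 - (cmod (x $ i))\<^sup>2)) * (force x $ i \<bullet> w $ i)))) (at x)"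
proof -
  have xd: "x $ i \<in> disk" for i using x by (simp add: realizations_def)
  have e: "((\<lambda>x. (hdist (x $ k) (\<gamma> k l (x $ l)))\<^sup>2) has_derivative
      (\<lambda>w. - (4 / (1 - (cmod (x $ k))\<^sup>2)) * (hlog (x $ k) (\<gamma> k l (x $ l)) \<bullet> w $ k)
        - (4 / (1 - (cmod (x $ l))\<^sup>2)) * (hlog (x $ l) (\<gamma>' k l (x $ k)) \<bullet> w $ l))) (at x)"
    if kl: "(k, l) \<in> EE" for k l
  proof -
    have "((\<lambda>x :: complex ^ 'v. (x $ k, x $ l)) has_derivative (\<lambda>w. (w $ k, w $ l))) (at x)"
      by (intro bounded_linear_imp_has_derivative bounded_linear_Pair bounded_linear_vec_nth)
    from has_derivative_compose[OF this hdist_sq_isometry_has_derivative[OF iso[OF kl] iso'[OF kl] inverse[OF kl] xd xd]]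
    show ?thesis by simp
  qed
  have "(D has_derivative (\<lambda>w. 1/4 * (\<Sum>(k, l)\<in>EE. c k l * (- (4 / (1 - (cmod (x $ k))\<^sup>2)) * (hlog (x $ k) (\<gamma> k l (x $ l)) \<bullet> w $ k)
        - (4 / (1 - (cmod (x $ l))\<^sup>2)) * (hlog (x $ l) (\<gamma>' k l (x $ k)) \<bullet> w $ l))))) (at x)"
    unfolding D_eq[abs_def] case_prod_beta
    by (intro has_derivative_mult_right has_derivative_sum e) auto
  moreover have "1/4 * (\<Sum>(k, l)\<in>EE. c k l * (- (4 / (1 - (cmod (x $ k))\<^sup>2)) * (hlog (x $ k) (\<gamma> k l (x $ l)) \<bullet> w $ k)
        - (4 / (1 - (cmod (x $ l))\<^sup>2)) * (hlog (x $ l) (\<gamma>' k l (x $ k)) \<bullet> w $ l)))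
      = - (\<Sum>i\<in>UNIV. (2 / (1 - (cmod (x $ i))\<^sup>2)) * (force x $ i \<bullet> w $ i))" for w
  proof -
    have "(\<Sum>i\<in>UNIV. (2 / (1 - (cmod (x $ i))\<^sup>2)) * (force x $ i \<bullet> w $ i))
        = (\<Sum>i\<in>UNIV. ((2 / (1 - (cmod (x $ i))\<^sup>2)) *\<^sub>R w $ i) \<bullet> force x $ i)"
      by (simp add: inner_commute)
    also have "\<dots> = 1/2 * (\<Sum>(k, l)\<in>EE. c k l *
      ((2 / (1 - (cmod (x $ k))\<^sup>2)) *\<^sub>R w $ k \<bullet> hlog (x $ k) (\<gamma> k l (x $ l))
       + (2 / (1 - (cmod (x $ l))\<^sup>2)) *\<^sub>R w $ l \<bullet> hlog (x $ l) (\<gamma>' k l (x $ k))))"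
      by (rule sum_inner_force)
    finally show ?thesis
      by (auto simp: sum_distrib_left sum_negf[symmetric] inner_commute algebra_simps case_prod_beta intro!: sum.cong)
  qed
  ultimately show ?thesis by simp
qed

lemma riem_gradient_eq:
  assumes x: "x \<in> realizations"
  shows "riem_gradient D x = - field x"
  unfolding riem_gradient_def
proof (rule the_equality)
  have xd: "(cmod (x $ i))\<^sup>2 < 1" for i using x disk_sq by (simp add: realizations_def)
  have eq: "riem x (- field x) w = - (\<Sum>i\<in>UNIV. (2 / (1 - (cmod (x $ i))\<^sup>2)) * (force x $ i \<bullet> w $ i))" for w
    unfolding riem_def sum_negf[symmetric]
  proof (rule sum.cong)
    fix i
    have "4 / X\<^sup>2 * - (X / 2 * b) = - (2 / X * b)" if "X > 0" for X b :: real
      using that by (simp add: field_simps power2_eq_square)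
    from this[of "1 - (cmod (x $ i))\<^sup>2" "force x $ i \<bullet> w $ i"] xd[of i]
    have "4 / (1 - (cmod (x $ i))\<^sup>2)\<^sup>2 * - ((1 - (cmod (x $ i))\<^sup>2) / 2 * (force x $ i \<bullet> w $ i))
        = - (2 / (1 - (cmod (x $ i))\<^sup>2) * (force x $ i \<bullet> w $ i))" by (simp only: diff_gt_0_iff_gt)
    moreover have "(- field x) $ i \<bullet> w $ i = - ((1 - (cmod (x $ i))\<^sup>2) / 2 * (force x $ i \<bullet> w $ i))"
      by (simp add: field_def)
    ultimately show "4 / (1 - (cmod (x $ i))\<^sup>2)\<^sup>2 * ((- field x) $ i \<bullet> w $ i) = - (2 / (1 - (cmod (x $ i))\<^sup>2) * (force x $ i \<bullet> w $ i))"
      by (simp only:)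
  qed simp
  show 1: "(D has_derivative riem x (- field x)) (at x)"
    using D_has_derivative[OF x] unfolding eq[symmetric] .
  fix G assume "(D has_derivative riem x G) (at x)"
  from has_derivative_unique[OF this 1] have "riem x G (G - - field x) = riem x (- field x) (G - - field x)"
    by (rule fun_cong)
  moreover have "riem x (G - - field x) w = riem x G w - riem x (- field x) w" for w
    unfolding riem_def sum_subtractf[symmetric] by (simp add: inner_diff_left inner_add_left algebra_simps)
  ultimately have "riem x (G - - field x) (G - - field x) = 0" by simp
  then have "\<forall>i. 4 / (1 - (cmod (x $ i))\<^sup>2)\<^sup>2 * ((G - - field x) $ i \<bullet> (G - - field x) $ i) = 0"
    unfolding riem_def by (subst (asm) sum_nonneg_eq_0_iff) auto
  then have "(G - - field x) $ i = 0" for i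
    using xd[of i] by (simp add: less_le) (metis)
  then show "G = - field x" by (simp add: vec_eq_iff eq_neg_iff_add_eq_0)
qed

lemma negative_gradient_flow_iff:
  "negative_gradient_flow D I x\<^sub>0 x \<longleftrightarrow>
    x 0 = x\<^sub>0 \<and> (\<forall>t\<in>I. x t \<in> realizations \<and> (x has_vector_derivative field (x t)) (at t within I))"
  unfolding negative_gradient_flow_def using riem_gradient_eq by (metis minus_minus)

text \<open>The isometry \<open>\<gamma> k l\<close> carries the logarithms at vertex l to the far
  end of the lifted edge, without changing inner products. Then the four inner products of an edge
  belong to the corners of a single quadrilateral.\<close>

lemma inner_force_pair:
  assumes x: "x \<in> realizations" and y: "y \<in> realizations"
  shows "pull x y + pull y x
    = 1/2 * (\<Sum>(k, l)\<in>EE. c k l * corner_sum (y $ k) (\<gamma> k l (y $ l)) (x $ k) (\<gamma> k l (x $ l)))"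
proof -
  have d: "x $ i \<in> disk" "y $ i \<in> disk" for i using x y by (simp_all add: realizations_def)
  have "c k l * (hlog (x $ k) (y $ k) \<bullet> hlog (x $ k) (\<gamma> k l (x $ l)) + hlog (x $ l) (y $ l) \<bullet> hlog (x $ l) (\<gamma>' k l (x $ k)))
     + c k l * (hlog (y $ k) (x $ k) \<bullet> hlog (y $ k) (\<gamma> k l (y $ l)) + hlog (y $ l) (x $ l) \<bullet> hlog (y $ l) (\<gamma>' k l (y $ k)))
     = c k l * corner_sum (y $ k) (\<gamma> k l (y $ l)) (x $ k) (\<gamma> k l (x $ l))" if kl: "(k, l) \<in> EE" for k l
  proof -
    note i = hlog_inner_isometry[OF iso[OF kl] iso'[OF kl] inverse[OF kl]]
    have "hlog (\<gamma> k l (x $ l)) (\<gamma> k l (y $ l)) \<bullet> hlog (\<gamma> k l (x $ l)) (x $ k)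
        = hlog (x $ l) (y $ l) \<bullet> hlog (x $ l) (\<gamma>' k l (x $ k))"
      by (rule i) (rule d | assumption)+
    moreover have "hlog (\<gamma> k l (y $ l)) (\<gamma> k l (x $ l)) \<bullet> hlog (\<gamma> k l (y $ l)) (y $ k)
        = hlog (y $ l) (x $ l) \<bullet> hlog (y $ l) (\<gamma>' k l (y $ k))"
      by (rule i) (rule d | assumption)+
    ultimately show ?thesis unfolding corner_sum_def distrib_left[symmetric] by simp
  qed
  then show ?thesis
    unfolding sum_inner_force distrib_left[symmetric] sum.distrib[symmetric] case_prod_beta
    by (intro arg_cong[of _ _ "\<lambda>x. 1/2 * x"] sum.cong) auto
qed

definition sqdist :: "complex ^ 'v \<Rightarrow> complex ^ 'v \<Rightarrow> real"
  where "sqdist x y = (\<Sum>i\<in>UNIV. (hdist (x $ i) (y $ i))\<^sup>2)"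

text \<open>First variation at both ends; the conformal factors of the derivative and of
  \<open>field\<close> cancel to 2. Convexity makes the result nonpositive, which is the contraction
  property of the flow.\<close>

lemma sqdist_deriv:
  assumes x: "x t \<in> realizations" "(x has_vector_derivative field (x t)) (at t within I)"
    and y: "y t \<in> realizations" "(y has_vector_derivative field (y t)) (at t within I)"
  shows "((\<lambda>t. sqdist (x t) (y t)) has_real_derivative
    - 2 * (pull (x t) (y t) + pull (y t) (x t))) (at t within I)"
proof -
  have d: "x t $ i \<in> disk" "y t $ i \<in> disk" for i using x y by (simp_all add: realizations_def)
  have s: "(cmod (x t $ i))\<^sup>2 < 1" "(cmod (y t $ i))\<^sup>2 < 1" for i using d disk_sq by auto
  have e: "((\<lambda>t. (hdist (x t $ i) (y t $ i))\<^sup>2) has_real_derivative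
      - (2 * (hlog (x t $ i) (y t $ i) \<bullet> force (x t) $ i)) - 2 * (hlog (y t $ i) (x t $ i) \<bullet> force (y t) $ i)) (at t within I)" for i
  proof -
    have "((\<lambda>t. (x t $ i, y t $ i)) has_derivative (\<lambda>h. (h *\<^sub>R field (x t) $ i, h *\<^sub>R field (y t) $ i))) (at t within I)"
      using bounded_linear.has_derivative[OF bounded_linear_vec_nth x(2)[unfolded has_vector_derivative_def], of i]
        bounded_linear.has_derivative[OF bounded_linear_vec_nth y(2)[unfolded has_vector_derivative_def], of i]
      by (auto intro!: has_derivative_Pair)
    from has_derivative_compose[OF this hdist_sq_has_derivative[OF d(1) d(2)]]
    have "((\<lambda>t. (hdist (x t $ i) (y t $ i))\<^sup>2) has_derivative
      (\<lambda>h. - (4 / (1 - (cmod (x t $ i))\<^sup>2)) * (hlog (x t $ i) (y t $ i) \<bullet> (h *\<^sub>R field (x t) $ i))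
        - (4 / (1 - (cmod (y t $ i))\<^sup>2)) * (hlog (y t $ i) (x t $ i) \<bullet> (h *\<^sub>R field (y t) $ i)))) (at t within I)"
      by simp
    moreover have "- (4 / (1 - (cmod (x t $ i))\<^sup>2)) * (hlog (x t $ i) (y t $ i) \<bullet> (h *\<^sub>R field (x t) $ i))
        - (4 / (1 - (cmod (y t $ i))\<^sup>2)) * (hlog (y t $ i) (x t $ i) \<bullet> (h *\<^sub>R field (y t) $ i))
      = (- (2 * (hlog (x t $ i) (y t $ i) \<bullet> force (x t) $ i)) - 2 * (hlog (y t $ i) (x t $ i) \<bullet> force (y t) $ i)) * h" for h
    proof -
      have "- (4 / X) * (h * (X / 2 * a)) - 4 / Y * (h * (Y / 2 * b)) = (- (2 * a) - 2 * b) * h"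
        if "X > 0" "Y > 0" for X Y a b :: real
        using that by (simp add: field_simps)
      from this[of "1 - (cmod (x t $ i))\<^sup>2" "1 - (cmod (y t $ i))\<^sup>2"] s[of i] show ?thesis
        by (simp only: field_def vec_lambda_beta inner_scaleR_right diff_gt_0_iff_gt)
    qed
    ultimately show ?thesis unfolding has_field_derivative_def by simp
  qed
  have "((\<lambda>t. sqdist (x t) (y t)) has_real_derivative
      (\<Sum>i\<in>UNIV. - (2 * (hlog (x t $ i) (y t $ i) \<bullet> force (x t) $ i)) - 2 * (hlog (y t $ i) (x t $ i) \<bullet> force (y t) $ i))) (at t within I)"
    unfolding sqdist_def by (intro DERIV_sum e)
  moreover have "(\<Sum>i\<in>UNIV. - (2 * a i) - 2 * b i) = - 2 * ((\<Sum>i\<in>UNIV. a i) + (\<Sum>i\<in>UNIV. b i))"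
    for a b :: "'v \<Rightarrow> real"
    unfolding sum.distrib[symmetric] sum_distrib_left by (intro sum.cong) auto
  ultimately show ?thesis by simp
qed

lemma sqdist_self: "x \<in> realizations \<Longrightarrow> sqdist x x = 0"
  by (simp add: sqdist_def realizations_def)

lemma sqdist_nonneg: "0 \<le> sqdist x y"
  by (simp add: sqdist_def sum_nonneg)

lemma sqdist_eq_0_iff:
  assumes "x \<in> realizations" "y \<in> realizations"
  shows "sqdist x y = 0 \<longleftrightarrow> x = y"
proof -
  have "sqdist x y = 0 \<longleftrightarrow> (\<forall>i. hdist (x $ i) (y $ i) = 0)"
    unfolding sqdist_def by (subst sum_nonneg_eq_0_iff) auto
  then show ?thesis using assms hdist_eq_0_iff by (auto simp: realizations_def vec_eq_iff)
qed

lemma inner_force_pair_nonneg: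
  assumes x: "x \<in> realizations" and y: "y \<in> realizations"
  shows "pull x y + pull y x \<ge> 0"
proof -
  have d: "x $ i \<in> disk" "y $ i \<in> disk" for i using x y by (simp_all add: realizations_def)
  have "0 \<le> (\<Sum>(k, l)\<in>EE. c k l * corner_sum (y $ k) (\<gamma> k l (y $ l)) (x $ k) (\<gamma> k l (x $ l)))"
    using c_pos corner_sum_nonneg d iso_disk
    by (intro sum_nonneg) (auto intro!: mult_nonneg_nonneg simp del: mem_ball_0 intro: less_imp_le)
  then show ?thesis unfolding inner_force_pair[OF x y] by simp
qed

lemma flow_unique:
  assumes x: "negative_gradient_flow D {0..} f x" and y: "negative_gradient_flow D {0..<b} f y" and t: "t \<in> {0..<b}"
  shows "y t = x t"
proof -
  have xs: "x s \<in> realizations" "(x has_vector_derivative field (x s)) (at s within {0..t})"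
      "y s \<in> realizations" "(y has_vector_derivative field (y s)) (at s within {0..t})" if "s \<in> {0..t}" for s
    using x y t that unfolding negative_gradient_flow_iff
    by (auto intro: has_vector_derivative_within_subset[of _ _ s "{0..}"]
        has_vector_derivative_within_subset[of _ _ s "{0..<b}"])
  have "sqdist (x t) (y t) \<le> sqdist (x 0) (y 0)"
  proof (rule DERIV_nonpos_within_imp_le[where r = "\<lambda>t. sqdist (x t) (y t)" and
        r' = "\<lambda>s. - 2 * (pull (x s) (y s) + pull (y s) (x s))"])
    fix s assume s: "s \<in> {0..t}"
    show "((\<lambda>t. sqdist (x t) (y t)) has_real_derivative
      - 2 * (pull (x s) (y s) + pull (y s) (x s))) (at s within {0..t})"
      using xs[OF s] by (intro sqdist_deriv)
    show "- 2 * (pull (x s) (y s) + pull (y s) (x s)) \<le> 0"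
      using inner_force_pair_nonneg[OF xs(1,3)[OF s]] by simp
  qed (use t in auto)
  also have "\<dots> = 0" using x y xs(1)[of 0] t by (simp add: negative_gradient_flow_iff sqdist_self)
  finally show ?thesis
    using sqdist_eq_0_iff[OF xs(1,3)[of t]] sqdist_nonneg[of "x t" "y t"] t by simp
qed

subsection \<open>Minimizers\<close>

lemma continuous_on_D: "continuous_on realizations D"
  using D_has_derivative has_derivative_continuous by (blast intro: continuous_at_imp_continuous_on)

lemma D_differentiable: "x \<in> realizations \<Longrightarrow> D differentiable (at x)"
  using D_has_derivative by (auto simp: differentiable_def)

lemma closed_polydisk: "closed {x :: complex ^ 'v. \<forall>i. cmod (x $ i) \<le> R}"
  unfolding Collect_all_eq by (intro closed_INT ballI closed_Collect_le continuous_intros)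

lemma compact_polydisk: "compact {x :: complex ^ 'v. \<forall>i. cmod (x $ i) \<le> R}"
proof -
  have "norm x \<le> (\<Sum>i\<in>(UNIV :: 'v set). R)" if "\<forall>i. cmod (x $ i) \<le> R" for x :: "complex ^ 'v"
  proof -
    have "norm x \<le> (\<Sum>i\<in>UNIV. norm (x $ i))" unfolding norm_vec_def by (rule L2_set_le_sum) auto
    also have "\<dots> \<le> (\<Sum>i\<in>(UNIV :: 'v set). R)" using that by (intro sum_mono) auto
    finally show ?thesis .
  qed
  then have "bounded {x :: complex ^ 'v. \<forall>i. cmod (x $ i) \<le> R}" by (intro boundedI) blast
  then show ?thesis using closed_polydisk compact_eq_bounded_closed by blast
qed

lemma polydisk_realizations: "R < 1 \<Longrightarrow> {x. \<forall>i. cmod (x $ i) \<le> R} \<subseteq> realizations"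
  unfolding realizations_def by (auto intro: le_less_trans)

lemma D_proper:
  assumes K: "compact K"
  shows "compact {x \<in> realizations. D x \<in> K}"
proof -
  obtain L where L: "\<And>d. d \<in> K \<Longrightarrow> d \<le> L"
    using compact_imp_bounded[OF K] unfolding bounded_iff by (metis abs_le_D1 real_norm_def)
  obtain R where R: "R < 1" "\<And>x i. x \<in> realizations \<Longrightarrow> D x \<le> L \<Longrightarrow> cmod (x $ i) \<le> R"
    using sublevel[of L] by blast
  have eq: "{x \<in> realizations. D x \<in> K} = {x. \<forall>i. cmod (x $ i) \<le> R} \<inter> D -` K"
    using R(2) L polydisk_realizations[OF R(1)] by auto
  have "continuous_on {x. \<forall>i. cmod (x $ i) \<le> R} D"
    by (rule continuous_on_subset[OF continuous_on_D polydisk_realizations[OF R(1)]])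
  then have "closed ({x. \<forall>i. cmod (x $ i) \<le> R} \<inter> D -` K)"
    using closed_polydisk compact_imp_closed[OF K] by (rule continuous_closed_preimage)
  then have "compact ({x. \<forall>i. cmod (x $ i) \<le> R} \<inter> ({x. \<forall>i. cmod (x $ i) \<le> R} \<inter> D -` K))"
    by (rule compact_Int_closed[OF compact_polydisk])
  then show ?thesis unfolding eq by (simp only: Int_left_absorb)
qed

lemma minimizer_exists: "\<exists>f\<in>realizations. \<forall>x\<in>realizations. D f \<le> D x"
proof -
  have 0: "0 \<in> realizations" by (simp add: realizations_def)
  obtain R where R: "R < 1" "\<And>x i. x \<in> realizations \<Longrightarrow> D x \<le> D 0 \<Longrightarrow> cmod (x $ i) \<le> R"
    using sublevel[of "D 0"] by blast
  have "0 \<in> {x :: complex ^ 'v. \<forall>i. cmod (x $ i) \<le> R}" using R(2)[OF 0] by auto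
  then obtain f where f: "f \<in> {x. \<forall>i. cmod (x $ i) \<le> R}" "\<And>x. x \<in> {x. \<forall>i. cmod (x $ i) \<le> R} \<Longrightarrow> D f \<le> D x"
    using continuous_attains_inf[OF compact_polydisk _ continuous_on_subset[OF continuous_on_D polydisk_realizations[OF R(1)]]]
    by blast
  have "D f \<le> D x" if "x \<in> realizations" for x
  proof (cases "D x \<le> D 0")
    case True
    then show ?thesis using f(2)[of x] R(2)[OF that] by auto
  next
    case False
    then show ?thesis using f(2)[of 0] R(2)[OF 0] by auto
  qed
  then show ?thesis using f(1) polydisk_realizations[OF R(1)] by blast
qed

lemma minimizer_force:
  assumes f: "f \<in> realizations" and min: "\<And>x. x \<in> realizations \<Longrightarrow> D f \<le> D x"
  shows "force f = 0"
proof -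
  have "(\<lambda>w. - (\<Sum>i\<in>UNIV. (2 / (1 - (cmod (f $ i))\<^sup>2)) * (force f $ i \<bullet> w $ i))) = (\<lambda>w. 0)"
    using D_has_derivative[OF f] open_realizations f min by (intro differential_zero_maxmin[of f realizations]) auto
  from fun_cong[OF this, of "force f"]
  have "(\<Sum>i\<in>UNIV. (2 / (1 - (cmod (f $ i))\<^sup>2)) * (force f $ i \<bullet> force f $ i)) = 0"
    by (simp only: neg_equal_0_iff_equal)
  moreover have p: "2 / (1 - (cmod (f $ i))\<^sup>2) > 0" for i using f disk_sq[of "f $ i"] by (simp add: realizations_def)
  moreover have "0 \<le> (2 / (1 - (cmod (f $ i))\<^sup>2)) * (force f $ i \<bullet> force f $ i)" for i
    by (rule mult_nonneg_nonneg[OF less_imp_le[OF p] inner_ge_zero])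
  ultimately have "(2 / (1 - (cmod (f $ i))\<^sup>2)) * (force f $ i \<bullet> force f $ i) = 0" for i
    by (subst (asm) sum_nonneg_eq_0_iff) auto
  then have "force f $ i = 0" for i using p[of i] by (metis inner_eq_zero_iff mult_eq_0_iff less_irrefl)
  then show ?thesis by (simp add: vec_eq_iff)
qed

text \<open>If the Hessian of \<open>D\<close> degenerated at a critical point, then \<open>D\<close> would be constant along a geodesic ray.\<close>

lemma coercive:
  assumes f: "f \<in> realizations" and crit: "force f = 0"
  obtains \<mu> where "\<mu> > 0" "\<And>x. x \<in> realizations \<Longrightarrow> (\<And>i. hdist (f $ i) (x $ i) \<le> P) \<Longrightarrow>
    pull x f \<ge> \<mu> * sqdist f x"
proof -
  have fd: "f $ i \<in> disk" for i using f by (simp add: realizations_def)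
  \<comment> \<open>The rotation between the frames at f $ l and at its image under
    \<open>\<gamma> k l\<close>; it transports the velocity of vertex l to the far end of the lifted
    edge.\<close>
  define \<omega> where "\<omega> k l = (SOME w. norm w = 1 \<and>
    (\<forall>z\<in>disk. hlog (\<gamma> k l (f $ l)) (\<gamma> k l z) = w * hlog (f $ l) z))" for k l
  have "norm (\<omega> k l) = 1 \<and> (\<forall>z\<in>disk. hlog (\<gamma> k l (f $ l)) (\<gamma> k l z) = \<omega> k l * hlog (f $ l) z)"
    if kl: "(k, l) \<in> EE" for k l
    unfolding \<omega>_def by (rule someI_ex) (rule hlog_isometry[OF iso[OF kl] fd[of l]], blast)
  then have \<omega>: "\<And>k l. (k, l) \<in> EE \<Longrightarrow> norm (\<omega> k l) = 1"
      "\<And>k l z. (k, l) \<in> EE \<Longrightarrow> z \<in> disk \<Longrightarrow> hlog (\<gamma> k l (f $ l)) (\<gamma> k l z) = \<omega> k l * hlog (f $ l) z" by blast+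
  define U where "U k l = hlog (f $ k) (\<gamma> k l (f $ l))" for k l
  define U' where "U' k l = hlog (\<gamma> k l (f $ l)) (f $ k)" for k l
  \<comment> \<open>The substitute for the Hessian: nonnegative, continuous and homogeneous of
    degree two, so that positivity away from 0 gives a uniform lower bound by compactness of the
    unit sphere.\<close>
  define H where "H v = (\<Sum>(k, l)\<in>EE. c k l * edge_form (U k l) (U' k l) (v $ k) (\<omega> k l * v $ l))" for v :: "complex ^ 'v"
  have cH: "continuous_on S H" for S
  proof -
    have "continuous_on S (\<lambda>v :: complex ^ 'v. edge_form (U k l) (U' k l) (v $ k) (\<omega> k l * v $ l))" for k l
      unfolding edge_form_def by (cases "U k l = 0") (auto intro!: continuous_intros)
    then show ?thesis unfolding H_def case_prod_beta by (intro continuous_intros)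
  qed
  have term_nonneg: "0 \<le> c k l * edge_form (U k l) (U' k l) (v $ k) (\<omega> k l * v $ l)" if "(k, l) \<in> EE" for k l and v :: "complex ^ 'v"
    using c_pos[OF that] edge_form_nonneg by (intro mult_nonneg_nonneg) auto
  have H0: "0 \<le> H v" for v unfolding H_def using term_nonneg by (intro sum_nonneg) auto
  have Hpos: "H v > 0" if v: "v \<noteq> 0" for v
  proof (rule ccontr)
    assume "\<not> H v > 0"
    then have "H v = 0" using H0[of v] by simp
    then have "\<forall>p\<in>EE. (case p of (k, l) \<Rightarrow> c k l * edge_form (U k l) (U' k l) (v $ k) (\<omega> k l * v $ l)) = 0"
      unfolding H_def using term_nonneg by (subst (asm) sum_nonneg_eq_0_iff) auto
    then have E0: "edge_form (U k l) (U' k l) (v $ k) (\<omega> k l * v $ l) = 0" if "(k, l) \<in> EE" for k l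
      using that c_pos by fastforce
    \<comment> \<open>Minus the first variation of half the squared length of the edge. The
      one-sided term of the form makes every \<open>d k l\<close> nonnegative, and criticality makes
      their weighted sum zero, so all of them vanish.\<close>
    define d where "d k l = v $ k \<bullet> U k l + (\<omega> k l * v $ l) \<bullet> U' k l" for k l
    have d0: "d k l \<ge> 0" if kl: "(k, l) \<in> EE" for k l
    proof -
      have "(v $ k \<bullet> U k l)\<^sup>2 \<le> (norm (v $ k))\<^sup>2 * (norm (U k l))\<^sup>2"
        using Cauchy_Schwarz_ineq[of "v $ k" "U k l"] by (simp add: power2_norm_eq_inner)
      then have "(max 0 (- d k l))\<^sup>2 \<le> edge_form (U k l) (U' k l) (v $ k) (\<omega> k l * v $ l)"
        using zero_le_power2[of "norm (v $ k) - norm (\<omega> k l * v $ l)"]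
        unfolding edge_form_def d_def by (cases "U k l = 0") auto
      then have "(max 0 (- d k l))\<^sup>2 \<le> 0" using E0[OF kl] by simp
      then show ?thesis by (auto simp: max_def split: if_splits)
    qed
    have "(\<Sum>i\<in>UNIV. v $ i \<bullet> force f $ i) = 0" by (simp add: crit)
    then have "(\<Sum>(k, l)\<in>EE. c k l * (v $ k \<bullet> hlog (f $ k) (\<gamma> k l (f $ l)) + v $ l \<bullet> hlog (f $ l) (\<gamma>' k l (f $ k)))) = 0"
      unfolding sum_inner_force by simp
    also have "(\<Sum>(k, l)\<in>EE. c k l * (v $ k \<bullet> hlog (f $ k) (\<gamma> k l (f $ l)) + v $ l \<bullet> hlog (f $ l) (\<gamma>' k l (f $ k))))
        = (\<Sum>(k, l)\<in>EE. c k l * d k l)"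
    proof (intro sum.cong refl, clarify)
      fix k l assume kl: "(k, l) \<in> EE"
      have "U' k l = \<omega> k l * hlog (f $ l) (\<gamma>' k l (f $ k))"
        unfolding U'_def using \<omega>(2)[OF kl iso_disk(2)[OF kl fd], of k] inverse[OF kl fd] by simp
      then show "c k l * (v $ k \<bullet> hlog (f $ k) (\<gamma> k l (f $ l)) + v $ l \<bullet> hlog (f $ l) (\<gamma>' k l (f $ k))) = c k l * d k l"
        using mult_unit_inner[OF \<omega>(1)[OF kl]] by (simp add: d_def U_def)
    qed
    finally have "(\<Sum>(k, l)\<in>EE. c k l * d k l) = 0" .
    then have "\<forall>p\<in>EE. (case p of (k, l) \<Rightarrow> c k l * d k l) = 0"
      using d0 c_pos by (subst (asm) sum_nonneg_eq_0_iff) (auto intro!: mult_nonneg_nonneg less_imp_le[OF c_pos])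
    then have d00: "d k l = 0" if "(k, l) \<in> EE" for k l using that c_pos by fastforce
    \<comment> \<open>Every vertex runs along the geodesic with initial velocity v $ i. Each edge is
      then translated along itself, so all lengths and the energy stay constant for all s.\<close>
    define x where "x s = (\<chi> i. hexp (f $ i) (s *\<^sub>R v $ i))" for s
    have xr: "x s \<in> realizations" for s using hexp_disk[OF fd] by (simp add: x_def realizations_def)
    have "hdist (x s $ k) (\<gamma> k l (x s $ l)) = hdist (f $ k) (\<gamma> k l (f $ l))" if kl: "(k, l) \<in> EE" for k l s
    proof -
      have g: "\<gamma> k l (f $ l) \<in> disk" using iso_disk kl fd by blast
      have h: "hexp (f $ l) (s *\<^sub>R v $ l) \<in> disk" by (rule hexp_disk[OF fd])
      have "hlog (\<gamma> k l (f $ l)) (\<gamma> k l (hexp (f $ l) (s *\<^sub>R v $ l))) = s *\<^sub>R (\<omega> k l * v $ l)"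
        using \<omega>(2)[OF kl h] by (simp add: hlog_hexp[OF fd])
      then have "\<gamma> k l (hexp (f $ l) (s *\<^sub>R v $ l)) = hexp (\<gamma> k l (f $ l)) (s *\<^sub>R (\<omega> k l * v $ l))"
        using hexp_hlog[OF g iso_disk(1)[OF kl h]] by simp
      then show ?thesis
        using edge_translation_rigid[OF fd[of k] g, of "v $ k" "\<omega> k l * v $ l" s] E0[OF kl] d00[OF kl]
        by (simp add: x_def U_def U'_def d_def)
    qed
    then have "D (x s) = D f" for s unfolding D_eq by (intro arg_cong[of _ _ "\<lambda>x. 1/4 * x"] sum.cong) auto
    then obtain R where R: "R < 1" "\<And>s i. cmod (x s $ i) \<le> R" using sublevel[of "D f"] xr by (metis order_refl)
    have "hexp (f $ i) 0 = f $ i" for i using hexp_hlog[OF fd fd, of i i] by simp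
    then have "x 0 = f" by (simp add: x_def vec_eq_iff)
    then have fR: "cmod (f $ i) \<le> R" for i using R(2)[of 0] by metis
    obtain B where B: "\<And>z w. cmod z \<le> R \<Longrightarrow> cmod w \<le> R \<Longrightarrow> hdist z w \<le> B"
      using hdist_bounded_on_cball[OF R(1)] by metis
    obtain i where i: "v $ i \<noteq> 0" using v by (auto simp: vec_eq_iff)
    have B0: "B \<ge> 0" using B[OF fR fR, of i i] fd by simp
    \<comment> \<open>The time at which vertex i has travelled the distance B + 1, more than the
      confining polydisk allows.\<close>
    define s where "s = (B + 1) / norm (v $ i)"
    have "hdist (f $ i) (x s $ i) = B + 1"
      unfolding x_def using hdist_hexp[OF fd, of i "s *\<^sub>R v $ i"] i B0 by (simp add: s_def)
    then show False using B[OF fR R(2), of i s i] by simp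
  qed
  have "\<exists>m>0. \<forall>v. norm v = 1 \<longrightarrow> m \<le> H v"
  proof -
    have "axis i 1 \<in> sphere (0 :: complex ^ 'v) 1" for i by (simp add: norm_axis)
    then have "sphere (0 :: complex ^ 'v) 1 \<noteq> {}" by blast
    then obtain v where "v \<in> sphere 0 1" "\<forall>w\<in>sphere 0 1. H v \<le> H w"
      using continuous_attains_inf[OF compact_sphere _ cH] by blast
    then show ?thesis using Hpos[of v] by (intro exI[of _ "H v"]) (force simp: sphere_def)
  qed
  then obtain m where m: "m > 0" "\<And>v. norm v = 1 \<Longrightarrow> m \<le> H v" by blast
  have Hm: "m * (norm v)\<^sup>2 \<le> H v" for v
  proof (cases "v = 0")
    case True
    then show ?thesis using H0[of v] by simp
  next
    case False
    have "H v = (norm v)\<^sup>2 * H (sgn v)"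
    proof -
      have v: "v $ i = norm v *\<^sub>R sgn v $ i" for i using False by (simp add: sgn_div_norm)
      have "edge_form (U k l) (U' k l) (v $ k) (\<omega> k l * v $ l)
          = (norm v)\<^sup>2 * edge_form (U k l) (U' k l) (sgn v $ k) (\<omega> k l * sgn v $ l)" for k l
        unfolding edge_form_scale[OF norm_ge_zero, symmetric] mult_scaleR_right[symmetric] v[symmetric] ..
      then show ?thesis unfolding H_def sum_distrib_left by (intro sum.cong) (auto simp: mult_ac)
    qed
    moreover have "m \<le> H (sgn v)" using False by (intro m(2)) (simp add: norm_sgn)
    ultimately show ?thesis by (simp add: mult.commute mult_right_mono)
  qed
  define dmax where "dmax = (\<Sum>(k, l)\<in>EE. hdist (f $ k) (\<gamma> k l (f $ l)))"
  have dm: "hdist (f $ k) (\<gamma> k l (f $ l)) \<le> dmax" if "(k, l) \<in> EE" for k l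
  proof -
    have "(case (k, l) of (k, l) \<Rightarrow> hdist (f $ k) (\<gamma> k l (f $ l))) \<le> dmax"
      unfolding dmax_def using that hdist_nonneg fd iso_disk by (intro member_le_sum) (auto simp del: mem_ball_0)
    then show ?thesis by simp
  qed
  \<comment> \<open>The comparison with the form needs one bound for the displacement of the
    vertices and for the edge lengths at f.\<close>
  define Q where "Q = max P dmax"
  define C where "C = 3 * (1 + Q\<^sup>2) + 8 * cosh (2 * Q) ^ 3"
  have "0 \<le> 3 * (1 + Q\<^sup>2)" "0 < 8 * cosh (2 * Q) ^ 3"
    by (intro mult_nonneg_nonneg add_nonneg_nonneg) auto
  then have C: "C > 0" unfolding C_def by (rule add_nonneg_pos)
  show ?thesis
  proof (rule that[of "m / (2 * C)"])
    show "m / (2 * C) > 0" using m(1) C by simp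
    fix x assume x: "x \<in> realizations" and P: "\<And>i. hdist (f $ i) (x $ i) \<le> P"
    have xd: "x $ i \<in> disk" for i using x by (simp add: realizations_def)
    define v where "v = (\<chi> i. hlog (f $ i) (x $ i))"
    have "sqdist f x = (norm v)\<^sup>2"
      unfolding sqdist_def power2_norm_eq_inner inner_vec_def v_def
      by (simp add: norm_hlog[OF fd xd] flip: power2_norm_eq_inner)
    then have "m * sqdist f x \<le> H v" using Hm[of v] by simp
    also have "\<dots> \<le> (\<Sum>(k, l)\<in>EE. C * (c k l * corner_sum (f $ k) (\<gamma> k l (f $ l)) (x $ k) (\<gamma> k l (x $ l))))"
      unfolding H_def
    proof (intro sum_mono, clarify)
      fix k l assume kl: "(k, l) \<in> EE"
      have "\<omega> k l * v $ l = hlog (\<gamma> k l (f $ l)) (\<gamma> k l (x $ l))"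
        using \<omega>(2)[OF kl xd] by (simp add: v_def)
      moreover have "hdist (f $ k) (x $ k) \<le> Q" "hdist (f $ k) (\<gamma> k l (f $ l)) \<le> Q"
        using P[of k] dm[OF kl] by (simp_all add: Q_def)
      ultimately have "edge_form (U k l) (U' k l) (v $ k) (\<omega> k l * v $ l)
          \<le> C * corner_sum (f $ k) (\<gamma> k l (f $ l)) (x $ k) (\<gamma> k l (x $ l))"
        using corner_sum_ge_edge_form[OF fd iso_disk(1)[OF kl fd] xd iso_disk(1)[OF kl xd]]
        unfolding U_def U'_def C_def v_def by simp
      from mult_left_mono[OF this less_imp_le[OF c_pos[OF kl]]]
      show "c k l * edge_form (U k l) (U' k l) (v $ k) (\<omega> k l * v $ l)
          \<le> C * (c k l * corner_sum (f $ k) (\<gamma> k l (f $ l)) (x $ k) (\<gamma> k l (x $ l)))"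
        by (simp add: mult_ac)
    qed
    \<comment> \<open>At the critical point f the other summand \<open>pull f x\<close> is
      zero.\<close>
    also have "\<dots> = C * (2 * pull x f)"
      using inner_force_pair[OF x f] unfolding crit by (simp add: sum_distrib_left case_prod_beta)
    finally show "m / (2 * C) * sqdist f x \<le> pull x f"
      using C by (simp add: field_simps)
  qed
qed

end

section \<open>Global existence and exponential convergence of the gradient flow\<close>

lemma bounded_lipschitz_isometry:
  assumes g: "disk_isometry g" and R: "R < 1"
  shows "bounded_lipschitz (cball 0 R) g"
proof (rule bounded_lipschitz_of_deriv[where f' = "deriv g"])
  have hol: "g holomorphic_on disk" using g by (simp add: disk_isometry_def)
  have sub: "cball 0 R \<subseteq> disk" using R by auto
  show "(g has_field_derivative deriv g x) (at x)" if "x \<in> cball 0 R" for x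
    using that sub hol by (intro holomorphic_derivI[of _ disk]) auto
  show "continuous_on (cball 0 R) (deriv g)"
    using holomorphic_deriv[OF hol open_ball] holomorphic_on_imp_continuous_on continuous_on_subset sub by blast
qed auto

lemma disk_isometry_cball:
  assumes g: "disk_isometry g" and R: "R < 1"
  obtains R' where "R' < 1" "\<And>z. cmod z \<le> R \<Longrightarrow> cmod (g z) \<le> R'"
proof -
  obtain B where B: "\<And>z w. cmod z \<le> R \<Longrightarrow> cmod w \<le> R \<Longrightarrow> hdist z w \<le> B"
    using hdist_bounded_on_cball[OF R] by metis
  have 0: "(0::complex) \<in> disk" by simp
  have g0: "g z \<in> disk" if "z \<in> disk" for z using g that unfolding disk_isometry_def by blast
  show ?thesis
  proof (rule that[OF tanh_real_lt_1])
    fix z assume z: "cmod z \<le> R"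
    then have zd: "z \<in> disk" and R0: "cmod 0 \<le> R" using R order_trans[OF norm_ge_zero z] by auto
    have "hdist 0 (g z) \<le> hdist 0 (g 0) + hdist (g 0) (g z)" by (rule hdist_triangle[OF 0 g0[OF 0] g0[OF zd]])
    also have "hdist (g 0) (g z) = hdist 0 z" using g 0 zd unfolding disk_isometry_def by blast
    also have "\<dots> \<le> B" by (rule B[OF R0 z])
    finally show "cmod (g z) \<le> tanh ((hdist 0 (g 0) + B) / 2)" by (intro cmod_le_of_hdist g0[OF zd]) simp
  qed
qed

context isometry_graph
begin

lemma bounded_lipschitz_field:
  assumes R: "R < 1"
  shows "bounded_lipschitz {x. \<forall>i. cmod (x $ i) \<le> R} field"
proof -
  define K where "K = {x :: complex ^ 'v. \<forall>i. cmod (x $ i) \<le> R}"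
  have comp: "bounded_lipschitz K (\<lambda>x. x $ i)" for i
  proof -
    have "1-lipschitz_on K (\<lambda>x. x $ i)"
      by (rule lipschitz_onI) (auto simp: dist_vec_nth_le)
    then show ?thesis unfolding bounded_lipschitz_def by (auto simp: K_def)
  qed
  have img: "(\<lambda>x. x $ i) ` K \<subseteq> cball 0 R" for i by (auto simp: K_def)
  have main: "bounded_lipschitz K (\<lambda>x. hlog (x $ k) (g (x $ l)))" if g: "disk_isometry g" for g k l
  proof -
    obtain R' where R': "R' < 1" "\<And>z. cmod z \<le> R \<Longrightarrow> cmod (g z) \<le> R'"
      using disk_isometry_cball[OF g R] by metis
    show ?thesis
    proof (rule bounded_lipschitz_hlog[of _ _ "max R R'"])
      show "bounded_lipschitz K (\<lambda>x. g (x $ l))"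
        by (rule bounded_lipschitz_compose[OF comp bounded_lipschitz_isometry[OF g R] img])
      show "cmod (g (x $ l)) \<le> max R R'" if "x \<in> K" for x
        using R'(2)[of "x $ l"] that by (auto simp: K_def le_max_iff_disj)
    qed (use comp R R' in \<open>auto simp: K_def le_max_iff_disj\<close>)
  qed
  have fo: "bounded_lipschitz K (\<lambda>x. force x $ i)" for i
  proof -
    have "bounded_lipschitz K (\<lambda>x. (1/2) *\<^sub>R (\<Sum>(k, l)\<in>EE. c k l *\<^sub>R
      ((if k = i then hlog (x $ k) (\<gamma> k l (x $ l)) else 0) + (if l = i then hlog (x $ l) (\<gamma>' k l (x $ k)) else 0))))"
      unfolding case_prod_beta
    proof (intro bounded_linear.bounded_lipschitz[OF bounded_linear_scaleR_right] bounded_lipschitz_sum bounded_lipschitz_add)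
      fix p assume p: "p \<in> EE"
      then have "disk_isometry (\<gamma> (fst p) (snd p))" "disk_isometry (\<gamma>' (fst p) (snd p))"
        using iso iso' by auto
      note m = this[THEN main]
      show "bounded_lipschitz K (\<lambda>x. if fst p = i then hlog (x $ fst p) (\<gamma> (fst p) (snd p) (x $ snd p)) else 0)"
        using m(1)[of "fst p" "snd p"] by (cases "fst p = i") (simp_all add: bounded_lipschitz_const)
      show "bounded_lipschitz K (\<lambda>x. if snd p = i then hlog (x $ snd p) (\<gamma>' (fst p) (snd p) (x $ fst p)) else 0)"
        using m(2)[of "snd p" "fst p"] by (cases "snd p = i") (simp_all add: bounded_lipschitz_const)
    qed
    then show ?thesis by (simp add: force_def)
  qed
  have "bounded_lipschitz K (\<lambda>x. (1 / 2 + (- 1 / 2) * (cmod (x $ i) * cmod (x $ i))) *\<^sub>R force x $ i)" for i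
    by (intro bounded_bilinear.bounded_lipschitz[OF bounded_bilinear_scaleR] bounded_lipschitz_add
        bounded_lipschitz_const bounded_bilinear.bounded_lipschitz[OF bounded_bilinear_mult]
        bounded_lipschitz_norm comp fo)
  moreover have "(1 / 2 + (- 1 / 2) * (cmod (x $ i) * cmod (x $ i))) *\<^sub>R force x $ i = field x $ i" for x i
    by (simp add: field_def power2_eq_square diff_divide_distrib)
  ultimately have "bounded_lipschitz K (\<lambda>x. field x $ i)" for i by simp
  then show ?thesis unfolding K_def by (rule bounded_lipschitz_vec)
qed

text \<open>The vector field is cut off outside a polydisk which the flow cannot leave, because the distance
  to a critical point does not increase.\<close>

lemma flow_exists:
  assumes f: "f \<in> realizations" and crit: "force f = 0" and f0: "f\<^sub>0 \<in> realizations"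
  obtains x where "negative_gradient_flow D {0..} f\<^sub>0 x" "\<And>t. t \<ge> 0 \<Longrightarrow> sqdist (x t) f \<le> sqdist f\<^sub>0 f"
proof -
  have fd: "f $ i \<in> disk" for i using f by (simp add: realizations_def)
  have field0: "field f = 0" by (simp add: field_def crit vec_eq_iff)
  define B where "B = (\<Sum>i\<in>UNIV. hdist 0 (f $ i)) + sqrt (sqdist f\<^sub>0 f)"
  define R1 where "R1 = tanh (B / 2)"
  have R1: "R1 < 1" unfolding R1_def by (rule tanh_real_lt_1)
  have confined: "cmod (y $ i) \<le> R1" if y: "y \<in> realizations" and le: "sqdist y f \<le> sqdist f\<^sub>0 f" for y i
  proof -
    have yd: "y $ i \<in> disk" using y by (simp add: realizations_def)
    have "(hdist (y $ i) (f $ i))\<^sup>2 \<le> sqdist y f"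
      unfolding sqdist_def by (rule member_le_sum) auto
    then have "hdist (y $ i) (f $ i) \<le> sqrt (sqdist f\<^sub>0 f)" using le by (intro real_le_rsqrt) linarith
    moreover have "hdist 0 (f $ i) \<le> (\<Sum>i\<in>UNIV. hdist 0 (f $ i))"
      using hdist_nonneg fd by (intro member_le_sum) auto
    ultimately have "hdist 0 (y $ i) \<le> B"
      using hdist_triangle[of 0 "f $ i" "y $ i"] hdist_commute[OF fd yd] fd yd by (simp add: B_def)
    then show ?thesis unfolding R1_def by (rule cmod_le_of_hdist[OF yd])
  qed
  \<comment> \<open>A radius strictly between R1 and 1. The gap between R1 and R is what a first
    arrival at radius R contradicts.\<close>
  define R where "R = (1 + R1) / 2"
  have R: "R1 < R" "R < 1" using R1 by (auto simp: R_def)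
  define K where "K = {x :: complex ^ 'v. \<forall>i. cmod (x $ i) \<le> R}"
  have f0R1: "cmod (f\<^sub>0 $ i) \<le> R1" for i by (rule confined[OF f0 order_refl])
  have R1': "0 \<le> R1" using f0R1 norm_ge_zero order_trans by blast
  have f0K: "f\<^sub>0 \<in> K" using order_trans[OF f0R1 less_imp_le[OF R(1)]] by (simp add: K_def)
  have Kr: "K \<subseteq> realizations" unfolding K_def by (rule polydisk_realizations[OF R(2)])
  have K: "closed K" "K \<noteq> {}" unfolding K_def using closed_polydisk f0K by (auto simp: K_def)
  have "convex K"
  proof (rule convexI)
    fix x y :: "complex ^ 'v" and u v :: real
    assume *: "x \<in> K" "y \<in> K" "0 \<le> u" "0 \<le> v" "u + v = 1"
    have "cmod ((u *\<^sub>R x + v *\<^sub>R y) $ i) \<le> R" for i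
    proof -
      have "cmod ((u *\<^sub>R x + v *\<^sub>R y) $ i) \<le> u * cmod (x $ i) + v * cmod (y $ i)"
        using norm_triangle_ineq[of "u *\<^sub>R x $ i" "v *\<^sub>R y $ i"] * by simp
      also have "\<dots> \<le> u * R + v * R" using * by (intro add_mono mult_left_mono) (auto simp: K_def)
      also have "\<dots> = R" using *(5) by (simp flip: distrib_right)
      finally show ?thesis .
    qed
    then show "u *\<^sub>R x + v *\<^sub>R y \<in> K" by (simp add: K_def)
  qed
  \<comment> \<open>Composed with the nearest-point projection onto the convex set \<open>K\<close>,
    the field becomes bounded and Lipschitz on the whole space and is unchanged on
    \<open>K\<close>.\<close>
  note cl = closest_point_lipschitz[OF this K]
  obtain L M where L: "L-lipschitz_on K field" and M: "\<And>x. x \<in> K \<Longrightarrow> norm (field x) \<le> M"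
    using bounded_lipschitz_field[OF R(2)] unfolding bounded_lipschitz_def K_def by blast
  have inK: "closest_point K x \<in> K" for x by (rule closest_point_in_set[OF K])
  define L' where "L' = L + 1"
  have L0: "0 \<le> L" by (rule lipschitz_on_nonneg[OF L])
  have "L'-lipschitz_on UNIV (\<lambda>x. field (closest_point K x))"
  proof (rule lipschitz_onI)
    fix x y
    have "dist (field (closest_point K x)) (field (closest_point K y)) \<le> L * dist (closest_point K x) (closest_point K y)"
      by (rule lipschitz_onD[OF L inK inK])
    also have "\<dots> \<le> L' * dist x y" using cl L0 by (intro mult_mono) (auto simp: L'_def)
    finally show "dist (field (closest_point K x)) (field (closest_point K y)) \<le> L' * dist x y" .
  qed (use L0 in \<open>simp add: L'_def\<close>)
  then obtain x where x0: "x 0 = f\<^sub>0"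
      and x': "\<And>t. t \<ge> 0 \<Longrightarrow> (x has_vector_derivative field (closest_point K (x t))) (at t within {0..})"
    using lipschitz_flow_exists[of L' "\<lambda>x. field (closest_point K x)" M f\<^sub>0] M[OF inK] L0 by (auto simp: L'_def)
  have flow: "(x has_vector_derivative field (x s)) (at s within S)" if "x s \<in> K" "s \<ge> 0" "S \<subseteq> {0..}" for s S
    using x'[OF that(2)] closest_point_self[OF that(1)] that(3) has_vector_derivative_within_subset by metis
  have decr: "sqdist (x t) f \<le> sqdist f\<^sub>0 f" if t: "0 \<le> t" and inside: "\<And>s. s \<in> {0..t} \<Longrightarrow> x s \<in> K" for t
  proof -
    have "sqdist (x t) f \<le> sqdist (x 0) f"
    proof (rule DERIV_nonpos_within_imp_le[where r = "\<lambda>t. sqdist (x t) f" and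
        r' = "\<lambda>s. - 2 * (pull (x s) f + pull f (x s))"])
      fix s assume s: "s \<in> {0..t}"
      have xr: "x s \<in> realizations" using inside[OF s] Kr by blast
      have "((\<lambda>t. sqdist (x t) ((\<lambda>_. f) t)) has_real_derivative
        - 2 * (pull (x s) ((\<lambda>_. f) s) + pull ((\<lambda>_. f) s) (x s))) (at s within {0..t})"
        using s flow[OF inside[OF s]] xr f field0 by (intro sqdist_deriv) auto
      then show "((\<lambda>t. sqdist (x t) f) has_real_derivative
        - 2 * (pull (x s) f + pull f (x s))) (at s within {0..t})" .
      show "- 2 * (pull (x s) f + pull f (x s)) \<le> 0"
        using inner_force_pair_nonneg[OF xr f] by simp
    qed (use t in auto)
    then show ?thesis by (simp add: x0)
  qed
  have cx: "continuous_on {0..} x"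
    using x' by (intro continuous_on_vector_derivative) auto
  have stay: "x t \<in> K" if t: "t \<ge> 0" for t
  proof (rule ccontr)
    assume "x t \<notin> K"
    then obtain i where i: "R < cmod (x t $ i)" by (auto simp: K_def not_le)
    define h where "h s = Max (range (\<lambda>i. cmod (x s $ i)))" for s
    have h: "h s \<le> a \<longleftrightarrow> (\<forall>i. cmod (x s $ i) \<le> a)" for s a unfolding h_def by (subst Max_le_iff) auto
    \<comment> \<open>The times at which some coordinate has reached radius R. Up to the first of
      them the curve stays in \<open>K\<close> and follows the true field, so its distance to f has
      not increased and its coordinates are at most R1.\<close>
    define A where "A = {s \<in> {0..t}. \<exists>i. R \<le> cmod (x s $ i)}"
    have tA: "t \<in> A" using i t by (auto simp: A_def intro: less_imp_le)
    have "A = (\<Union>i. {0..t} \<inter> (\<lambda>s. cmod (x s $ i)) -` {R..})" by (auto simp: A_def)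
    moreover have "closed \<dots>"
      by (intro closed_UN finite ballI continuous_closed_preimage continuous_intros)
         (auto intro!: continuous_on_subset[OF cx])
    ultimately have cA: "closed A" by simp
    define s where "s = Inf A"
    have bA: "bdd_below A" by (rule bdd_belowI[of _ 0]) (auto simp: A_def)
    have sA: "s \<in> A" unfolding s_def using closed_contains_Inf[OF _ bA cA] tA by blast
    then obtain j where j: "R \<le> cmod (x s $ j)" and s: "0 \<le> s" "s \<le> t" by (auto simp: A_def)
    have before: "x r \<in> K" if "0 \<le> r" "r < s" for r
    proof -
      have "r \<notin> A" using that cInf_lower[OF _ bA, of r] by (auto simp: s_def)
      then show ?thesis using that s by (auto simp: A_def K_def not_le intro: less_imp_le)
    qed
    have "s \<noteq> 0" using j f0R1[of j] R(1) x0 by auto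
    then have s0: "0 < s" using s by simp
    have "x s \<in> K"
    proof -
      have "(x \<longlongrightarrow> x s) (at_left s)"
      proof -
        have "(x \<longlongrightarrow> x s) (at s within {0..})" using cx s by (simp add: continuous_on_def)
        then have "(x \<longlongrightarrow> x s) (at s within {0..s})" by (rule tendsto_within_subset) auto
        then show ?thesis using s0 by (simp add: at_within_Icc_at_left)
      qed
      moreover have "\<forall>\<^sub>F r in at_left s. x r \<in> K"
        using s0 before by (auto simp: eventually_at_left intro!: exI[of _ 0])
      ultimately show ?thesis
        using Lim_in_closed_set[OF K(1), of x "at_left s"] by simp
    qed
    then have "sqdist (x s) f \<le> sqdist f\<^sub>0 f"
      using before s by (intro decr) (auto simp: less_le)
    then have "cmod (x s $ j) \<le> R1" using \<open>x s \<in> K\<close> Kr by (intro confined) auto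
    then show False using j R(1) by simp
  qed
  show ?thesis
  proof (rule that)
    show "negative_gradient_flow D {0..} f\<^sub>0 x"
      unfolding negative_gradient_flow_iff using x0 stay Kr flow by auto
    show "sqdist (x t) f \<le> sqdist f\<^sub>0 f" if "t \<ge> 0" for t
      using that stay by (intro decr) auto
  qed
qed

lemma sqdist_commute: "x \<in> realizations \<Longrightarrow> y \<in> realizations \<Longrightarrow> sqdist x y = sqdist y x"
  unfolding sqdist_def realizations_def by (auto intro!: sum.cong simp: hdist_commute)

lemma norm_diff_le_sqdist:
  assumes "x \<in> realizations" "y \<in> realizations"
  shows "(norm (x - y))\<^sup>2 \<le> sqdist x y"
proof -
  have "(norm (x - y))\<^sup>2 = (\<Sum>i\<in>UNIV. (cmod (x $ i - y $ i))\<^sup>2)"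
    unfolding power2_norm_eq_inner inner_vec_def by simp
  also have "\<dots> \<le> sqdist x y"
    unfolding sqdist_def using assms
    by (intro sum_mono power_mono cmod_diff_le_hdist) (auto simp: realizations_def)
  finally show ?thesis .
qed

theorem gradient_flow_converges:
  "(\<forall>K. compact K \<longrightarrow> compact {x \<in> realizations. D x \<in> K})
    \<and> (\<forall>x\<in>realizations. D differentiable (at x))
    \<and> (\<exists>f\<in>realizations. (\<forall>x\<in>realizations. D f \<le> D x)
        \<and> (\<forall>f'\<in>realizations. (\<forall>x\<in>realizations. D f' \<le> D x) \<longrightarrow> f' = f)
        \<and> (\<forall>f\<^sub>0\<in>realizations. \<exists>x. negative_gradient_flow D {0..} f\<^sub>0 x
            \<and> (\<forall>b>0. \<forall>y. negative_gradient_flow D {0..<b} f\<^sub>0 y \<longrightarrow> (\<forall>t\<in>{0..<b}. y t = x t))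
            \<and> (\<exists>C>0. \<exists>\<kappa>>0. \<forall>t\<ge>0. riem_dist (x t) f \<le> C * exp (- \<kappa> * t))))"
proof (intro conjI)
  show "\<forall>K. compact K \<longrightarrow> compact {x \<in> realizations. D x \<in> K}" using D_proper by blast
  show "\<forall>x\<in>realizations. D differentiable (at x)" using D_differentiable by blast
  obtain f where f: "f \<in> realizations" and min: "\<And>x. x \<in> realizations \<Longrightarrow> D f \<le> D x"
    using minimizer_exists by blast
  have crit: "force f = 0" by (rule minimizer_force[OF f min])
  have field0: "field f = 0" by (simp add: field_def crit vec_eq_iff)
  have fd: "f $ i \<in> disk" for i using f by (simp add: realizations_def)
  have le_sqrt: "hdist (f $ i) (y $ i) \<le> sqrt (sqdist f y)" for y :: "complex ^ 'v" and i
  proof (rule real_le_rsqrt)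
    show "(hdist (f $ i) (y $ i))\<^sup>2 \<le> sqdist f y" unfolding sqdist_def by (rule member_le_sum) auto
  qed
  \<comment> \<open>Another minimizer is critical as well, so its pull towards f is zero, and
    coercivity leaves no distance between the two.\<close>
  have uniq: "f' = f" if f': "f' \<in> realizations" and min': "\<And>x. x \<in> realizations \<Longrightarrow> D f' \<le> D x" for f'
  proof -
    obtain \<mu> where \<mu>: "\<mu> > 0" "\<And>x. x \<in> realizations \<Longrightarrow> (\<And>i. hdist (f $ i) (x $ i) \<le> sqrt (sqdist f f')) \<Longrightarrow>
        pull x f \<ge> \<mu> * sqdist f x"
      using coercive[OF f crit, of "sqrt (sqdist f f')"] by metis
    have "\<mu> * sqdist f f' \<le> 0"
      using \<mu>(2)[OF f' le_sqrt] minimizer_force[OF f' min'] by simp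
    then have "sqdist f f' = 0" using \<mu>(1) sqdist_nonneg[of f f'] by (simp add: mult_le_0_iff)
    then show ?thesis using sqdist_eq_0_iff[OF f f'] by simp
  qed
  have conv: "\<exists>x. negative_gradient_flow D {0..} f\<^sub>0 x
            \<and> (\<forall>b>0. \<forall>y. negative_gradient_flow D {0..<b} f\<^sub>0 y \<longrightarrow> (\<forall>t\<in>{0..<b}. y t = x t))
            \<and> (\<exists>C>0. \<exists>\<kappa>>0. \<forall>t\<ge>0. riem_dist (x t) f \<le> C * exp (- \<kappa> * t))"
    if f0: "f\<^sub>0 \<in> realizations" for f\<^sub>0
  proof -
    obtain x where x: "negative_gradient_flow D {0..} f\<^sub>0 x"
        and le: "\<And>t. t \<ge> 0 \<Longrightarrow> sqdist (x t) f \<le> sqdist f\<^sub>0 f"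
      using flow_exists[OF f crit f0] by metis
    have xr: "x t \<in> realizations" "(x has_vector_derivative field (x t)) (at t within S)"
      if "t \<ge> 0" "S \<subseteq> {0..}" for t S
      using x that unfolding negative_gradient_flow_iff by (auto intro: has_vector_derivative_within_subset)
    define P where "P = sqrt (sqdist f\<^sub>0 f)"
    have xP: "hdist (f $ i) (x t $ i) \<le> P" if "t \<ge> 0" for t i
    proof -
      have "sqdist f (x t) \<le> sqdist f\<^sub>0 f" using le[OF that] sqdist_commute[OF f xr(1)[OF that order_refl]] by simp
      then have "sqrt (sqdist f (x t)) \<le> P" by (simp add: P_def)
      then show ?thesis using le_sqrt[of i "x t"] by linarith
    qed
    obtain \<mu> where \<mu>: "\<mu> > 0" "\<And>x. x \<in> realizations \<Longrightarrow> (\<And>i. hdist (f $ i) (x $ i) \<le> P) \<Longrightarrow>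
        pull x f \<ge> \<mu> * sqdist f x"
      using coercive[OF f crit, of P] by metis
    \<comment> \<open>The constant curve f is a flow line too. Coercivity bounds the derivative of
      the squared distance by -2 \<mu> times itself, so multiplication by exp (2 \<mu> t) makes it
      nonincreasing.\<close>
    have decay: "sqdist (x t) f \<le> sqdist f\<^sub>0 f * exp (- 2 * \<mu> * t)" if t: "t \<ge> 0" for t
    proof -
      let ?S = "\<lambda>s. pull (x s) f"
      have "sqdist (x t) f * exp (2 * \<mu> * t) \<le> sqdist (x 0) f * exp (2 * \<mu> * 0)"
      proof (rule DERIV_nonpos_within_imp_le[where r = "\<lambda>t. sqdist (x t) f * exp (2 * \<mu> * t)" and
          r' = "\<lambda>s. (- 2 * ?S s) * exp (2 * \<mu> * s) + sqdist (x s) f * (2 * \<mu> * exp (2 * \<mu> * s))"])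
        fix s assume s: "s \<in> {0..t}"
        then have s0: "s \<ge> 0" by simp
        have xs: "x s \<in> realizations" by (rule xr(1)[OF s0 order_refl])
        have "((\<lambda>t. sqdist (x t) ((\<lambda>_. f) t)) has_real_derivative
          - 2 * (pull (x s) ((\<lambda>_. f) s) + pull ((\<lambda>_. f) s) (x s))) (at s within {0..t})"
          using xr[OF s0, of "{0..t}"] f field0 by (intro sqdist_deriv) auto
        then have d: "((\<lambda>t. sqdist (x t) f) has_real_derivative - 2 * ?S s) (at s within {0..t})"
          by (simp add: crit)
        have e: "((\<lambda>t. exp (2 * \<mu> * t)) has_real_derivative 2 * \<mu> * exp (2 * \<mu> * s)) (at s within {0..t})"
          by (auto intro!: derivative_eq_intros)
        show "((\<lambda>t. sqdist (x t) f * exp (2 * \<mu> * t)) has_real_derivative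
          (- 2 * ?S s) * exp (2 * \<mu> * s) + sqdist (x s) f * (2 * \<mu> * exp (2 * \<mu> * s))) (at s within {0..t})"
          using DERIV_mult[OF d e] by (simp add: mult_ac add.commute)
        have "\<mu> * sqdist (x s) f \<le> ?S s"
          using \<mu>(2)[OF xs xP[OF s0]] sqdist_commute[OF f xs] by simp
        then have "(- ?S s + \<mu> * sqdist (x s) f) * (2 * exp (2 * \<mu> * s)) \<le> 0"
          by (intro mult_nonpos_nonneg) auto
        then show "(- 2 * ?S s) * exp (2 * \<mu> * s) + sqdist (x s) f * (2 * \<mu> * exp (2 * \<mu> * s)) \<le> 0"
          by (simp add: algebra_simps)
      qed (use t in auto)
      also have "\<dots> = sqdist f\<^sub>0 f" using x by (simp add: negative_gradient_flow_iff)
      finally have "sqdist (x t) f * exp (2 * \<mu> * t) * exp (- 2 * \<mu> * t) \<le> sqdist f\<^sub>0 f * exp (- 2 * \<mu> * t)"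
        by (intro mult_right_mono) auto
      then show ?thesis by (simp add: exp_minus mult.assoc)
    qed
    define R where "R = tanh (((\<Sum>i\<in>UNIV. hdist 0 (f $ i)) + P) / 2)"
    have R: "R < 1" unfolding R_def by (rule tanh_real_lt_1)
    have hf: "hdist 0 (f $ i) \<le> (\<Sum>i\<in>UNIV. hdist 0 (f $ i))" for i
      using hdist_nonneg fd by (intro member_le_sum) auto
    have P0: "0 \<le> P" by (simp add: P_def sqdist_nonneg)
    have fR: "cmod (f $ i) \<le> R" for i
      unfolding R_def using hf[of i] P0 by (intro cmod_le_of_hdist[OF fd]) linarith
    have xR: "cmod (x t $ i) \<le> R" if "t \<ge> 0" for t i
    proof -
      have xd: "x t $ i \<in> disk" using xr(1)[OF that order_refl] by (simp add: realizations_def)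
      have "hdist 0 (x t $ i) \<le> (\<Sum>i\<in>UNIV. hdist 0 (f $ i)) + P"
        using hdist_triangle[of 0 "f $ i" "x t $ i"] hf[of i] xP[OF that, of i] fd xd by simp
      then show ?thesis unfolding R_def by (rule cmod_le_of_hdist[OF xd])
    qed
    have R0: "0 \<le> R" using fR norm_ge_zero order_trans by blast
    have R2: "R\<^sup>2 < 1" using R R0 by (simp add: power_less_one_iff abs_square_less_1)
    \<comment> \<open>The summand 1 keeps \<open>C\<close> positive also for a flow that starts at
      f.\<close>
    define C where "C = 2 / (1 - R\<^sup>2) * P + 1"
    have C: "C > 0" using R2 P0 by (simp add: C_def add_nonneg_pos)
    have "riem_dist (x t) f \<le> C * exp (- \<mu> * t)" if t: "t \<ge> 0" for t
    proof -
      have "(norm (x t - f))\<^sup>2 \<le> sqdist f\<^sub>0 f * exp (- 2 * \<mu> * t)"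
        using norm_diff_le_sqdist[OF xr(1)[OF t order_refl] f] decay[OF t] by linarith
      also have "\<dots> = (P * exp (- \<mu> * t))\<^sup>2"
      proof -
        have "exp (- 2 * \<mu> * t) = (exp (- \<mu> * t))\<^sup>2" by (simp add: exp_double[symmetric])
        then show ?thesis by (simp add: P_def power_mult_distrib sqdist_nonneg)
      qed
      finally have "norm (x t - f) \<le> P * exp (- \<mu> * t)" using P0 by (simp add: power2_le_iff_abs_le)
      then have "2 / (1 - R\<^sup>2) * norm (x t - f) \<le> 2 / (1 - R\<^sup>2) * (P * exp (- \<mu> * t))"
        using R2 by (intro mult_left_mono) auto
      then have "riem_dist (x t) f \<le> 2 / (1 - R\<^sup>2) * (P * exp (- \<mu> * t))"
        using riem_dist_le_norm[OF R0 R xR[OF t] fR] by linarith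
      also have "\<dots> \<le> C * exp (- \<mu> * t)" by (simp add: C_def algebra_simps)
      finally show ?thesis .
    qed
    then show ?thesis using x flow_unique[OF x] C \<mu>(1) by blast
  qed
  show "\<exists>f\<in>realizations. (\<forall>x\<in>realizations. D f \<le> D x)
        \<and> (\<forall>f'\<in>realizations. (\<forall>x\<in>realizations. D f' \<le> D x) \<longrightarrow> f' = f)
        \<and> (\<forall>f\<^sub>0\<in>realizations. \<exists>x. negative_gradient_flow D {0..} f\<^sub>0 x
            \<and> (\<forall>b>0. \<forall>y. negative_gradient_flow D {0..<b} f\<^sub>0 y \<longrightarrow> (\<forall>t\<in>{0..<b}. y t = x t))
            \<and> (\<exists>C>0. \<exists>\<kappa>>0. \<forall>t\<ge>0. riem_dist (x t) f \<le> C * exp (- \<kappa> * t)))"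
    by (rule bexI[OF _ f]) (intro conjI ballI impI min uniq conv; blast)
qed

end

subsection \<open>Cocompact groups of isometries\<close>

abbreviation disk_id :: "complex \<Rightarrow> complex"
  where "disk_id \<equiv> (\<lambda>z\<in>disk. z)"

abbreviation disk_inv :: "(complex \<Rightarrow> complex) \<Rightarrow> complex \<Rightarrow> complex"
  where "disk_inv g \<equiv> (\<lambda>z\<in>disk. inv_into disk g z)"

lemma compact_disk_radius:
  assumes "compact K" "K \<subseteq> disk"
  obtains r where "0 \<le> r" "r < 1" "\<And>k. k \<in> K \<Longrightarrow> cmod k \<le> r"
proof (cases "K = {}")
  case True
  then show ?thesis using that[of 0] by simp
next
  case False
  have "\<exists>w\<in>K. \<forall>k\<in>K. cmod k \<le> cmod w"
    by (rule continuous_attains_sup[OF assms(1) False]) (intro continuous_intros)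
  then obtain w where "w \<in> K" "\<And>k. k \<in> K \<Longrightarrow> cmod k \<le> cmod w" by blast
  then show ?thesis using that[of "cmod w"] assms(2) by force
qed

lemma compact_disk_hdist:
  assumes "compact K" "K \<subseteq> disk"
  obtains \<rho> where "0 \<le> \<rho>" "\<And>k. k \<in> K \<Longrightarrow> hdist 0 k \<le> \<rho>"
proof -
  obtain r where r: "0 \<le> r" "r < 1" "\<And>k. k \<in> K \<Longrightarrow> cmod k \<le> r"
    using compact_disk_radius[OF assms] by metis
  obtain B where B: "\<And>z w. cmod z \<le> r \<Longrightarrow> cmod w \<le> r \<Longrightarrow> hdist z w \<le> B"
    using hdist_bounded_on_cball[OF r(2)] by metis
  show ?thesis
  proof (rule that[of B])
    show "0 \<le> B" using B[of 0 0] r(1) by simp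
    show "hdist 0 k \<le> B" if "k \<in> K" for k using B[of 0 k] r(1) r(3)[OF that] by simp
  qed
qed

lemma continuous_on_hdist:
  assumes z: "z \<in> disk"
  shows "continuous_on disk (hdist z)"
proof -
  have "continuous_on disk (\<lambda>w. norm (hlog z w))"
  proof -
    have 1: "continuous_on disk (moebius z)"
      using z by (intro holomorphic_on_imp_continuous_on Moebius_function_holomorphic) auto
    have 2: "continuous_on {-1<..<1} artanh_quot"
      by (rule continuous_at_imp_continuous_on) (use DERIV_artanh_quot DERIV_isCont in force)
    have "continuous_on disk (\<lambda>w. artanh_quot ((cmod (moebius z w))\<^sup>2))"
    proof (rule continuous_on_compose2[OF 2])
      show "continuous_on disk (\<lambda>w. (cmod (moebius z w))\<^sup>2)" by (intro continuous_intros 1)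
      show "(\<lambda>w. (cmod (moebius z w))\<^sup>2) ` disk \<subseteq> {-1<..<1}"
        using moebius_norm_sq_less[OF z] zero_le_power2 by (fastforce intro: less_le_trans[of _ 0])
    qed
    then show ?thesis unfolding hlog_def by (intro continuous_intros 1)
  qed
  then show ?thesis using norm_hlog[OF z] by (simp cong: continuous_on_cong_simp)
qed

locale surface_group =
  fixes \<Gamma> :: "(complex \<Rightarrow> complex) set"
  assumes surface_group: "closed_surface_group \<Gamma>"
begin

lemmas group_parts = surface_group[unfolded closed_surface_group_def]

lemma is_subgroup: "subgroup \<Gamma> (BijGroup disk)"
  by (rule conjunct1[OF group_parts])

lemma Bij_group: "g \<in> \<Gamma> \<Longrightarrow> g \<in> Bij disk"
  using subgroup.subset[OF is_subgroup] by (auto simp: BijGroup_def)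

lemma group_disk: "g \<in> \<Gamma> \<Longrightarrow> z \<in> disk \<Longrightarrow> g z \<in> disk"
  using Bij_imp_funcset[OF Bij_group] by blast

lemma group_isometry:
  assumes g: "g \<in> \<Gamma>"
  shows "disk_isometry g"
  unfolding disk_isometry_def
proof (intro conjI)
  have "g holomorphic_on disk \<and> (\<forall>z\<in>disk. \<forall>w\<in>disk. hdist (g z) (g w) = hdist z w)"
    by (rule bspec[OF conjunct1[OF conjunct2[OF group_parts]] g])
  then show "g holomorphic_on disk" "\<forall>z\<in>disk. \<forall>w\<in>disk. hdist (g z) (g w) = hdist z w" by auto
  show "g ` disk \<subseteq> disk" using group_disk[OF g] by blast
qed

lemma group_hdist: "g \<in> \<Gamma> \<Longrightarrow> z \<in> disk \<Longrightarrow> w \<in> disk \<Longrightarrow> hdist (g z) (g w) = hdist z w"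
  using group_isometry unfolding disk_isometry_def by blast

lemma group_id: "disk_id \<in> \<Gamma>"
proof -
  have "\<one>\<^bsub>BijGroup disk\<^esub> \<in> \<Gamma>" by (rule subgroup.one_closed[OF is_subgroup])
  then show ?thesis by (simp only: BijGroup_def monoid.simps)
qed

lemma group_compose:
  assumes "g \<in> \<Gamma>" "h \<in> \<Gamma>"
  shows "compose disk g h \<in> \<Gamma>"
proof -
  have "g \<otimes>\<^bsub>BijGroup disk\<^esub> h = compose disk g h"
    unfolding BijGroup_def monoid.simps
    by (simp only: restrict_apply' Bij_group[OF assms(1)] Bij_group[OF assms(2)])
  then show ?thesis using subgroup.m_closed[OF is_subgroup assms] by (simp only:)
qed

lemma group_inv: "g \<in> \<Gamma> \<Longrightarrow> disk_inv g \<in> \<Gamma>"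
  using subgroup.m_inv_closed[OF is_subgroup] inv_BijGroup[OF Bij_group] by metis

lemma group_inv_left:
  assumes g: "g \<in> \<Gamma>" and z: "z \<in> disk"
  shows "disk_inv g (g z) = z"
proof -
  have "inj_on g disk" using Bij_group[OF g] unfolding Bij_def bij_betw_def by blast
  then have "inv_into disk g (g z) = z" using z by (rule inv_into_f_f)
  then show ?thesis using group_disk[OF g z] by (simp only: restrict_apply')
qed

lemma group_inv_right:
  assumes g: "g \<in> \<Gamma>" and z: "z \<in> disk"
  shows "g (disk_inv g z) = z"
proof -
  have "g ` disk = disk" using Bij_group[OF g] unfolding Bij_def bij_betw_def by blast
  then have "g (inv_into disk g z) = z" using z by (intro f_inv_into_f) simp
  then show ?thesis using z by (simp only: restrict_apply')
qed

lemma group_fixpoint: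
  assumes "g \<in> \<Gamma>" "z \<in> disk" "g z = z"
  shows "g = disk_id"
proof -
  have "\<forall>g\<in>\<Gamma>. \<forall>z\<in>disk. g z = z \<longrightarrow> g = \<one>\<^bsub>BijGroup disk\<^esub>"
    by (rule conjunct1[OF conjunct2[OF conjunct2[OF conjunct2[OF group_parts]]]])
  then have "g = \<one>\<^bsub>BijGroup disk\<^esub>" using assms by (simp only: Ball_def)
  then show ?thesis by (simp only: BijGroup_def monoid.simps)
qed

lemma group_eqI:
  assumes "g \<in> \<Gamma>" "h \<in> \<Gamma>" "\<And>z. z \<in> disk \<Longrightarrow> g z = h z"
  shows "g = h"
  using Bij_imp_extensional[OF Bij_group[OF assms(1)]] Bij_imp_extensional[OF Bij_group[OF assms(2)]] assms(3)
  by (rule extensionalityI)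

lemma group_free:
  assumes g: "g \<in> \<Gamma>" and h: "h \<in> \<Gamma>" and z: "z \<in> disk" and eq: "g z = h z"
  shows "g = h"
proof -
  have k: "compose disk (disk_inv h) g \<in> \<Gamma>" using group_compose group_inv g h by blast
  have "compose disk (disk_inv h) g z = z"
    using group_inv_left[OF h z] eq z by (simp only: compose_eq)
  then have id: "compose disk (disk_inv h) g = disk_id" by (rule group_fixpoint[OF k z])
  show ?thesis
  proof (rule group_eqI[OF g h])
    fix w assume w: "w \<in> disk"
    have "disk_inv h (g w) = w" using fun_cong[OF id, of w] w by (simp only: compose_eq restrict_apply' w)
    then show "g w = h w" using group_inv_right[OF h group_disk[OF g w]] by simp
  qed
qed

lemma cocompact:
  obtains K where "compact K" "K \<subseteq> disk" "\<And>z. z \<in> disk \<Longrightarrow> \<exists>g\<in>\<Gamma>. \<exists>k\<in>K. z = g k"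
proof -
  obtain K where K: "compact K" "K \<subseteq> disk" "(\<Union>g\<in>\<Gamma>. g ` K) = disk"
    using conjunct2[OF conjunct2[OF conjunct2[OF conjunct2[OF group_parts]]]] by (elim exE conjE)
  show ?thesis
  proof (rule that[OF K(1,2)])
    fix z assume "z \<in> disk"
    then have "z \<in> (\<Union>g\<in>\<Gamma>. g ` K)" by (simp only: K(3))
    then show "\<exists>g\<in>\<Gamma>. \<exists>k\<in>K. z = g k" by (elim UN_E imageE) (intro bexI)
  qed
qed

lemma identity_isolated:
  obtains Z e where "finite Z" "Z \<subseteq> disk" "e > 0"
    "\<And>g. g \<in> \<Gamma> \<Longrightarrow> (\<And>z. z \<in> Z \<Longrightarrow> cmod (g z - z) < e) \<Longrightarrow> g = disk_id"
proof -
  have "discrete \<Gamma>" by (rule conjunct1[OF conjunct2[OF conjunct2[OF group_parts]]])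
  then obtain T where T: "open T" "T \<inter> \<Gamma> = {disk_id}"
    using discreteD[OF _ group_id] unfolding isolated_in_def by blast
  have "openin (product_topology (\<lambda>i. euclidean) UNIV) T" using T(1) by (simp add: open_fun_def)
  moreover have idT: "disk_id \<in> T" using T(2) by blast
  ultimately obtain X where X: "disk_id \<in> (\<Pi>\<^sub>E i\<in>UNIV. X i)" "\<And>i. open (X i)" "finite {i. X i \<noteq> UNIV}"
      "(\<Pi>\<^sub>E i\<in>UNIV. X i) \<subseteq> T"
    using product_topology_open_contains_basis[of "\<lambda>i. euclidean" UNIV T disk_id] by auto
  define Z where "Z = {i. X i \<noteq> UNIV} \<inter> disk"
  have Z: "finite Z" "Z \<subseteq> disk" using X(3) by (auto simp: Z_def)
  have idX: "disk_id z \<in> X z" for z using X(1) by (simp add: PiE_iff)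
  have "\<exists>d>0. ball z d \<subseteq> X z" if "z \<in> Z" for z
  proof -
    have "z \<in> X z" using idX[of z] that Z(2) by auto
    then show ?thesis using X(2)[of z] open_contains_ball by blast
  qed
  then obtain d where d: "\<And>z. z \<in> Z \<Longrightarrow> d z > 0" "\<And>z. z \<in> Z \<Longrightarrow> ball z (d z) \<subseteq> X z" by metis
  define e where "e = Min (insert 1 (d ` Z))"
  have e: "e > 0" "\<And>z. z \<in> Z \<Longrightarrow> e \<le> d z" using Z(1) d(1) by (auto simp: e_def)
  show ?thesis
  proof (rule that[OF Z e(1)])
    fix g assume g: "g \<in> \<Gamma>" and close: "\<And>z. z \<in> Z \<Longrightarrow> cmod (g z - z) < e"
    have "g z \<in> X z" for z
    proof (cases "z \<in> disk")
      case True
      show ?thesis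
      proof (cases "z \<in> Z")
        case True
        then have "g z \<in> ball z (d z)" using close[OF True] e(2)[OF True] by (simp add: dist_norm norm_minus_commute)
        then show ?thesis using d(2)[OF True] by blast
      next
        case False
        then show ?thesis using True by (auto simp: Z_def)
      qed
    next
      case False
      then have "g z = disk_id z"
        using extensional_arb[OF Bij_imp_extensional[OF Bij_group[OF g]]] by (simp only: restrict_apply if_False)
      then show ?thesis using idX by simp
    qed
    then have "g \<in> T" using X(4) by (auto simp: PiE_iff)
    then show "g = disk_id" using T(2) g by blast
  qed
qed

text \<open>Discreteness becomes proper discontinuity. The elements in question map the finite set
  \<open>Z\<close> into a fixed closed disk; cover it by finitely many small balls and record for
  each z in \<open>Z\<close> a ball containing g z. If g and h have the same record, then g followed
  by the inverse of h is so close to the identity on \<open>Z\<close> that it is the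
  identity.\<close>

lemma finite_group_bounded:
  "finite {g \<in> \<Gamma>. hdist 0 (g 0) \<le> R}"
proof -
  obtain Z e where Z: "finite Z" "Z \<subseteq> disk" and e: "e > 0"
    and iso: "\<And>g. g \<in> \<Gamma> \<Longrightarrow> (\<And>z. z \<in> Z \<Longrightarrow> cmod (g z - z) < e) \<Longrightarrow> g = disk_id"
    using identity_isolated by metis
  define G where "G = {g \<in> \<Gamma>. hdist 0 (g 0) \<le> R}"
  have 0: "(0::complex) \<in> disk" by simp
  define r where "r = tanh ((R + (\<Sum>z\<in>Z. hdist 0 z)) / 2)"
  have r: "r < 1" unfolding r_def by (rule tanh_real_lt_1)
  have gr: "cmod (g z) \<le> r" if g: "g \<in> G" and z: "z \<in> Z" for g z
  proof -
    have gG: "g \<in> \<Gamma>" and zd: "z \<in> disk" using g z Z by (auto simp: G_def)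
    have "hdist 0 (g z) \<le> hdist 0 (g 0) + hdist (g 0) (g z)"
      by (rule hdist_triangle[OF 0 group_disk[OF gG 0] group_disk[OF gG zd]])
    also have "hdist (g 0) (g z) = hdist 0 z" by (rule group_hdist[OF gG 0 zd])
    also have "hdist 0 z \<le> (\<Sum>z\<in>Z. hdist 0 z)" using z Z hdist_nonneg[OF 0] by (intro member_le_sum) auto
    finally show ?thesis unfolding r_def using g by (intro cmod_le_of_hdist group_disk[OF gG zd]) (simp add: G_def)
  qed
  define \<rho> where "\<rho> = max r 0"
  have \<rho>: "0 \<le> \<rho>" "\<rho> < 1" "r \<le> \<rho>" using r by (auto simp: \<rho>_def)
  have \<rho>2: "\<rho>\<^sup>2 < 1" using \<rho> by (simp add: power_less_one_iff abs_square_less_1)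
  define s where "s = sinh (e / 4)"
  have s: "s > 0" using e by (simp add: s_def)
  \<comment> \<open>Chosen so that points of the disk of radius \<rho> at Euclidean distance at most
    2 \<delta> have \<open>hratio\<close> at most sinh(e/4)^2, that is, hyperbolic distance at most
    e / 2.\<close>
  define \<delta> where "\<delta> = (1 - \<rho>\<^sup>2) * s / 2"
  have \<delta>: "\<delta> > 0" using \<rho>2 s by (simp add: \<delta>_def)
  have close: "hdist z w < e" if zw: "cmod z \<le> \<rho>" "cmod w \<le> \<rho>" "cmod (z - w) \<le> 2 * \<delta>" for z w
  proof -
    have d: "z \<in> disk" "w \<in> disk" using zw \<rho> by auto
    have sq: "(cmod z)\<^sup>2 \<le> \<rho>\<^sup>2" "(cmod w)\<^sup>2 \<le> \<rho>\<^sup>2" using zw by (auto intro: power_mono)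
    have "hratio z w \<le> (2 * \<delta>)\<^sup>2 / ((1 - \<rho>\<^sup>2) * (1 - \<rho>\<^sup>2))"
      unfolding hratio_def using zw sq \<rho>2 by (intro frac_le power_mono mult_mono) auto
    also have "\<dots> = s\<^sup>2" using \<rho>2 by (simp add: \<delta>_def power2_eq_square)
    finally have "hdist z w \<le> e / 2"
      using e by (subst hdist_le_iff[OF d]) (auto simp: s_def)
    then show ?thesis using e by simp
  qed
  have "compact (cball (0::complex) \<rho>)" by simp
  then have "\<forall>\<epsilon>>0. \<exists>k. finite k \<and> cball (0::complex) \<rho> \<subseteq> (\<Union>x\<in>k. ball x \<epsilon>)"
    unfolding compact_eq_totally_bounded by (rule conjunct2)
  from this[rule_format, OF \<delta>]
  obtain C where C: "finite C" "cball (0::complex) \<rho> \<subseteq> (\<Union>x\<in>C. ball x \<delta>)" by (elim exE conjE) (rule that; assumption)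
  define \<phi> where "\<phi> g = (\<lambda>z\<in>Z. SOME c. c \<in> C \<and> g z \<in> ball c \<delta>)" for g :: "complex \<Rightarrow> complex"
  have \<phi>: "\<phi> g z \<in> C \<and> g z \<in> ball (\<phi> g z) \<delta>" if "g \<in> G" "z \<in> Z" for g z
  proof -
    have "g z \<in> cball 0 \<rho>" using gr[OF that] \<rho> by simp
    then have "\<exists>c. c \<in> C \<and> g z \<in> ball c \<delta>" using C(2) by blast
    then have "(SOME c. c \<in> C \<and> g z \<in> ball c \<delta>) \<in> C \<and> g z \<in> ball (SOME c. c \<in> C \<and> g z \<in> ball c \<delta>) \<delta>"
      by (rule someI_ex)
    then show ?thesis using that(2) by (simp add: \<phi>_def)
  qed
  have "\<phi> ` G \<subseteq> (\<Pi>\<^sub>E z\<in>Z. C)" using \<phi> by (auto simp: PiE_iff \<phi>_def)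
  moreover have "finite (\<Pi>\<^sub>E z\<in>Z. C)" using Z(1) C(1) by (intro finite_PiE) auto
  ultimately have "finite (\<phi> ` G)" by (rule finite_subset)
  moreover have "inj_on \<phi> G"
  proof (rule inj_onI)
    fix g h assume g: "g \<in> G" and h: "h \<in> G" and eq: "\<phi> g = \<phi> h"
    have gG: "g \<in> \<Gamma>" and hG: "h \<in> \<Gamma>" using g h by (auto simp: G_def)
    have "compose disk (disk_inv h) g = disk_id"
    proof (rule iso)
      show "compose disk (disk_inv h) g \<in> \<Gamma>" by (intro group_compose group_inv gG hG)
      fix z assume z: "z \<in> Z"
      then have zd: "z \<in> disk" using Z by blast
      have "dist (g z) (h z) \<le> dist (\<phi> g z) (g z) + dist (\<phi> g z) (h z)" by (metis dist_commute dist_triangle2)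
      then have "cmod (g z - h z) \<le> 2 * \<delta>"
        using \<phi>[OF g z] \<phi>[OF h z] eq by (simp add: dist_norm)
      then have "hdist (g z) (h z) < e" using gr[OF g z] gr[OF h z] \<rho> by (intro close) auto
      moreover have "hdist (disk_inv h (g z)) z = hdist (g z) (h z)"
        using group_hdist[OF group_inv[OF hG] group_disk[OF gG zd] group_disk[OF hG zd]] group_inv_left[OF hG zd]
        by simp
      ultimately have "hdist (disk_inv h (g z)) z < e" by simp
      then have "cmod (disk_inv h (g z) - z) < e"
        using cmod_diff_le_hdist[OF group_disk[OF group_inv[OF hG] group_disk[OF gG zd]] zd] by linarith
      then show "cmod (compose disk (disk_inv h) g z - z) < e" using zd by (simp only: compose_eq)
    qed
    from fun_cong[OF this, of 0] have "disk_inv h (g 0) = 0" using 0 by (simp only: compose_eq restrict_apply')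
    then have "g 0 = h 0" using group_inv_right[OF hG group_disk[OF gG 0]] by metis
    then show "g = h" by (rule group_free[OF gG hG 0])
  qed
  ultimately show ?thesis unfolding G_def by (rule finite_imageD)
qed

text \<open>A central element has bounded displacement by cocompactness, so it extends to the unit circle by the
  identity and is trivial by the maximum principle.\<close>

lemma center_trivial:
  assumes a: "a \<in> \<Gamma>" and comm: "\<And>g z. g \<in> \<Gamma> \<Longrightarrow> z \<in> disk \<Longrightarrow> a (g z) = g (a z)"
  shows "a = disk_id"
proof -
  have 0: "(0::complex) \<in> disk" by simp
  obtain K where K: "compact K" "K \<subseteq> disk" "\<And>z. z \<in> disk \<Longrightarrow> \<exists>g\<in>\<Gamma>. \<exists>k\<in>K. z = g k"
    using cocompact by metis
  obtain \<rho> where \<rho>: "0 \<le> \<rho>" "\<And>k. k \<in> K \<Longrightarrow> hdist 0 k \<le> \<rho>" using compact_disk_hdist[OF K(1,2)] by metis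
  define C where "C = 2 * \<rho> + hdist 0 (a 0)"
  have C0: "0 \<le> C" using \<rho>(1) hdist_nonneg[OF 0 group_disk[OF a 0]] by (simp add: C_def)
  have disp: "hdist z (a z) \<le> C" if z: "z \<in> disk" for z
  proof -
    obtain g k where gk: "g \<in> \<Gamma>" "k \<in> K" "z = g k" using K(3)[OF z] by blast
    have k: "k \<in> disk" using gk K by blast
    have "hdist z (a z) = hdist k (a k)"
      using comm[OF gk(1) k] group_hdist[OF gk(1) k group_disk[OF a k]] by (simp add: gk(3))
    also have "\<dots> \<le> hdist k 0 + hdist 0 (a k)" by (rule hdist_triangle[OF k 0 group_disk[OF a k]])
    also have "hdist 0 (a k) \<le> hdist 0 (a 0) + hdist (a 0) (a k)"
      by (rule hdist_triangle[OF 0 group_disk[OF a 0] group_disk[OF a k]])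
    also have "hdist (a 0) (a k) = hdist 0 k" by (rule group_hdist[OF a 0 k])
    finally show ?thesis using \<rho>(2)[OF gk(2)] hdist_commute[OF k 0] by (simp add: C_def)
  qed
  define \<sigma> where "\<sigma> = (sinh (C / 2))\<^sup>2"
  \<comment> \<open>Near the unit circle a bounded hyperbolic displacement is a small Euclidean
    one.\<close>
  have bound: "(cmod (a z - z))\<^sup>2 \<le> \<sigma> * (1 - (cmod z)\<^sup>2)" if z: "z \<in> disk" for z
  proof -
    have az: "a z \<in> disk" by (rule group_disk[OF a z])
    have s: "(cmod z)\<^sup>2 < 1" "(cmod (a z))\<^sup>2 < 1" using disk_sq z az by auto
    have "hratio z (a z) \<le> \<sigma>" using hdist_le_iff[OF z az C0] disp[OF z] by (simp add: \<sigma>_def)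
    then have "(cmod (z - a z))\<^sup>2 \<le> \<sigma> * ((1 - (cmod z)\<^sup>2) * (1 - (cmod (a z))\<^sup>2))"
      unfolding hratio_def using s by (simp add: divide_le_eq)
    also have "\<dots> \<le> \<sigma> * ((1 - (cmod z)\<^sup>2) * 1)"
      using s by (intro mult_left_mono) (auto simp: \<sigma>_def)
    finally show ?thesis by (simp add: norm_minus_commute)
  qed
  have hol: "(\<lambda>z. a z - z) holomorphic_on disk"
    using group_isometry[OF a] unfolding disk_isometry_def by (intro holomorphic_intros) auto
  have small: "cmod (a 0 - 0) \<le> \<epsilon>" if \<epsilon>: "\<epsilon> > 0" for \<epsilon>
  proof -
    have \<sigma>0: "0 \<le> \<sigma>" by (simp add: \<sigma>_def)
    have q: "0 < \<epsilon>\<^sup>2 / (\<sigma> + 1)" using \<epsilon> \<sigma>0 by (simp add: divide_pos_pos add_nonneg_pos)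
    define Y where "Y = \<epsilon>\<^sup>2 / (\<sigma> + 1)"
    \<comment> \<open>The square of the radius, halfway between 1 and max 0 (1 - Y). It is positive,
      and 1 - X is at most Y even if Y exceeds 1.\<close>
    define X where "X = max 0 (1 - Y) / 2 + 1 / 2"
    define r where "r = sqrt X"
    have "0 < Y" using q by (simp add: Y_def)
    then have X: "0 < X" "X < 1" "1 - X \<le> \<epsilon>\<^sup>2 / (\<sigma> + 1)"
      unfolding Y_def[symmetric] by (auto simp: X_def max_def field_simps)
    have r: "0 < r" "r < 1" "r\<^sup>2 = X" using X by (auto simp: r_def)
    show ?thesis
    proof (rule maximum_modulus_frontier[of "\<lambda>z. a z - z" "ball 0 r"])
      show "(\<lambda>z. a z - z) holomorphic_on interior (ball 0 r)"
        using hol r by (rule_tac holomorphic_on_subset) auto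
      show "continuous_on (closure (ball 0 r)) (\<lambda>z. a z - z)"
        using r by (intro continuous_on_subset[OF holomorphic_on_imp_continuous_on[OF hol]]) auto
      show "cmod (a z - z) \<le> \<epsilon>" if "z \<in> frontier (ball 0 r)" for z
      proof -
        have zr: "cmod z = r" using that r by (simp add: sphere_def)
        then have "(cmod (a z - z))\<^sup>2 \<le> \<sigma> * (1 - X)" using bound[of z] r by simp
        also have "\<dots> \<le> (\<sigma> + 1) * (1 - X)" using X by (intro mult_right_mono) auto
        also have "\<dots> \<le> (\<sigma> + 1) * (\<epsilon>\<^sup>2 / (\<sigma> + 1))" using X \<sigma>0 by (intro mult_left_mono) auto
        also have "\<dots> = \<epsilon>\<^sup>2" using \<sigma>0 by simp
        finally show ?thesis using \<epsilon> by (simp add: power2_le_iff_abs_le)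
      qed
    qed (use r in auto)
  qed
  have "cmod (a 0 - 0) \<le> 0" by (rule field_le_epsilon) (use small in auto)
  then have "a 0 = 0" by simp
  then show ?thesis by (rule group_fixpoint[OF a 0])
qed

text \<open>Write z = g k with k in a compact set whose translates cover the disk. The conjugates of
  the elements of \<open>S\<close> by g displace k, hence also 0, by a bounded amount, so only
  finitely many of them occur. They determine g up to the centralizer of \<open>S\<close>, which is
  trivial. So finitely many g remain, and z lies in one of finitely many bounded translates.\<close>

lemma bounded_displacement:
  assumes S: "finite S" "S \<subseteq> \<Gamma>"
    and cent: "\<And>a. a \<in> \<Gamma> \<Longrightarrow> (\<And>s z. s \<in> S \<Longrightarrow> z \<in> disk \<Longrightarrow> a (s z) = s (a z)) \<Longrightarrow> a = disk_id"
  obtains B where "\<And>z. z \<in> disk \<Longrightarrow> (\<And>s. s \<in> S \<Longrightarrow> hdist z (s z) \<le> R) \<Longrightarrow> hdist 0 z \<le> B"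
proof -
  have 0: "(0::complex) \<in> disk" by simp
  obtain K where K: "compact K" "K \<subseteq> disk" "\<And>z. z \<in> disk \<Longrightarrow> \<exists>g\<in>\<Gamma>. \<exists>k\<in>K. z = g k"
    using cocompact by metis
  obtain \<rho> where \<rho>: "0 \<le> \<rho>" "\<And>k. k \<in> K \<Longrightarrow> hdist 0 k \<le> \<rho>" using compact_disk_hdist[OF K(1,2)] by metis
  define Fin where "Fin = {g \<in> \<Gamma>. hdist 0 (g 0) \<le> R + 2 * \<rho>}"
  have Fin: "finite Fin" unfolding Fin_def by (rule finite_group_bounded)
  define G where "G = {g \<in> \<Gamma>. \<exists>k\<in>K. \<forall>s\<in>S. hdist (g k) (s (g k)) \<le> R}"
  define F where "F g = (\<lambda>s\<in>S. compose disk (disk_inv g) (compose disk s g))" for g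
  have Fv: "F g s z = disk_inv g (s (g z))" if "s \<in> S" "z \<in> disk" for g s z
    using that by (simp add: F_def compose_eq del: mem_ball_0 restrict_apply) (simp add: compose_eq del: mem_ball_0)
  have FG: "F g s \<in> Fin" if g: "g \<in> G" and s: "s \<in> S" for g s
  proof -
    have gG: "g \<in> \<Gamma>" and sG: "s \<in> \<Gamma>" using g s S by (auto simp: G_def)
    obtain k where k: "k \<in> K" "hdist (g k) (s (g k)) \<le> R" using g s by (auto simp: G_def)
    have kd: "k \<in> disk" using k K by blast
    have FsG: "F g s \<in> \<Gamma>" using s by (simp add: F_def group_compose group_inv gG sG)
    note d = group_disk[OF gG kd] group_disk[OF sG group_disk[OF gG kd]]
    have "hdist k (F g s k) = hdist (disk_inv g (g k)) (disk_inv g (s (g k)))"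
      using Fv[OF s kd] group_inv_left[OF gG kd] by simp
    also have "\<dots> \<le> R" using group_hdist[OF group_inv[OF gG] d] k(2) by simp
    finally have kR: "hdist k (F g s k) \<le> R" .
    have "hdist 0 (F g s 0) \<le> hdist 0 k + hdist k (F g s 0)"
      by (rule hdist_triangle[OF 0 kd group_disk[OF FsG 0]])
    also have "hdist k (F g s 0) \<le> hdist k (F g s k) + hdist (F g s k) (F g s 0)"
      by (rule hdist_triangle[OF kd group_disk[OF FsG kd] group_disk[OF FsG 0]])
    also have "hdist (F g s k) (F g s 0) = hdist 0 k"
      using group_hdist[OF FsG kd 0] hdist_commute[OF kd 0] by simp
    finally show ?thesis using kR \<rho>(2)[OF k(1)] FsG by (simp add: Fin_def)
  qed
  have "F ` G \<subseteq> (\<Pi>\<^sub>E s\<in>S. Fin)" using FG by (auto simp: PiE_iff F_def)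
  moreover have "finite (\<Pi>\<^sub>E s\<in>S. Fin)" using S(1) Fin by (intro finite_PiE) auto
  ultimately have "finite (F ` G)" by (rule finite_subset)
  moreover have "inj_on F G"
  proof (rule inj_onI)
    fix g h assume g: "g \<in> G" and h: "h \<in> G" and eq: "F g = F h"
    have gG: "g \<in> \<Gamma>" and hG: "h \<in> \<Gamma>" using g h by (auto simp: G_def)
    \<comment> \<open>If g and h give the same conjugates of every s, then the inverse of h followed
      by g commutes with \<open>S\<close>.\<close>
    define a where "a = compose disk g (disk_inv h)"
    have aG: "a \<in> \<Gamma>" unfolding a_def by (intro group_compose group_inv gG hG)
    have av: "a z = g (disk_inv h z)" if "z \<in> disk" for z using that unfolding a_def by (simp only: compose_eq)
    have "a = disk_id"
    proof (rule cent[OF aG])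
      fix s z assume s: "s \<in> S" and z: "z \<in> disk"
      have sG: "s \<in> \<Gamma>" using s S by blast
      define w where "w = disk_inv h z"
      have w: "w \<in> disk" unfolding w_def by (rule group_disk[OF group_inv[OF hG] z])
      have hw: "h w = z" unfolding w_def by (rule group_inv_right[OF hG z])
      have "disk_inv g (s (g w)) = disk_inv h (s z)"
        using fun_cong[OF fun_cong[OF eq, of s], of w] Fv[OF s w, of g] Fv[OF s w, of h] by (simp only: hw)
      then have "g (disk_inv g (s (g w))) = g (disk_inv h (s z))" by simp
      then have "s (g w) = a (s z)"
        using group_inv_right[OF gG group_disk[OF sG group_disk[OF gG w]]] av[OF group_disk[OF sG z]] by simp
      then show "a (s z) = s (a z)" using av[OF z] by (simp add: w_def)
    qed
    then have "g (disk_inv h (h 0)) = h 0"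
      using av[OF group_disk[OF hG 0]] group_disk[OF hG 0] by simp
    then have "g 0 = h 0" using group_inv_left[OF hG 0] by simp
    then show "g = h" by (rule group_free[OF gG hG 0])
  qed
  ultimately have finG: "finite G" by (rule finite_imageD)
  show ?thesis
  proof (rule that[of "(\<Sum>g\<in>G. hdist 0 (g 0)) + \<rho>"])
    fix z assume z: "z \<in> disk" and le: "\<And>s. s \<in> S \<Longrightarrow> hdist z (s z) \<le> R"
    obtain g k where gk: "g \<in> \<Gamma>" "k \<in> K" "z = g k" using K(3)[OF z] by blast
    have g: "g \<in> G" using gk le by (auto simp: G_def)
    have k: "k \<in> disk" using gk K by blast
    have "hdist 0 z \<le> hdist 0 (g 0) + hdist (g 0) (g k)"
      using hdist_triangle[OF 0 group_disk[OF gk(1) 0] z] by (simp add: gk(3))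
    also have "hdist (g 0) (g k) = hdist 0 k" by (rule group_hdist[OF gk(1) 0 k])
    also have "hdist 0 (g 0) \<le> (\<Sum>g\<in>G. hdist 0 (g 0))"
      using g finG hdist_nonneg[OF 0 group_disk[OF _ 0]] by (intro member_le_sum) (auto simp: G_def)
    finally show "hdist 0 z \<le> (\<Sum>g\<in>G. hdist 0 (g 0)) + \<rho>" using \<rho>(2)[OF gk(2)] by simp
  qed
qed

end

subsection \<open>The universal covering of a triangulated surface\<close>

lemma vertex_component: "vertex i $ j = (if j = i then 1 else 0)"
  by (simp add: vertex_def axis_def)

text \<open>Barycentric coordinates make it evident that two cells meet exactly in the cell of their
  common vertices, which is needed to compare lifted simplices.\<close>

lemma cell_eq:
  "cell \<sigma> = {x :: real ^ 'v::finite. (\<forall>i. 0 \<le> x $ i) \<and> (\<Sum>i\<in>UNIV. x $ i) = 1 \<and> (\<forall>i. i \<notin> \<sigma> \<longrightarrow> x $ i = 0)}"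
  (is "_ = ?R")
proof
  have "convex ?R"
  proof (rule convexI)
    fix x y :: "real ^ 'v" and u v :: real
    assume *: "x \<in> ?R" "y \<in> ?R" "0 \<le> u" "0 \<le> v" "u + v = 1"
    have "(\<Sum>i\<in>UNIV. (u *\<^sub>R x + v *\<^sub>R y) $ i) = u * (\<Sum>i\<in>UNIV. x $ i) + v * (\<Sum>i\<in>UNIV. y $ i)"
      by (simp add: sum.distrib sum_distrib_left)
    then show "u *\<^sub>R x + v *\<^sub>R y \<in> ?R" using * by auto
  qed
  moreover have "vertex ` \<sigma> \<subseteq> ?R" by (auto simp: vertex_component)
  ultimately show "cell \<sigma> \<subseteq> ?R" unfolding cell_def by (rule hull_minimal[rotated])
  show "?R \<subseteq> cell \<sigma>"
  proof
    fix x :: "real ^ 'v" assume x: "x \<in> ?R"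
    have "(\<Sum>i\<in>\<sigma>. x $ i *\<^sub>R vertex i) \<in> cell \<sigma>"
      unfolding cell_def
    proof (rule convex_sum)
      have "(\<Sum>i\<in>\<sigma>. x $ i) = (\<Sum>i\<in>UNIV. x $ i)" using x by (intro sum.mono_neutral_left) auto
      then show "(\<Sum>i\<in>\<sigma>. x $ i) = 1" using x by simp
    qed (use x in \<open>auto intro: hull_inc\<close>)
    moreover have "(\<Sum>i\<in>\<sigma>. x $ i *\<^sub>R vertex i) = x"
    proof -
      have "(\<Sum>i\<in>\<sigma>. x $ i *\<^sub>R vertex i) $ j = x $ j" for j
      proof -
        have "(\<Sum>i\<in>\<sigma>. x $ i *\<^sub>R vertex i) $ j = (\<Sum>i\<in>\<sigma>. if i = j then x $ i else 0)"
          unfolding sum_component by (intro sum.cong) (auto simp: vertex_component)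
        then show ?thesis using x by (simp add: sum.delta)
      qed
      then show ?thesis by (simp add: vec_eq_iff)
    qed
    ultimately show "x \<in> cell \<sigma>" by simp
  qed
qed

lemma cell_Int: "cell \<sigma> \<inter> cell \<sigma>' = cell (\<sigma> \<inter> \<sigma>')"
  unfolding cell_eq by auto

lemma cell_empty: "cell {} = {}"
  by (simp add: cell_def)

lemma cell_mono: "\<sigma> \<subseteq> \<sigma>' \<Longrightarrow> cell \<sigma> \<subseteq> cell \<sigma>'"
  unfolding cell_eq by auto

lemma vertex_in_cell: "i \<in> \<sigma> \<Longrightarrow> vertex i \<in> cell \<sigma>"
  unfolding cell_def by (auto intro: hull_inc)

lemma convex_cell: "convex (cell \<sigma>)"
  unfolding cell_def by (rule convex_convex_hull)

lemma compact_cell: "compact (cell \<sigma>)"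
  unfolding cell_def by (intro finite_imp_compact_convex_hull) simp

locale covered_surface = surface_group +
  fixes X :: "(real ^ 'v::finite) set" and \<phi> :: "real ^ 'v \<Rightarrow> complex set"
  assumes homeo: "homeomorphic_map (top_of_set X) (surface \<Gamma>) \<phi>"
begin

text \<open>The projection from the disk with the quotient surface replaced, through
  \<open>\<phi>\<close>, by the Euclidean set X. This makes it a map between subsets of the plane
  and of a Euclidean space, to which covering theory applies.\<close>

definition cov :: "complex \<Rightarrow> real ^ 'v"
  where "cov z = inv_into X \<phi> (surface_proj \<Gamma> z)"

lemma inj_phi: "inj_on \<phi> X"
  using homeo homeomorphic_imp_injective_map by fastforce

lemma image_phi: "\<phi> ` X = surface_proj \<Gamma> ` disk"
  using homeomorphic_imp_surjective_map[OF homeo] by (simp add: topspace_surface)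

lemma phi_cov: "z \<in> disk \<Longrightarrow> \<phi> (cov z) = surface_proj \<Gamma> z"
  unfolding cov_def using image_phi by (intro f_inv_into_f) blast

lemma cov_in: "z \<in> disk \<Longrightarrow> cov z \<in> X"
  unfolding cov_def using image_phi by (intro inv_into_into) blast

lemma cov_eqI: "x \<in> X \<Longrightarrow> surface_proj \<Gamma> z = \<phi> x \<Longrightarrow> cov z = x"
  unfolding cov_def using inj_phi by simp

lemma cov_image: "cov ` disk = X"
proof
  show "cov ` disk \<subseteq> X" using cov_in by blast
  show "X \<subseteq> cov ` disk"
  proof
    fix x assume x: "x \<in> X"
    then obtain z where "z \<in> disk" "\<phi> x = surface_proj \<Gamma> z" using image_phi by blast
    then show "x \<in> cov ` disk" using cov_eqI[OF x] by (metis imageI)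
  qed
qed

lemma surface_proj_group:
  assumes g: "g \<in> \<Gamma>" and z: "z \<in> disk"
  shows "surface_proj \<Gamma> (g z) = surface_proj \<Gamma> z"
  unfolding surface_proj_def
proof (intro subset_antisym image_subsetI)
  fix h assume h: "h \<in> \<Gamma>"
  have "h (g z) = compose disk h g z" by (rule compose_eq[OF z, symmetric])
  then show "h (g z) \<in> (\<lambda>g. g z) ` \<Gamma>" using group_compose[OF h g] by (rule image_eqI)
  have "h z = compose disk h (disk_inv g) (g z)"
    using compose_eq[OF group_disk[OF g z], of h "disk_inv g"] group_inv_left[OF g z] by simp
  then show "h z \<in> (\<lambda>h. h (g z)) ` \<Gamma>" using group_compose[OF h group_inv[OF g]] by (rule image_eqI)
qed

lemma cov_group: "g \<in> \<Gamma> \<Longrightarrow> z \<in> disk \<Longrightarrow> cov (g z) = cov z"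
  unfolding cov_def by (simp only: surface_proj_group)

lemma cov_eq_iff:
  assumes z: "z \<in> disk" and w: "w \<in> disk"
  shows "cov z = cov w \<longleftrightarrow> (\<exists>g\<in>\<Gamma>. z = g w)"
proof
  assume "cov z = cov w"
  then have "surface_proj \<Gamma> z = surface_proj \<Gamma> w" using phi_cov z w by metis
  moreover have "disk_id z \<in> surface_proj \<Gamma> z" unfolding surface_proj_def using group_id by (rule imageI)
  ultimately have "z \<in> surface_proj \<Gamma> w" using z by (simp only: restrict_apply')
  then show "\<exists>g\<in>\<Gamma>. z = g w" unfolding surface_proj_def by blast
next
  assume "\<exists>g\<in>\<Gamma>. z = g w"
  then show "cov z = cov w" using cov_group w by blast
qed

lemma is_lift_iff:
  assumes "S \<subseteq> X"
  shows "is_lift \<Gamma> S \<phi> q \<longleftrightarrow> continuous_on S q \<and> q ` S \<subseteq> disk \<and> (\<forall>s\<in>S. cov (q s) = s)"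
proof -
  have "surface_proj \<Gamma> (q s) = \<phi> s \<longleftrightarrow> cov (q s) = s" if "q s \<in> disk" "s \<in> S" for s
    using cov_eqI[of s "q s"] phi_cov[OF that(1)] that(2) assms by auto
  then show ?thesis unfolding is_lift_def by blast
qed

lemma continuous_on_cov: "continuous_on disk cov"
proof -
  have "continuous_map (top_of_set disk) (surface \<Gamma>) (surface_proj \<Gamma>)"
    by (rule quotient_imp_continuous_map[OF quotient_map_proj])
  moreover have "continuous_map (surface \<Gamma>) (top_of_set X) (inv_into X \<phi>)"
  proof -
    obtain \<psi> where \<psi>: "homeomorphic_maps (top_of_set X) (surface \<Gamma>) \<phi> \<psi>"
      using homeo homeomorphic_map_maps by blast
    then have "continuous_map (surface \<Gamma>) (top_of_set X) \<psi>" by (simp add: homeomorphic_maps_def)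
    moreover have "inv_into X \<phi> y = \<psi> y" if "y \<in> topspace (surface \<Gamma>)" for y
    proof -
      have "\<psi> y \<in> X" "\<phi> (\<psi> y) = y"
        using \<psi> that by (auto simp: homeomorphic_maps_def continuous_map_def)
      then show ?thesis using inj_phi by (metis inv_into_f_f)
    qed
    ultimately show ?thesis using continuous_map_eq[of _ _ \<psi> "inv_into X \<phi>"] by metis
  qed
  ultimately have "continuous_map (top_of_set disk) (top_of_set X) (inv_into X \<phi> \<circ> surface_proj \<Gamma>)"
    by (rule continuous_map_compose)
  moreover have "inv_into X \<phi> \<circ> surface_proj \<Gamma> = cov" by (simp add: fun_eq_iff cov_def)
  ultimately show ?thesis by (simp add: continuous_map_in_subtopology)
qed

lemma open_group_image:
  assumes g: "g \<in> \<Gamma>" and U: "open U" "U \<subseteq> disk"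
  shows "open (g ` U)"
proof -
  have "continuous_on disk (disk_inv g)"
    using group_isometry[OF group_inv[OF g]] unfolding disk_isometry_def by (blast intro: holomorphic_on_imp_continuous_on)
  then have "open (disk \<inter> disk_inv g -` U)" by (rule continuous_open_preimage) (use U in auto)
  moreover have "g ` U = disk \<inter> disk_inv g -` U"
  proof (intro subset_antisym subsetI)
    fix w assume "w \<in> g ` U"
    then obtain z where z: "z \<in> U" "w = g z" by blast
    then have zd: "z \<in> disk" using U by blast
    then show "w \<in> disk \<inter> disk_inv g -` U"
      using z group_disk[OF g zd] group_inv_left[OF g zd] by (simp del: mem_ball_0 restrict_apply)
  next
    fix w assume w: "w \<in> disk \<inter> disk_inv g -` U"
    then have "w = g (disk_inv g w)" using group_inv_right[OF g, of w] by simp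
    then show "w \<in> g ` U" using w by (intro image_eqI) auto
  qed
  ultimately show ?thesis by simp
qed

text \<open>The points of the disk that project into the image of U form the union of the translates
  of U, which is open.\<close>

lemma open_cov_image:
  assumes U: "open U" "U \<subseteq> disk"
  shows "openin (top_of_set X) (cov ` U)"
proof -
  have "{z \<in> disk. surface_proj \<Gamma> z \<in> surface_proj \<Gamma> ` U} = (\<Union>g\<in>\<Gamma>. g ` U)"
  proof (intro subset_antisym subsetI)
    fix z assume z: "z \<in> {z \<in> disk. surface_proj \<Gamma> z \<in> surface_proj \<Gamma> ` U}"
    then obtain w where w: "w \<in> U" "surface_proj \<Gamma> z = surface_proj \<Gamma> w" by blast
    then have "cov z = cov w" by (simp add: cov_def)
    then obtain g where "g \<in> \<Gamma>" "z = g w" using cov_eq_iff[of z w] z w U by blast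
    then show "z \<in> (\<Union>g\<in>\<Gamma>. g ` U)" using w by blast
  next
    fix z assume "z \<in> (\<Union>g\<in>\<Gamma>. g ` U)"
    then obtain g w where gw: "g \<in> \<Gamma>" "w \<in> U" "z = g w" by blast
    then have "w \<in> disk" using U by blast
    then show "z \<in> {z \<in> disk. surface_proj \<Gamma> z \<in> surface_proj \<Gamma> ` U}"
      using gw group_disk[OF gw(1)] surface_proj_group[OF gw(1)] by blast
  qed
  moreover have "open (\<Union>g\<in>\<Gamma>. g ` U)" using open_group_image U by blast
  ultimately have "openin (surface \<Gamma>) (surface_proj \<Gamma> ` U)"
    unfolding openin_surface using U by (simp add: image_mono)
  then have "openin (top_of_set X) {x \<in> topspace (top_of_set X). \<phi> x \<in> surface_proj \<Gamma> ` U}"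
    using homeomorphic_imp_continuous_map[OF homeo] by (rule openin_continuous_map_preimage[rotated])
  moreover have "{x \<in> topspace (top_of_set X). \<phi> x \<in> surface_proj \<Gamma> ` U} = cov ` U"
  proof (intro subset_antisym subsetI)
    fix x assume "x \<in> {x \<in> topspace (top_of_set X). \<phi> x \<in> surface_proj \<Gamma> ` U}"
    then obtain z where "x \<in> X" "z \<in> U" "\<phi> x = surface_proj \<Gamma> z" by auto
    then show "x \<in> cov ` U" using cov_eqI by (metis imageI)
  next
    fix x assume "x \<in> cov ` U"
    then obtain z where z: "z \<in> U" "x = cov z" by blast
    then have "z \<in> disk" using U by blast
    then show "x \<in> {x \<in> topspace (top_of_set X). \<phi> x \<in> surface_proj \<Gamma> ` U}"
      using z cov_in phi_cov by auto
  qed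
  ultimately show ?thesis by simp
qed

text \<open>If w and g w are both within d / 2 of the center, then g moves the center by less than
  d. Elements with so small a displacement form a finite set, and d is at most the least
  displacement among the nontrivial ones, since these have no fixed point.\<close>

lemma wandering_neighborhood:
  assumes z0: "z\<^sub>0 \<in> disk"
  obtains U where "open U" "U \<subseteq> disk" "z\<^sub>0 \<in> U"
    "\<And>g w. g \<in> \<Gamma> \<Longrightarrow> w \<in> U \<Longrightarrow> g w \<in> U \<Longrightarrow> g = disk_id"
proof -
  have 0: "(0::complex) \<in> disk" by simp
  define F where "F = {g \<in> \<Gamma>. hdist 0 (g 0) \<le> 2 * hdist 0 z\<^sub>0 + 1} - {disk_id}"
  have F: "finite F" unfolding F_def using finite_group_bounded by blast
  \<comment> \<open>Inserting 1 makes the minimum meaningful for empty \<open>F\<close> and ensures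
    d <= 1, the allowance made in the bound that defines \<open>F\<close>.\<close>
  define d where "d = Min (insert 1 ((\<lambda>g. hdist z\<^sub>0 (g z\<^sub>0)) ` F))"
  have pos: "hdist z\<^sub>0 (g z\<^sub>0) > 0" if "g \<in> F" for g
  proof -
    have g: "g \<in> \<Gamma>" "g \<noteq> disk_id" using that by (auto simp: F_def)
    then have "z\<^sub>0 \<noteq> g z\<^sub>0" using group_fixpoint[OF g(1) z0] by metis
    then show ?thesis
      using hdist_nonneg[OF z0 group_disk[OF g(1) z0]] hdist_eq_0_iff[OF z0 group_disk[OF g(1) z0]] by linarith
  qed
  have d: "0 < d" "d \<le> 1" "\<And>g. g \<in> F \<Longrightarrow> d \<le> hdist z\<^sub>0 (g z\<^sub>0)" using F pos by (auto simp: d_def)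
  define U where "U = disk \<inter> hdist z\<^sub>0 -` {..<d / 2}"
  show ?thesis
  proof (rule that)
    show "open U" unfolding U_def by (rule continuous_open_preimage[OF continuous_on_hdist[OF z0]]) auto
    show "U \<subseteq> disk" by (auto simp: U_def)
    show "z\<^sub>0 \<in> U" using z0 d(1) by (simp add: U_def)
    fix g w assume g: "g \<in> \<Gamma>" and w: "w \<in> U" "g w \<in> U"
    have wd: "w \<in> disk" using w by (simp add: U_def)
    note gd = group_disk[OF g]
    have "hdist z\<^sub>0 (g z\<^sub>0) \<le> hdist z\<^sub>0 (g w) + hdist (g w) (g z\<^sub>0)"
      by (rule hdist_triangle[OF z0 gd[OF wd] gd[OF z0]])
    also have "hdist (g w) (g z\<^sub>0) = hdist z\<^sub>0 w"
      using group_hdist[OF g wd z0] hdist_commute[OF wd z0] by simp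
    finally have lt: "hdist z\<^sub>0 (g z\<^sub>0) < d" using w by (simp add: U_def)
    have "hdist 0 (g 0) \<le> hdist 0 z\<^sub>0 + hdist z\<^sub>0 (g 0)" by (rule hdist_triangle[OF 0 z0 gd[OF 0]])
    also have "hdist z\<^sub>0 (g 0) \<le> hdist z\<^sub>0 (g z\<^sub>0) + hdist (g z\<^sub>0) (g 0)"
      by (rule hdist_triangle[OF z0 gd[OF z0] gd[OF 0]])
    also have "hdist (g z\<^sub>0) (g 0) = hdist 0 z\<^sub>0"
      using group_hdist[OF g z0 0] hdist_commute[OF z0 0] by simp
    finally have "hdist 0 (g 0) \<le> 2 * hdist 0 z\<^sub>0 + 1" using lt d(2) by simp
    then show "g = disk_id" using d(3)[of g] lt g by (force simp: F_def)
  qed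
qed

text \<open>Images of wandering neighborhoods are evenly covered: the translates of such a
  neighborhood by distinct elements are disjoint, and \<open>cov\<close> is injective and open on
  each of them.\<close>

lemma covering: "covering_space disk cov X"
proof (rule covering_spaceI[OF continuous_on_cov cov_image])
  fix x assume "x \<in> X"
  then obtain z0 where z0: "z0 \<in> disk" "x = cov z0" using cov_image by blast
  obtain U where U: "open U" "U \<subseteq> disk" "z0 \<in> U"
      and wand: "\<And>g w. g \<in> \<Gamma> \<Longrightarrow> w \<in> U \<Longrightarrow> g w \<in> U \<Longrightarrow> g = disk_id"
    using wandering_neighborhood[OF z0(1)] by metis
  have T: "openin (top_of_set X) (cov ` U)" by (rule open_cov_image[OF U(1,2)])
  have meet: "g = h" if gh: "g \<in> \<Gamma>" "h \<in> \<Gamma>" and w: "w \<in> U" "w' \<in> U" "g w = h w'" for g h w w'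
  proof -
    have wd: "w \<in> disk" "w' \<in> disk" using w U by auto
    have k: "compose disk (disk_inv h) g \<in> \<Gamma>" using group_compose group_inv gh by blast
    have "compose disk (disk_inv h) g w = w'"
      using group_inv_left[OF gh(2) wd(2)] w(3) by (simp only: compose_eq wd)
    then have "compose disk (disk_inv h) g = disk_id" using wand[OF k w(1)] w(2) by simp
    then have "w' = w"
      using \<open>compose disk (disk_inv h) g w = w'\<close> wd by (simp only: restrict_apply')
    then show ?thesis using group_free[OF gh wd(1)] w(3) by simp
  qed
  have sheet: "\<exists>q. homeomorphism (g ` U) (cov ` U) cov q" if g: "g \<in> \<Gamma>" for g
  proof -
    have gU: "open (g ` U)" "g ` U \<subseteq> disk" using open_group_image[OF g U(1,2)] group_disk[OF g] U(2) by auto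
    have im: "cov ` (g ` U) = cov ` U"
      unfolding image_image using cov_group[OF g] U(2) by (intro image_cong) auto
    have inj: "inj_on cov (g ` U)"
    proof (rule inj_onI, clarify)
      fix w w' assume w: "w \<in> U" "w' \<in> U" and eq: "cov (g w) = cov (g w')"
      have wd: "w \<in> disk" "w' \<in> disk" using w U by auto
      obtain k where k: "k \<in> \<Gamma>" "g w = k (g w')"
        using eq cov_eq_iff[OF group_disk[OF g wd(1)] group_disk[OF g wd(2)]] by blast
      then have "g w = compose disk k g w'" by (simp only: compose_eq wd)
      then have "g = compose disk k g" using meet[OF g group_compose[OF k(1) g] w] by blast
      then show "g w = g w'" using \<open>g w = compose disk k g w'\<close> by metis
    qed
    have op: "openin (top_of_set (cov ` U)) (cov ` V)" if V: "openin (top_of_set (g ` U)) V" for V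
    proof -
      have "open V" "V \<subseteq> g ` U" using V gU(1) by (auto simp: openin_open_eq)
      then have "openin (top_of_set X) (cov ` V)" using gU(2) by (intro open_cov_image) auto
      moreover have "cov ` V \<subseteq> cov ` U" using \<open>V \<subseteq> g ` U\<close> im by blast
      ultimately show ?thesis
        using T by (meson openin_imp_subset openin_subset_trans)
    qed
    show ?thesis
      using homeomorphism_injective_open_map[OF continuous_on_subset[OF continuous_on_cov gU(2)] im inj op] by blast
  qed
  show "\<exists>T. x \<in> T \<and> openin (top_of_set X) T \<and>
      (\<exists>v. \<Union>v = disk \<inter> cov -` T \<and> (\<forall>u\<in>v. openin (top_of_set disk) u) \<and>
        pairwise disjnt v \<and> (\<forall>u\<in>v. \<exists>q. homeomorphism u T cov q))"
  proof (intro exI[of _ "cov ` U"] exI[of _ "(\<lambda>g. g ` U) ` \<Gamma>"] conjI)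
    show "x \<in> cov ` U" using U(3) z0(2) by blast
    show "openin (top_of_set X) (cov ` U)" by (rule T)
    show "\<Union> ((\<lambda>g. g ` U) ` \<Gamma>) = disk \<inter> cov -` (cov ` U)"
    proof (intro subset_antisym subsetI)
      fix z assume "z \<in> \<Union> ((\<lambda>g. g ` U) ` \<Gamma>)"
      then obtain g w where gw: "g \<in> \<Gamma>" "w \<in> U" "z = g w" by blast
      then have "w \<in> disk" using U by blast
      then show "z \<in> disk \<inter> cov -` (cov ` U)" using gw group_disk[OF gw(1)] cov_group[OF gw(1)] by blast
    next
      fix z assume z: "z \<in> disk \<inter> cov -` (cov ` U)"
      then obtain w where w: "w \<in> U" "cov z = cov w" by blast
      then obtain g where "g \<in> \<Gamma>" "z = g w" using cov_eq_iff[of z w] z U by blast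
      then show "z \<in> \<Union> ((\<lambda>g. g ` U) ` \<Gamma>)" using w by blast
    qed
    show "\<forall>u\<in>(\<lambda>g. g ` U) ` \<Gamma>. openin (top_of_set disk) u"
    proof clarify
      fix g assume g: "g \<in> \<Gamma>"
      have "open (g ` U)" "g ` U \<subseteq> disk" using open_group_image[OF g U(1,2)] group_disk[OF g] U(2) by auto
      then show "openin (top_of_set disk) (g ` U)" by (subst openin_open_eq) auto
    qed
    show "pairwise disjnt ((\<lambda>g. g ` U) ` \<Gamma>)"
      unfolding pairwise_image by (auto simp: pairwise_def disjnt_iff dest: meet)
    show "\<forall>u\<in>(\<lambda>g. g ` U) ` \<Gamma>. \<exists>q. homeomorphism u (cov ` U) cov q" using sheet by blast
  qed
qed

text \<open>Seen through \<open>cov\<close>, a lift of \<open>\<phi>\<close> is a lift of the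
  inclusion of S into X, the form in which the lifting theorems are applied.\<close>

definition lifting :: "(real ^ 'v) set \<Rightarrow> (real ^ 'v \<Rightarrow> complex) \<Rightarrow> bool"
  where "lifting S q \<longleftrightarrow> continuous_on S q \<and> q ` S \<subseteq> disk \<and> (\<forall>s\<in>S. cov (q s) = s)"

lemma lifting_in_X: "lifting S q \<Longrightarrow> S \<subseteq> X"
  unfolding lifting_def using cov_in by (metis image_subset_iff subsetI)

lemma lifting_subset: "lifting S q \<Longrightarrow> S' \<subseteq> S \<Longrightarrow> lifting S' q"
  unfolding lifting_def using continuous_on_subset by blast

lemma lifting_disk: "lifting S q \<Longrightarrow> s \<in> S \<Longrightarrow> q s \<in> disk"
  unfolding lifting_def by blast

lemma lifting_cov: "lifting S q \<Longrightarrow> s \<in> S \<Longrightarrow> cov (q s) = s"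
  unfolding lifting_def by blast

lemma lifting_unique:
  assumes "lifting S q" "lifting S q'" "connected S" "a \<in> S" "q a = q' a" "s \<in> S"
  shows "q s = q' s"
proof (rule covering_space_lift_unique[where ?g1.0 = q and ?g2.0 = q' and f = "\<lambda>s. s" and T = S
      and a = a and c = disk and p = cov and S = X])
  show "(\<lambda>s. s) \<in> S \<rightarrow> X" using lifting_in_X[OF assms(1)] by blast
  show "covering_space disk cov X" by (rule covering)
qed (use assms in \<open>auto simp: lifting_def\<close>)

lemma lifting_group:
  assumes q: "lifting S q" and g: "g \<in> \<Gamma>"
  shows "lifting S (\<lambda>s. g (q s))"
proof -
  have "continuous_on disk g"
    using group_isometry[OF g] unfolding disk_isometry_def by (blast intro: holomorphic_on_imp_continuous_on)
  then have "continuous_on S (\<lambda>s. g (q s))"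
    by (rule continuous_on_compose2) (use q in \<open>auto simp: lifting_def\<close>)
  moreover have "g (q s) \<in> disk" "cov (g (q s)) = s" if "s \<in> S" for s
    using group_disk[OF g lifting_disk[OF q that]] cov_group[OF g lifting_disk[OF q that]] lifting_cov[OF q that] by auto
  ultimately show ?thesis unfolding lifting_def by blast
qed

text \<open>A convex set is simply connected, so some lift exists; a deck transformation then moves
  it to the prescribed value.\<close>

lemma lifting_exists:
  assumes S: "convex S" "S \<subseteq> X" and a: "a \<in> S" and z: "z \<in> disk" "cov z = a"
  obtains q where "lifting S q" "q a = z"
proof -
  have id: "(\<lambda>s. s) \<in> S \<rightarrow> X" using S(2) by blast
  obtain q where q: "continuous_on S q" "q \<in> S \<rightarrow> disk" "\<And>s. s \<in> S \<Longrightarrow> cov (q s) = s"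
    using covering_space_lift[OF covering convex_imp_simply_connected[OF S(1)]
        convex_imp_locally_path_connected[OF S(1)] continuous_on_id id] by metis
  then have l: "lifting S q" unfolding lifting_def by blast
  have "cov z = cov (q a)" using q(3)[OF a] z by simp
  then obtain g where "g \<in> \<Gamma>" "z = g (q a)" using cov_eq_iff[OF z(1) lifting_disk[OF l a]] by blast
  then show ?thesis using that[OF lifting_group[OF l]] by simp
qed

end

section \<open>Edge elements of a triangulated surface and properness of the energy\<close>

locale triangulated_target = covered_surface \<Gamma> "carrier_2 E F" \<phi>
  for \<Gamma> and E F :: "'v::finite set set" and \<phi> +
  fixes T :: "'v set set" and q :: "real ^ 'v \<Rightarrow> complex"
  assumes card_edge: "e \<in> E \<Longrightarrow> card e = 2" and card_face: "f \<in> F \<Longrightarrow> card f = 3"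
    and face_edge: "f \<in> F \<Longrightarrow> e \<subseteq> f \<Longrightarrow> card e = 2 \<Longrightarrow> e \<in> E"
    and tree: "spanning_tree E T"
    and lift: "is_lift \<Gamma> (carrier_1 T) \<phi> q"
begin

abbreviation \<gamma> :: "'v \<Rightarrow> 'v \<Rightarrow> complex \<Rightarrow> complex"
  where "\<gamma> \<equiv> edge_element \<Gamma> \<phi> q"

abbreviation base :: "'v \<Rightarrow> complex"
  where "base i \<equiv> q (vertex i)"

lemma cell_subset_carrier: "e \<in> E \<Longrightarrow> cell e \<subseteq> carrier_2 E F" "f \<in> F \<Longrightarrow> cell f \<subseteq> carrier_2 E F"
  by (auto simp: carrier_2_def carrier_1_def)

lemma lifting_tree: "lifting (carrier_1 T) q"
proof -
  have "carrier_1 T \<subseteq> carrier_2 E F"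
    using tree by (auto simp: spanning_tree_def carrier_1_def carrier_2_def)
  then show ?thesis using lift is_lift_iff unfolding lifting_def by blast
qed

lemma base_disk: "base i \<in> disk"
  by (rule lifting_disk[OF lifting_tree]) (simp add: carrier_1_def)

lemma cov_base: "cov (base i) = vertex i"
  by (rule lifting_cov[OF lifting_tree]) (simp add: carrier_1_def)

lemma lifting_edge_iff:
  "{i, j} \<in> E \<Longrightarrow> is_lift \<Gamma> (cell {i, j}) \<phi> p \<longleftrightarrow> lifting (cell {i, j}) p"
  using is_lift_iff[OF cell_subset_carrier(1)] unfolding lifting_def by blast

text \<open>The lift of the edge is determined by its starting point, and freeness of the action
  recovers the group element from the endpoint. Thus the description in \<open>edge_element\<close>
  is definite.\<close>

lemma edge_element_unique:
  assumes e: "{i, j} \<in> E"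
    and g: "g \<in> \<Gamma>" "lifting (cell {i, j}) p" "p (vertex i) = base i" "p (vertex j) = g (base j)"
    and g': "g' \<in> \<Gamma>" "lifting (cell {i, j}) p'" "p' (vertex i) = base i" "p' (vertex j) = g' (base j)"
  shows "g = g'"
proof -
  have "p (vertex j) = p' (vertex j)"
  proof (rule lifting_unique[OF g(2) g'(2) convex_connected[OF convex_cell]])
    show "vertex i \<in> cell {i, j}" "vertex j \<in> cell {i, j}" by (simp_all add: vertex_in_cell)
    show "p (vertex i) = p' (vertex i)" using g(3) g'(3) by simp
  qed
  then show ?thesis using g g' group_free[OF g(1) g'(1) base_disk[of j]] by simp
qed

lemma edge_element_eqI:
  assumes "{i, j} \<in> E" "g \<in> \<Gamma>" "lifting (cell {i, j}) p" "p (vertex i) = base i" "p (vertex j) = g (base j)"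
  shows "\<gamma> i j = g"
  unfolding edge_element_def lifting_edge_iff[OF assms(1)]
proof (rule the_equality)
  show "g \<in> \<Gamma> \<and> (\<exists>p. lifting (cell {i, j}) p \<and> p (vertex i) = base i \<and> p (vertex j) = g (base j))"
    using assms by (intro conjI exI[of _ p])
  fix g' assume "g' \<in> \<Gamma> \<and> (\<exists>p. lifting (cell {i, j}) p \<and> p (vertex i) = base i \<and> p (vertex j) = g' (base j))"
  then show "g' = g"
    by (elim conjE exE) (rule edge_element_unique[OF assms(1) _ _ _ _ assms(2-5)])
qed

lemma edge_element_lifting:
  assumes e: "{i, j} \<in> E"
  obtains p where "\<gamma> i j \<in> \<Gamma>" "lifting (cell {i, j}) p" "p (vertex i) = base i" "p (vertex j) = \<gamma> i j (base j)"
proof -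
  obtain p where p: "lifting (cell {i, j}) p" "p (vertex i) = base i"
    using lifting_exists[OF convex_cell cell_subset_carrier(1)[OF e] vertex_in_cell base_disk cov_base] by blast
  have j: "vertex j \<in> cell {i, j}" by (rule vertex_in_cell) simp
  have "cov (p (vertex j)) = cov (base j)" using lifting_cov[OF p(1) j] cov_base by simp
  then obtain g where g: "g \<in> \<Gamma>" "p (vertex j) = g (base j)"
    using cov_eq_iff[OF lifting_disk[OF p(1) j] base_disk] by blast
  then show ?thesis using that[OF _ p] edge_element_eqI[OF e g(1) p g(2)] by simp
qed

lemma edge_element_in: "{i, j} \<in> E \<Longrightarrow> \<gamma> i j \<in> \<Gamma>"
  using edge_element_lifting by metis

lemma edge_element_tree:
  assumes e: "{i, j} \<in> T"
  shows "\<gamma> i j = disk_id"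
proof (rule edge_element_eqI[OF _ group_id])
  show "{i, j} \<in> E" using e tree by (auto simp: spanning_tree_def)
  show "lifting (cell {i, j}) q"
    by (rule lifting_subset[OF lifting_tree]) (use e in \<open>auto simp: carrier_1_def\<close>)
  show "base j = disk_id (base j)" using base_disk by (simp only: restrict_apply')
qed simp

text \<open>The lifted simplices whose group element lies in \<open>H\<close> and those whose group element does not
  lie in \<open>H\<close> form a partition of the disk into two closed sets.\<close>

lemma edge_elements_generate:
  assumes H: "H \<subseteq> \<Gamma>" "disk_id \<in> H" "\<And>g h. g \<in> H \<Longrightarrow> h \<in> H \<Longrightarrow> compose disk g h \<in> H"
      "\<And>g. g \<in> H \<Longrightarrow> disk_inv g \<in> H"
    and edges: "\<And>i j. {i, j} \<in> E \<Longrightarrow> \<gamma> i j \<in> H"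
  shows "H = \<Gamma>"
proof -
  define S where "S = range (\<lambda>i::'v. {i}) \<union> E \<union> F"
  have S_nonempty: "\<sigma> \<noteq> {}" if "\<sigma> \<in> S" for \<sigma>
    using that card_edge[of \<sigma>] card_face[of \<sigma>] by (auto simp: S_def)
  have S_edge: "{i, j} \<in> E" if ij: "\<sigma> \<in> S" "i \<in> \<sigma>" "j \<in> \<sigma>" "i \<noteq> j" for \<sigma> i j
  proof -
    have c2: "card {i, j} = 2" using ij(4) by simp
    have "\<sigma> \<in> E \<or> \<sigma> \<in> F" using ij by (auto simp: S_def)
    then show ?thesis
    proof
      assume e: "\<sigma> \<in> E"
      then have "finite \<sigma>" by simp
      then have "{i, j} = \<sigma>" using card_edge[OF e] c2 ij by (intro card_subset_eq) auto
      then show ?thesis using e by simp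
    next
      assume "\<sigma> \<in> F"
      then show ?thesis using face_edge[of \<sigma> "{i, j}"] ij c2 by auto
    qed
  qed
  have cell1: "cell {i} = {vertex i}" for i :: 'v by (simp add: cell_def)
  have X_eq: "carrier_2 E F = (\<Union>\<sigma>\<in>S. cell \<sigma>)"
    by (auto simp: carrier_2_def carrier_1_def S_def cell1)
  define b where "b \<sigma> = (SOME i. i \<in> \<sigma>)" for \<sigma> :: "'v set"
  have b: "b \<sigma> \<in> \<sigma>" if "\<sigma> \<in> S" for \<sigma>
    using S_nonempty[OF that] unfolding b_def by (simp add: some_in_eq)
  \<comment> \<open>A reference lift of every simplex, anchored at the lifted position of one chosen
    vertex.\<close>
  define l where "l \<sigma> = (SOME p. lifting (cell \<sigma>) p \<and> p (vertex (b \<sigma>)) = base (b \<sigma>))" for \<sigma>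
  have l: "lifting (cell \<sigma>) (l \<sigma>) \<and> l \<sigma> (vertex (b \<sigma>)) = base (b \<sigma>)" if s: "\<sigma> \<in> S" for \<sigma>
  proof -
    have "cell \<sigma> \<subseteq> carrier_2 E F" using s X_eq by blast
    then have "\<exists>p. lifting (cell \<sigma>) p \<and> p (vertex (b \<sigma>)) = base (b \<sigma>)"
      using lifting_exists[OF convex_cell _ vertex_in_cell[OF b[OF s]] base_disk cov_base] by metis
    then show ?thesis unfolding l_def by (rule someI_ex)
  qed
  \<comment> \<open>The edge from the anchor to j lies in the simplex, so by uniqueness of lifts its
    edge element, a member of \<open>H\<close>, carries \<open>base j\<close> to the corresponding
    vertex of the lifted simplex.\<close>
  have l_vertex: "\<exists>g\<in>H. l \<sigma> (vertex j) = g (base j)" if s: "\<sigma> \<in> S" and j: "j \<in> \<sigma>" for \<sigma> j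
  proof (cases "j = b \<sigma>")
    case True
    then have "l \<sigma> (vertex j) = disk_id (base j)"
      using l[OF s] base_disk[of j] by (simp only: restrict_apply')
    then show ?thesis using H(2) by blast
  next
    case False
    have e: "{b \<sigma>, j} \<in> E" using S_edge[OF s b[OF s] j] False by blast
    have sub: "cell {b \<sigma>, j} \<subseteq> cell \<sigma>" using b[OF s] j by (intro cell_mono) auto
    obtain p where p: "lifting (cell {b \<sigma>, j}) p" "p (vertex (b \<sigma>)) = base (b \<sigma>)"
        "p (vertex j) = \<gamma> (b \<sigma>) j (base j)"
      using edge_element_lifting[OF e] by metis
    have "l \<sigma> (vertex j) = p (vertex j)"
    proof (rule lifting_unique[OF lifting_subset[OF conjunct1[OF l[OF s]] sub] p(1) convex_connected[OF convex_cell]])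
      show "vertex (b \<sigma>) \<in> cell {b \<sigma>, j}" "vertex j \<in> cell {b \<sigma>, j}" by (simp_all add: vertex_in_cell)
      show "l \<sigma> (vertex (b \<sigma>)) = p (vertex (b \<sigma>))" using l[OF s] p(2) by simp
    qed
    then show ?thesis using p(3) edges[OF e] by metis
  qed
  define K where "K = (\<Union>\<sigma>\<in>S. l \<sigma> ` cell \<sigma>)"
  have K: "compact K" "K \<subseteq> disk"
  proof -
    show "K \<subseteq> disk" unfolding K_def using l lifting_disk by blast
    have "finite S" by (rule finite)
    then show "compact K"
      unfolding K_def using l
      by (intro compact_UN compact_continuous_image compact_cell) (auto simp: lifting_def)
  qed
  obtain \<rho> where \<rho>: "0 \<le> \<rho>" "\<And>k. k \<in> K \<Longrightarrow> hdist 0 k \<le> \<rho>" using compact_disk_hdist[OF K] by metis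
  define C where "C M = (\<Union>g\<in>M. g ` K)" for M :: "(complex \<Rightarrow> complex) set"
  have 0: "(0::complex) \<in> disk" by simp
  \<comment> \<open>The translates of the compact set \<open>K\<close> are locally finite, so the
    union of any family of them is closed in the disk.\<close>
  have openC: "open (disk - C M)" if M: "M \<subseteq> \<Gamma>" for M
  proof (subst open_subopen, intro ballI)
    fix z assume z: "z \<in> disk - C M"
    then have zd: "z \<in> disk" by blast
    \<comment> \<open>If the translate by g meets the unit ball about z, then 0 and g 0 are at most
      this far apart: from 0 to z, at most 1 to the common point, and at most \<rho> from there to g
      0.\<close>
    define N where "N = {g \<in> M. hdist 0 (g 0) \<le> hdist 0 z + 1 + \<rho>}"
    have "N \<subseteq> {g \<in> \<Gamma>. hdist 0 (g 0) \<le> hdist 0 z + 1 + \<rho>}" using M by (auto simp: N_def)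
    then have N: "finite N" by (rule finite_subset[OF _ finite_group_bounded])
    have contg: "continuous_on K g" if "g \<in> \<Gamma>" for g
      using group_isometry[OF that] K(2) unfolding disk_isometry_def
      by (meson continuous_on_subset holomorphic_on_imp_continuous_on)
    define W where "W = (disk \<inter> hdist z -` {..<1}) - (\<Union>g\<in>N. g ` K)"
    have "compact (\<Union>g\<in>N. g ` K)"
      using N M contg K(1) by (intro compact_UN compact_continuous_image) (auto simp: N_def)
    moreover have "open (disk \<inter> hdist z -` {..<1})"
      by (rule continuous_open_preimage[OF continuous_on_hdist[OF zd]]) auto
    ultimately have "open W" unfolding W_def by (intro open_Diff compact_imp_closed)
    moreover have "z \<in> W" using z zd by (auto simp: W_def C_def N_def)
    moreover have "W \<subseteq> disk - C M"
    proof
      fix w assume w: "w \<in> W"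
      then have wd: "w \<in> disk" "hdist z w < 1" by (auto simp: W_def)
      have "w \<notin> C M"
      proof
        assume "w \<in> C M"
        then obtain g k where gk: "g \<in> M" "k \<in> K" "w = g k" by (auto simp: C_def)
        have g: "g \<in> \<Gamma>" and k: "k \<in> disk" using gk M K by auto
        have "hdist 0 (g 0) \<le> hdist 0 z + hdist z (g 0)" by (rule hdist_triangle[OF 0 zd group_disk[OF g 0]])
        also have "hdist z (g 0) \<le> hdist z w + hdist w (g 0)" by (rule hdist_triangle[OF zd wd(1) group_disk[OF g 0]])
        also have "hdist w (g 0) = hdist 0 k"
          using group_hdist[OF g k 0] hdist_commute[OF k 0] by (simp add: gk(3))
        finally have "g \<in> N" using wd(2) \<rho>(2)[OF gk(2)] gk(1) by (simp add: N_def)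
        then show False using w gk by (auto simp: W_def)
      qed
      then show "w \<in> disk - C M" using wd by blast
    qed
    ultimately show "\<exists>T. open T \<and> z \<in> T \<and> T \<subseteq> disk - C M" by blast
  qed
  have cover: "z \<in> C H \<or> z \<in> C (\<Gamma> - H)" if z: "z \<in> disk" for z
  proof -
    obtain \<sigma> where s: "\<sigma> \<in> S" "cov z \<in> cell \<sigma>" using cov_in[OF z] X_eq by blast
    have ls: "l \<sigma> (cov z) \<in> disk" "cov (l \<sigma> (cov z)) = cov z"
      using l[OF s(1)] s(2) lifting_disk lifting_cov by blast+
    then obtain g where "g \<in> \<Gamma>" "z = g (l \<sigma> (cov z))" using cov_eq_iff[OF z ls(1)] by metis
    then show ?thesis using s unfolding C_def K_def by blast
  qed
  \<comment> \<open>Lifted simplices with a common point have a common vertex, since the projection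
    of that point lies in the cell of the common vertices; over this cell the two lifts agree.
    Comparison at the vertex expresses g' through g and two elements of \<open>H\<close>.\<close>
  have disjoint: "C H \<inter> C (\<Gamma> - H) = {}"
  proof (rule ccontr)
    assume "C H \<inter> C (\<Gamma> - H) \<noteq> {}"
    then obtain g g' \<sigma> \<sigma>' s s' where *: "g \<in> H" "g' \<in> \<Gamma> - H" "\<sigma> \<in> S" "\<sigma>' \<in> S" "s \<in> cell \<sigma>" "s' \<in> cell \<sigma>'"
        "g (l \<sigma> s) = g' (l \<sigma>' s')" unfolding C_def K_def by blast
    have g: "g \<in> \<Gamma>" "g' \<in> \<Gamma>" using * H(1) by auto
    have lg: "lifting (cell \<sigma>) (\<lambda>s. g (l \<sigma> s))" "lifting (cell \<sigma>') (\<lambda>s. g' (l \<sigma>' s))"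
      using lifting_group l *(3,4) g by blast+
    have ss: "s = s'" using lifting_cov[OF lg(1) *(5)] lifting_cov[OF lg(2) *(6)] *(7) by simp
    have si: "s \<in> cell (\<sigma> \<inter> \<sigma>')" using *(5,6) ss cell_Int by blast
    then obtain j where j: "j \<in> \<sigma>" "j \<in> \<sigma>'" using cell_empty by (metis Int_iff all_not_in_conv)
    have "g (l \<sigma> (vertex j)) = g' (l \<sigma>' (vertex j))"
    proof (rule lifting_unique[of "cell (\<sigma> \<inter> \<sigma>')" "\<lambda>s. g (l \<sigma> s)" "\<lambda>s. g' (l \<sigma>' s)" s])
      show "lifting (cell (\<sigma> \<inter> \<sigma>')) (\<lambda>s. g (l \<sigma> s))" by (rule lifting_subset[OF lg(1) cell_mono]) blast
      show "lifting (cell (\<sigma> \<inter> \<sigma>')) (\<lambda>s. g' (l \<sigma>' s))" by (rule lifting_subset[OF lg(2) cell_mono]) blast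
      show "connected (cell (\<sigma> \<inter> \<sigma>'))" by (rule convex_connected[OF convex_cell])
      show "s \<in> cell (\<sigma> \<inter> \<sigma>')" by (rule si)
      show "g (l \<sigma> s) = g' (l \<sigma>' s)" using *(7) ss by simp
      show "vertex j \<in> cell (\<sigma> \<inter> \<sigma>')" using j by (intro vertex_in_cell) blast
    qed
    moreover obtain k where k: "k \<in> H" "l \<sigma> (vertex j) = k (base j)" using l_vertex[OF *(3) j(1)] by blast
    moreover obtain k' where k': "k' \<in> H" "l \<sigma>' (vertex j) = k' (base j)" using l_vertex[OF *(4) j(2)] by blast
    ultimately have "compose disk g k (base j) = compose disk g' k' (base j)" by (simp only: compose_eq base_disk)
    then have eq: "compose disk g k = compose disk g' k'"
      using group_free[OF group_compose[OF g(1)] group_compose[OF g(2)] base_disk[of j]] k(1) k'(1) H(1) by blast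
    have "g' = compose disk (compose disk g k) (disk_inv k')"
    proof (rule group_eqI)
      show "g' \<in> \<Gamma>" by (rule g(2))
      show "compose disk (compose disk g k) (disk_inv k') \<in> \<Gamma>"
        by (rule subsetD[OF H(1) H(3)[OF H(3)[OF *(1) k(1)] H(4)[OF k'(1)]]])
      fix z assume z: "z \<in> disk"
      have k'G: "k' \<in> \<Gamma>" using k' H(1) by blast
      have d: "disk_inv k' z \<in> disk" by (rule group_disk[OF group_inv[OF k'G] z])
      show "g' z = compose disk (compose disk g k) (disk_inv k') z"
        unfolding eq compose_eq[OF z] compose_eq[OF d] group_inv_right[OF k'G z] ..
    qed
    also have "\<dots> \<in> H" using H(3)[OF H(3)[OF *(1) k(1)] H(4)[OF k'(1)]] .
    finally show False using *(2) by blast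
  qed
  obtain i :: 'v where True by simp
  have iS: "{i} \<in> S" by (simp add: S_def)
  have "l {i} (vertex (b {i})) \<in> l {i} ` cell {i}" using vertex_in_cell[OF b[OF iS]] by blast
  then have K_ne: "l {i} (vertex (b {i})) \<in> K" using iS unfolding K_def by blast
  have "(disk - C H) \<inter> disk = {} \<or> (disk - C (\<Gamma> - H)) \<inter> disk = {}"
  proof (rule connectedD)
    show "connected disk" by (rule convex_connected[OF convex_ball])
    show "open (disk - C H)" by (rule openC[OF H(1)])
    show "open (disk - C (\<Gamma> - H))" by (rule openC) blast
    show "(disk - C H) \<inter> (disk - C (\<Gamma> - H)) \<inter> disk = {}" using cover by blast
    show "disk \<subseteq> (disk - C H) \<union> (disk - C (\<Gamma> - H))" using disjoint by blast
  qed
  moreover have "(disk - C (\<Gamma> - H)) \<inter> disk \<noteq> {}"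
  proof -
    have kd: "l {i} (vertex (b {i})) \<in> disk" using K_ne K(2) by blast
    then have "l {i} (vertex (b {i})) = disk_id (l {i} (vertex (b {i})))" by (simp only: restrict_apply')
    then have "l {i} (vertex (b {i})) \<in> C H" using K_ne H(2) unfolding C_def by blast
    then show ?thesis using disjoint kd by blast
  qed
  ultimately have "disk \<subseteq> C H" by blast
  have "\<Gamma> - H = {}"
  proof (rule ccontr)
    assume "\<Gamma> - H \<noteq> {}"
    then obtain g where g: "g \<in> \<Gamma> - H" by blast
    then have "g (l {i} (vertex (b {i}))) \<in> C (\<Gamma> - H)" using K_ne unfolding C_def by blast
    moreover have "g (l {i} (vertex (b {i}))) \<in> disk" using g group_disk K_ne K(2) by blast
    ultimately show False using disjoint \<open>disk \<subseteq> C H\<close> by blast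
  qed
  then show ?thesis using H(1) by blast
qed

text \<open>The elements that commute with a form a subgroup containing the edge elements, so they
  are all of \<Gamma>, and a is central.\<close>

lemma centralizer_trivial:
  assumes a: "a \<in> \<Gamma>" and comm: "\<And>i j z. {i, j} \<in> E \<Longrightarrow> z \<in> disk \<Longrightarrow> a (\<gamma> i j z) = \<gamma> i j (a z)"
  shows "a = disk_id"
proof (rule center_trivial[OF a])
  define H where "H = {g \<in> \<Gamma>. \<forall>z\<in>disk. a (g z) = g (a z)}"
  note ad = group_disk[OF a]
  have "H = \<Gamma>"
  proof (rule edge_elements_generate)
    show "H \<subseteq> \<Gamma>" by (auto simp: H_def)
    have "a (disk_id z) = disk_id (a z)" if z: "z \<in> disk" for z
      by (simp only: restrict_apply' z ad[OF z])
    then show "disk_id \<in> H" using group_id unfolding H_def by blast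
    show "\<gamma> i j \<in> H" if "{i, j} \<in> E" for i j
      using comm[OF that] edge_element_in[OF that] by (simp add: H_def)
  next
    fix g h assume gh: "g \<in> H" "h \<in> H"
    then have G: "g \<in> \<Gamma>" "h \<in> \<Gamma>" by (auto simp: H_def)
    have "a (compose disk g h z) = compose disk g h (a z)" if z: "z \<in> disk" for z
    proof -
      have "a (g (h z)) = g (a (h z))" using gh group_disk[OF G(2) z] unfolding H_def by blast
      also have "a (h z) = h (a z)" using gh z unfolding H_def by blast
      finally show ?thesis by (simp only: compose_eq z ad[OF z])
    qed
    then show "compose disk g h \<in> H" using group_compose[OF G] unfolding H_def by blast
  next
    fix g assume g: "g \<in> H"
    then have G: "g \<in> \<Gamma>" by (auto simp: H_def)
    have "a (disk_inv g z) = disk_inv g (a z)" if z: "z \<in> disk" for z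
    proof -
      have d: "disk_inv g z \<in> disk" by (rule group_disk[OF group_inv[OF G] z])
      have "a (g (disk_inv g z)) = g (a (disk_inv g z))" using g d unfolding H_def by blast
      then have "a z = g (a (disk_inv g z))" by (simp only: group_inv_right[OF G z])
      then show ?thesis using group_inv_left[OF G ad[OF d]] by metis
    qed
    then show "disk_inv g \<in> H" using group_inv[OF G] unfolding H_def by blast
  qed
  then show "a (g z) = g (a z)" if "g \<in> \<Gamma>" "z \<in> disk" for g z
    using that unfolding H_def by blast
qed

text \<open>On tree edges the group element is trivial, so bounded lengths keep the positions of all
  vertices within some M of each other. Each edge element s then moves any vertex by at most 2 M +
  d: go to x $ i, cross the edge to s (x $ j), and return by a translated distance of at most M.
  Since the edge elements have trivial centralizer, \<open>bounded_displacement\<close> confines the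
  vertex.\<close>

lemma lengths_bounded_imp_confined:
  obtains R where "R < 1" "\<And>x i. x \<in> realizations \<Longrightarrow>
    (\<And>i j. {i, j} \<in> E \<Longrightarrow> hdist (x $ i) (\<gamma> i j (x $ j)) \<le> d) \<Longrightarrow> cmod (x $ i) \<le> R"
proof -
  define good where "good x \<longleftrightarrow> x \<in> realizations \<and> (\<forall>i j. {i, j} \<in> E \<longrightarrow> hdist (x $ i) (\<gamma> i j (x $ j)) \<le> d)"
    for x :: "complex ^ 'v"
  have gd: "x $ i \<in> disk" if "good x" for x i using that by (simp add: good_def realizations_def)
  have tree_dist: "\<exists>N. \<forall>x. good x \<longrightarrow> hdist (x $ i) (x $ j) \<le> N" for i j
  proof -
    have "(i, j) \<in> {(a, b). {a, b} \<in> T}\<^sup>*" using tree by (simp add: spanning_tree_def edge_connected_def)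
    then show ?thesis
    proof (induction rule: rtrancl_induct)
      case base
      show ?case using gd by (intro exI[of _ 0]) auto
    next
      case (step k m)
      then obtain N where N: "\<And>x. good x \<Longrightarrow> hdist (x $ i) (x $ k) \<le> N" by blast
      have km: "{k, m} \<in> T" using step by simp
      then have kmE: "{k, m} \<in> E" using tree by (auto simp: spanning_tree_def)
      have "hdist (x $ i) (x $ m) \<le> N + d" if x: "good x" for x
      proof -
        have "\<gamma> k m (x $ m) = x $ m"
          unfolding edge_element_tree[OF km] using gd[OF x, of m] by (simp only: restrict_apply')
        then have "hdist (x $ k) (x $ m) \<le> d" using x kmE unfolding good_def by metis
        then show ?thesis using N[OF x] hdist_triangle[OF gd[OF x] gd[OF x] gd[OF x], of i m k] by linarith
      qed
      then show ?case by blast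
    qed
  qed
  then obtain N where N: "\<And>i j x. good x \<Longrightarrow> hdist (x $ i) (x $ j) \<le> N i j" by metis
  define M where "M = (\<Sum>(i, j)\<in>UNIV. \<bar>N i j\<bar>)"
  have M: "hdist (x $ i) (x $ j) \<le> M" if "good x" for x i j
  proof -
    have "(case (i, j) of (i, j) \<Rightarrow> \<bar>N i j\<bar>) \<le> M" unfolding M_def by (rule member_le_sum) auto
    then show ?thesis using N[OF that, of i j] by simp
  qed
  define S where "S = (\<lambda>(i, j). \<gamma> i j) ` {(i, j). {i, j} \<in> E}"
  have S: "finite S" "S \<subseteq> \<Gamma>" unfolding S_def using edge_element_in by (auto intro: finite_imageI)
  have "a = disk_id" if "a \<in> \<Gamma>" "\<And>s z. s \<in> S \<Longrightarrow> z \<in> disk \<Longrightarrow> a (s z) = s (a z)" for a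
    using that by (intro centralizer_trivial) (auto simp: S_def simp del: mem_ball_0)
  then obtain B where B: "\<And>z. z \<in> disk \<Longrightarrow> (\<And>s. s \<in> S \<Longrightarrow> hdist z (s z) \<le> 2 * M + d) \<Longrightarrow> hdist 0 z \<le> B"
    using bounded_displacement[OF S, of "2 * M + d"] by metis
  show ?thesis
  proof (rule that[OF tanh_real_lt_1])
    fix x o' assume x: "x \<in> realizations" "\<And>i j. {i, j} \<in> E \<Longrightarrow> hdist (x $ i) (\<gamma> i j (x $ j)) \<le> d"
    then have g: "good x" by (simp add: good_def)
    note xd = gd[OF g]
    have "hdist (x $ o') (s (x $ o')) \<le> 2 * M + d" if s: "s \<in> S" for s
    proof -
      obtain i j where ij: "{i, j} \<in> E" "s = \<gamma> i j" using s by (auto simp: S_def)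
      have sG: "s \<in> \<Gamma>" using s S by blast
      note sd = group_disk[OF sG xd]
      have "hdist (x $ o') (s (x $ o')) \<le> hdist (x $ o') (x $ i) + hdist (x $ i) (s (x $ o'))"
        by (rule hdist_triangle[OF xd xd sd])
      also have "hdist (x $ i) (s (x $ o')) \<le> hdist (x $ i) (s (x $ j)) + hdist (s (x $ j)) (s (x $ o'))"
        by (rule hdist_triangle[OF xd sd sd])
      also have "hdist (s (x $ j)) (s (x $ o')) = hdist (x $ j) (x $ o')" by (rule group_hdist[OF sG xd xd])
      finally show ?thesis using M[OF g, of o' i] M[OF g, of j o'] x(2)[OF ij(1)] ij(2) by simp
    qed
    then have "hdist 0 (x $ o') \<le> B" by (rule B[OF xd])
    then show "cmod (x $ o') \<le> tanh (B / 2)" by (rule cmod_le_of_hdist[OF xd])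
  qed
qed

lemma is_isometry_graph:
  assumes c: "\<And>i j. {i, j} \<in> E \<Longrightarrow> c i j > 0"
  shows "isometry_graph {(i, j). {i, j} \<in> E} c \<gamma> (\<lambda>i j. disk_inv (\<gamma> i j)) (dirichlet_energy E c \<gamma>)"
proof (rule isometry_graph.intro)
  show D: "dirichlet_energy E c \<gamma> x
      = 1/4 * (\<Sum>(i, j)\<in>{(i, j). {i, j} \<in> E}. c i j * (hdist (x $ i) (\<gamma> i j (x $ j)))\<^sup>2)" for x
    by (simp add: dirichlet_energy_def realized_length_def)
  fix L :: real
  \<comment> \<open>Energy at most L bounds each single summand c i j times the squared length by 4
    |L|; the sum of the resulting length bounds is a common bound for all edges.\<close>
  define d where "d = (\<Sum>(i, j)\<in>{(i, j). {i, j} \<in> E}. sqrt (4 * \<bar>L\<bar> / c i j))"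
  obtain R where R: "R < 1" "\<And>x i. x \<in> realizations \<Longrightarrow>
      (\<And>i j. {i, j} \<in> E \<Longrightarrow> hdist (x $ i) (\<gamma> i j (x $ j)) \<le> d) \<Longrightarrow> cmod (x $ i) \<le> R"
    using lengths_bounded_imp_confined[of d] by metis
  have "hdist (x $ i) (\<gamma> i j (x $ j)) \<le> d"
    if x: "x \<in> realizations" "dirichlet_energy E c \<gamma> x \<le> L" and e: "{i, j} \<in> E" for x i j
  proof -
    have "(case (i, j) of (i, j) \<Rightarrow> c i j * (hdist (x $ i) (\<gamma> i j (x $ j)))\<^sup>2)
        \<le> (\<Sum>(i, j)\<in>{(i, j). {i, j} \<in> E}. c i j * (hdist (x $ i) (\<gamma> i j (x $ j)))\<^sup>2)"
      using e c by (intro member_le_sum) (auto intro!: mult_nonneg_nonneg less_imp_le[OF c])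
    also have "\<dots> \<le> 4 * \<bar>L\<bar>" using x(2) unfolding D by linarith
    finally have "(hdist (x $ i) (\<gamma> i j (x $ j)))\<^sup>2 \<le> 4 * \<bar>L\<bar> / c i j"
      using c[OF e] by (simp add: pos_le_divide_eq mult.commute)
    then have "hdist (x $ i) (\<gamma> i j (x $ j)) \<le> sqrt (4 * \<bar>L\<bar> / c i j)" by (rule real_le_rsqrt)
    also have "\<dots> = (case (i, j) of (i, j) \<Rightarrow> sqrt (4 * \<bar>L\<bar> / c i j))" by simp
    also have "\<dots> \<le> d"
      unfolding d_def using e by (intro member_le_sum) (auto intro!: divide_nonneg_pos c)
    finally show ?thesis .
  qed
  then show "\<exists>R<1. \<forall>x\<in>realizations. dirichlet_energy E c \<gamma> x \<le> L \<longrightarrow> (\<forall>i. cmod (x $ i) \<le> R)"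
    using R by blast
next
  fix i j assume "(i, j) \<in> {(i, j). {i, j} \<in> E}"
  then have e: "{i, j} \<in> E" by simp
  show "c i j > 0" by (rule c[OF e])
  show "disk_isometry (\<gamma> i j)" "disk_isometry (disk_inv (\<gamma> i j))"
    using group_isometry group_inv edge_element_in[OF e] by blast+
  show "\<gamma> i j (disk_inv (\<gamma> i j) z) = z" if "z \<in> disk" for z
    by (rule group_inv_right[OF edge_element_in[OF e] that])
qed

end

theorem mainTheorem1:
  fixes \<Gamma>\<^sub>1 \<Gamma>\<^sub>2 :: "(complex \<Rightarrow> complex) set"
    and E F T :: "'v::finite set set"
    and \<tau> :: "real ^ 'v \<Rightarrow> complex set"
    and h :: "complex set \<Rightarrow> complex set"
    and q :: "real ^ 'v \<Rightarrow> complex"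
    and g :: nat
    and c :: "'v \<Rightarrow> 'v \<Rightarrow> real"
    and D :: "complex ^ 'v \<Rightarrow> real"
  assumes S1: "closed_surface_group \<Gamma>\<^sub>1"
    and triangulation: "geodesic_triangulation \<Gamma>\<^sub>1 E F \<tau>"
    and genus: "g \<ge> 2" "int CARD('v) - int (card E) + int (card F) = 2 - 2 * int g"
    and c_def: "c = canonical_weight \<Gamma>\<^sub>1 F \<tau>"
    and c_pos: "\<And>i j. {i, j} \<in> E \<Longrightarrow> c i j > 0"
    and S2: "closed_surface_group \<Gamma>\<^sub>2"
    and h: "homeomorphic_map (surface \<Gamma>\<^sub>1) (surface \<Gamma>\<^sub>2) h"
    and tree: "spanning_tree E T"
    and lift: "is_lift \<Gamma>\<^sub>2 (carrier_1 T) (h \<circ> \<tau>) q"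
    and D_def: "D = dirichlet_energy E c (edge_element \<Gamma>\<^sub>2 (h \<circ> \<tau>) q)"
  shows "(\<forall>K. compact K \<longrightarrow> compact {x \<in> realizations. D x \<in> K})
    \<and> (\<forall>x\<in>realizations. D differentiable (at x))
    \<and> (\<exists>f\<in>realizations. (\<forall>x\<in>realizations. D f \<le> D x)
        \<and> (\<forall>f'\<in>realizations. (\<forall>x\<in>realizations. D f' \<le> D x) \<longrightarrow> f' = f)
        \<and> (\<forall>f\<^sub>0\<in>realizations. \<exists>x. negative_gradient_flow D {0..} f\<^sub>0 x
            \<and> (\<forall>b>0. \<forall>y. negative_gradient_flow D {0..<b} f\<^sub>0 y \<longrightarrow> (\<forall>t\<in>{0..<b}. y t = x t))
            \<and> (\<exists>C>0. \<exists>\<kappa>>0. \<forall>t\<ge>0. riem_dist (x t) f \<le> C * exp (- \<kappa> * t))))"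
proof -
  have tri: "\<forall>e\<in>E. card e = 2" "\<forall>f\<in>F. card f = 3" "\<forall>f\<in>F. \<forall>e. e \<subseteq> f \<and> card e = 2 \<longrightarrow> e \<in> E"
      "homeomorphic_map (top_of_set (carrier_2 E F)) (surface \<Gamma>\<^sub>1) \<tau>"
    using triangulation unfolding geodesic_triangulation_def by simp_all
  \<comment> \<open>Composition with \<open>h\<close> carries the triangulation over to the second
    surface, as a homeomorphism from the same complex.\<close>
  interpret triangulated_target \<Gamma>\<^sub>2 E F "h \<circ> \<tau>" T q
  proof
    show "closed_surface_group \<Gamma>\<^sub>2" by (rule S2)
    show "homeomorphic_map (top_of_set (carrier_2 E F)) (surface \<Gamma>\<^sub>2) (h \<circ> \<tau>)"
      by (rule homeomorphic_map_compose[OF tri(4) h])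
    show "card e = 2" if "e \<in> E" for e using tri(1) that by simp
    show "card f = 3" if "f \<in> F" for f using tri(2) that by simp
    show "e \<in> E" if "f \<in> F" "e \<subseteq> f" "card e = 2" for f e using tri(3) that by simp
    show "spanning_tree E T" by (rule tree)
    show "is_lift \<Gamma>\<^sub>2 (carrier_1 T) (h \<circ> \<tau>) q" by (rule lift)
  qed
  show ?thesis
    unfolding D_def by (rule isometry_graph.gradient_flow_converges[OF is_isometry_graph[OF c_pos]])
qed

end
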